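(* Let $\theta\in\mathbb R\setminus\mathbb Q$ and let $\Gamma$ be one of the cyclic subgroups $\mathbb Z_3,\mathbb Z_4,\mathbb Z_6$ of $SL(2,\mathbb Z)$ described in the context. Then the periodic cyclic cohomology of $\mathcal A_\theta^{alg}\rtimes\Gamma$ satisfies $HP^{even}(\mathcal A_\theta^{alg}\rtimes\Gamma)\cong\mathbb C^8$ for $\Gamma=\mathbb Z_3$, $\cong\mathbb C^9$ for $\Gamma=\mathbb Z_4$, $\cong\mathbb C^{10}$ for $\Gamma=\mathbb Z_6$, and $HP^{odd}(\mathcal A_\theta^{alg}\rtimes\Gamma)\cong 0$ for $\Gamma=\mathbb Z_3,\mathbb Z_4,\mathbb Z_6$.
   Context: Let $\lambda=e^{2\pi i\theta}$ and for $s\in\mathbb R$ write $\lambda^s:=e^{2\pi i\theta s}$. The algebraic noncommutative torus $\mathcal A_\theta^{alg}$ is the complex algebra of finite sums $\sum_{(n,m)\in\mathbb Z^2}a_{n,m}U_1^nU_2^m$, where $U_1,U_2$ are invertible generators with $U_2U_1=\lambda U_1U_2$. An element $g=\begin{pmatrix}g_{11}&g_{12}\\ g_{21}&g_{22}\end{pmatrix}\in SL(2,\mathbb Z)$ acts by the automorphism determined by $g\cdot U_1=e^{\pi i g_{11}g_{21}\theta}U_1^{g_{11}}U_2^{g_{21}}$, $g\cdot U_2=e^{\pi i g_{12}g_{22}\theta}U_1^{g_{12}}U_2^{g_{22}}$. The subgroup $\mathbb Z_3$ is generated by $\omega=\begin{pmatrix}0&1\\-1&-1\end{pmatrix}$ (so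 $U_1\mapsto U_2^{-1}$, $U_2\mapsto\lambda^{-1/2}U_1U_2^{-1}$); $\mathbb Z_4$ is generated by an element acting by $U_1\mapsto U_2^{-1}$, $U_2\mapsto U_1$; $\mathbb Z_6$ is generated by $-\omega=\begin{pmatrix}0&-1\\1&1\end{pmatrix}$ (so $U_1\mapsto U_2$, $U_2\mapsto\lambda^{-1/2}U_1^{-1}U_2$). The crossed product $\mathcal A_\theta^{alg}\rtimes\Gamma$ is $\mathcal A_\theta^{alg}\otimes\mathbb C\Gamma$ with product $(a\otimes g)(b\otimes h)=a(g\cdot b)\otimes gh$. $HP^{even}$, $HP^{odd}$ denote Connes' periodic cyclic cohomology (the direct limits of $HC^{2n}$, resp. $HC^{2n+1}$, under the periodicity operator $S$). *)

theory Defs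
  imports Complex_Main
begin

text \<open>An element of the algebraic noncommutative torus is a finitely supported
  coefficient function a with element = sum of a(n,m) U1^n U2^m.\<close>

type_synonym torus = "int \<times> int \<Rightarrow> complex"

definition lam_pow :: "real \<Rightarrow> real \<Rightarrow> complex" where
  "lam_pow \<theta> s = cis (2 * pi * \<theta> * s)"

definition tmono :: "int \<times> int \<Rightarrow> torus" where
  "tmono p = (\<lambda>q. if q = p then 1 else 0)"

definition tone :: torus where "tone = tmono (0, 0)"

definition tscale :: "complex \<Rightarrow> torus \<Rightarrow> torus" where
  "tscale c f = (\<lambda>q. c * f q)"

definition tsupp :: "torus \<Rightarrow> (int \<times> int) set" where
  "tsupp f = {q. f q \<noteq> 0}"

text \<open>Product, from the relation U2 U1 = lambda U1 U2, i.e.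
  (U1^a U2^b)(U1^c U2^d) = lambda^(b c) U1^(a+c) U2^(b+d).\<close>
definition tmult :: "real \<Rightarrow> torus \<Rightarrow> torus \<Rightarrow> torus" where
  "tmult \<theta> f g = (\<lambda>(p, q). \<Sum>x\<in>tsupp f. \<Sum>y\<in>tsupp g.
      if fst x + fst y = p \<and> snd x + snd y = q
      then f x * g y * lam_pow \<theta> (real_of_int (snd x * fst y)) else 0)"

definition tinv :: "real \<Rightarrow> torus \<Rightarrow> torus" where
  "tinv \<theta> x = (THE y. tmult \<theta> x y = tone \<and> tmult \<theta> y x = tone)"

definition tpow :: "real \<Rightarrow> torus \<Rightarrow> int \<Rightarrow> torus" where
  "tpow \<theta> x n = (if 0 \<le> n then (tmult \<theta> x ^^ nat n) tone
                   else (tmult \<theta> (tinv \<theta> x) ^^ nat (- n)) tone)"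

type_synonym mat2 = "int \<times> int \<times> int \<times> int"

definition mat2_mult :: "mat2 \<Rightarrow> mat2 \<Rightarrow> mat2" where
  "mat2_mult A B = (case A of (a11, a12, a21, a22) \<Rightarrow> case B of (b11, b12, b21, b22) \<Rightarrow>
     (a11 * b11 + a12 * b21, a11 * b12 + a12 * b22,
      a21 * b11 + a22 * b21, a21 * b12 + a22 * b22))"

definition mat2_id :: mat2 where "mat2_id = (1, 0, 0, 1)"

definition mat2_pow :: "mat2 \<Rightarrow> nat \<Rightarrow> mat2" where
  "mat2_pow g k = (mat2_mult g ^^ k) mat2_id"

definition act_U1 :: "real \<Rightarrow> mat2 \<Rightarrow> torus" where
  "act_U1 \<theta> g = (case g of (g11, g12, g21, g22) \<Rightarrow>
     tscale (cis (pi * real_of_int (g11 * g21) * \<theta>)) (tmono (g11, g21)))"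

definition act_U2 :: "real \<Rightarrow> mat2 \<Rightarrow> torus" where
  "act_U2 \<theta> g = (case g of (g11, g12, g21, g22) \<Rightarrow>
     tscale (cis (pi * real_of_int (g12 * g22) * \<theta>)) (tmono (g12, g22)))"

definition act :: "real \<Rightarrow> mat2 \<Rightarrow> torus \<Rightarrow> torus" where
  "act \<theta> g f = (\<lambda>z. \<Sum>p\<in>tsupp f.
      f p * tmult \<theta> (tpow \<theta> (act_U1 \<theta> g) (fst p)) (tpow \<theta> (act_U2 \<theta> g) (snd p)) z)"

text \<open>Basis of A rtimes Gamma, Gamma = {g^j | j < N}: the element U1^n U2^m (x) g^j
  is indexed by ((n,m), j) with j < N.\<close>

definition cp_basis :: "nat \<Rightarrow> ((int \<times> int) \<times> nat) set" where
  "cp_basis N = {x. snd x < N}"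

text \<open>Product of two basis elements, (a (x) g^j)(b (x) g^k) = a (g^j . b) (x) g^(j+k),
  written as a coefficient function on the basis.\<close>
definition cp_mult :: "real \<Rightarrow> mat2 \<Rightarrow> nat \<Rightarrow> (int \<times> int) \<times> nat \<Rightarrow> (int \<times> int) \<times> nat
     \<Rightarrow> ((int \<times> int) \<times> nat \<Rightarrow> complex)" where
  "cp_mult \<theta> g N x y = (\<lambda>(r, l).
     if l = (snd x + snd y) mod N
     then tmult \<theta> (tmono (fst x)) (act \<theta> (mat2_pow g (snd x)) (tmono (fst y))) r
     else 0)"

definition cp_unit :: "(int \<times> int) \<times> nat" where "cp_unit = ((0, 0), 0)"

text \<open>An algebra is given by a basis index set Bs, the product of basis elements
  (as a finitely supported coefficient function) and the index of the unit
  (the unit is a basis element). A multilinear (k+1)-linear functional on the algebra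
  is the same as an arbitrary function on (k+1)-tuples of basis indices; we represent
  a family of cochains of all Hochschild degrees by one function on lists of basis
  indices: its values on lists of length k+1 form the degree k component.\<close>

definition ext_at :: "('b list \<Rightarrow> complex) \<Rightarrow> 'b list \<Rightarrow> ('b \<Rightarrow> complex) \<Rightarrow> 'b list \<Rightarrow> complex" where
  "ext_at \<Phi> pre F post = (\<Sum>z\<in>{z. F z \<noteq> 0}. F z * \<Phi> (pre @ [z] @ post))"

definition hoch_b :: "('b \<Rightarrow> 'b \<Rightarrow> ('b \<Rightarrow> complex)) \<Rightarrow> ('b list \<Rightarrow> complex) \<Rightarrow> 'b list \<Rightarrow> complex" where
  "hoch_b mult \<Phi> xs = (if length xs < 2 then 0 else
     (\<Sum>i<length xs - 1. (-1) ^ i * ext_at \<Phi> (take i xs) (mult (xs ! i) (xs ! (i + 1))) (drop (i + 2) xs))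
     + (-1) ^ (length xs - 1) * ext_at \<Phi> [] (mult (last xs) (hd xs)) (tl (butlast xs)))"

text \<open>Connes' operator B = A B0 on (non-normalized) cochains: for psi of degree n+1,
  (B0 psi)(a0,...,an) = psi(1,a0,...,an) - (-1)^(n+1) psi(a0,...,an,1),
  (B psi)(a0,...,an) = sum_{j=0}^n (-1)^(n j) (B0 psi)(a_j,...,a_n,a_0,...,a_{j-1}).\<close>
definition connes_B0 :: "'b \<Rightarrow> ('b list \<Rightarrow> complex) \<Rightarrow> 'b list \<Rightarrow> complex" where
  "connes_B0 u \<Psi> ys = \<Psi> (u # ys) - (-1) ^ length ys * \<Psi> (ys @ [u])"

definition connes_B :: "'b \<Rightarrow> ('b list \<Rightarrow> complex) \<Rightarrow> 'b list \<Rightarrow> complex" where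
  "connes_B u \<Psi> xs = (if xs = [] then 0 else
     (\<Sum>j<length xs. (-1) ^ ((length xs - 1) * j) * connes_B0 u \<Psi> (drop j xs @ take j xs)))"

definition bB :: "'b set \<Rightarrow> ('b \<Rightarrow> 'b \<Rightarrow> ('b \<Rightarrow> complex)) \<Rightarrow> 'b \<Rightarrow> ('b list \<Rightarrow> complex) \<Rightarrow> 'b list \<Rightarrow> complex" where
  "bB Bs mult u \<Phi> xs = (if xs = [] \<or> \<not> set xs \<subseteq> Bs then 0
                        else hoch_b mult \<Phi> xs + connes_B u \<Phi> xs)"

text \<open>Cochains of the total complex of the (b,B) bicomplex in total degree m - 1:
  components of Hochschild degree m-1, m-3, ... (lists of length m, m-2, ...).\<close>
definition tot :: "'b set \<Rightarrow> nat \<Rightarrow> ('b list \<Rightarrow> complex) set" where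
  "tot Bs m = {\<Phi>. \<forall>xs. \<Phi> xs \<noteq> 0 \<longrightarrow>
      xs \<noteq> [] \<and> set xs \<subseteq> Bs \<and> length xs \<le> m \<and> even (m - length xs)}"

definition cyc_Z :: "'b set \<Rightarrow> ('b \<Rightarrow> 'b \<Rightarrow> ('b \<Rightarrow> complex)) \<Rightarrow> 'b \<Rightarrow> nat \<Rightarrow> ('b list \<Rightarrow> complex) set" where
  "cyc_Z Bs mult u n = {\<Phi> \<in> tot Bs (n + 1). bB Bs mult u \<Phi> = (\<lambda>_. 0)}"

definition cyc_B :: "'b set \<Rightarrow> ('b \<Rightarrow> 'b \<Rightarrow> ('b \<Rightarrow> complex)) \<Rightarrow> 'b \<Rightarrow> nat \<Rightarrow> ('b list \<Rightarrow> complex) set" where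
  "cyc_B Bs mult u n = {bB Bs mult u \<Psi> | \<Psi>. \<Psi> \<in> tot Bs n}"

text \<open>With this realization the periodicity map S : HC^n -> HC^(n+2) is induced by the
  inclusion tot Bs (n+1) \<subseteq> tot Bs (n+3). Hence the direct limit of HC^(2n + p)
  under S is the quotient of the union of the cocycle spaces by the union of the
  coboundary spaces.\<close>
definition HP_cocycles :: "'b set \<Rightarrow> ('b \<Rightarrow> 'b \<Rightarrow> ('b \<Rightarrow> complex)) \<Rightarrow> 'b \<Rightarrow> nat \<Rightarrow> ('b list \<Rightarrow> complex) set" where
  "HP_cocycles Bs mult u p = (\<Union>n. cyc_Z Bs mult u (2 * n + p))"

definition HP_coboundaries :: "'b set \<Rightarrow> ('b \<Rightarrow> 'b \<Rightarrow> ('b \<Rightarrow> complex)) \<Rightarrow> 'b \<Rightarrow> nat \<Rightarrow> ('b list \<Rightarrow> complex) set" where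
  "HP_coboundaries Bs mult u p = (\<Union>n. cyc_B Bs mult u (2 * n + p))"

definition quot_dim :: "('a \<Rightarrow> complex) set \<Rightarrow> ('a \<Rightarrow> complex) set \<Rightarrow> nat \<Rightarrow> bool" where
  "quot_dim Z Bd d \<longleftrightarrow> (\<exists>f :: nat \<Rightarrow> 'a \<Rightarrow> complex.
      (\<forall>i<d. f i \<in> Z) \<and>
      (\<forall>\<Phi>\<in>Z. \<exists>c :: nat \<Rightarrow> complex. (\<lambda>x. \<Phi> x - (\<Sum>i<d. c i * f i x)) \<in> Bd) \<and>
      (\<forall>c :: nat \<Rightarrow> complex. (\<lambda>x. \<Sum>i<d. c i * f i x) \<in> Bd \<longrightarrow> (\<forall>i<d. c i = 0)))"

definition HP_dim :: "real \<Rightarrow> mat2 \<Rightarrow> nat \<Rightarrow> nat \<Rightarrow> nat \<Rightarrow> bool" where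
  "HP_dim \<theta> g N p d = quot_dim
      (HP_cocycles (cp_basis N) (cp_mult \<theta> g N) cp_unit p)
      (HP_coboundaries (cp_basis N) (cp_mult \<theta> g N) cp_unit p) d"

abbreviation HP_even_dim :: "real \<Rightarrow> mat2 \<Rightarrow> nat \<Rightarrow> nat \<Rightarrow> bool" where
  "HP_even_dim \<theta> g N d \<equiv> HP_dim \<theta> g N 0 d"

abbreviation HP_odd_dim :: "real \<Rightarrow> mat2 \<Rightarrow> nat \<Rightarrow> nat \<Rightarrow> bool" where
  "HP_odd_dim \<theta> g N d \<equiv> HP_dim \<theta> g N 1 d"

text \<open>Generators: omega for Z_3, the rotation U1 -> U2^-1, U2 -> U1 for Z_4,
  and -omega for Z_6.  Matrices are written (g11, g12, g21, g22).\<close>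
definition gen_Z3 :: mat2 where "gen_Z3 = (0, 1, -1, -1)"
definition gen_Z4 :: mat2 where "gen_Z4 = (0, 1, -1, 0)"
definition gen_Z6 :: mat2 where "gen_Z6 = (0, -1, 1, 1)"

end

theory Submission
  imports Defs "HOL-Library.Countable_Set" "HOL-Library.Product_Plus"
begin

text \<open>The crossed product is a twisted group algebra of \<open>G = \<int>\<^sup>2 \<rtimes> \<Gamma>\<close>. Its Hochschild cochains are the
  equivariant simplicial cochains \<open>F(y\<^sub>0, \<dots>, y\<^sub>n; m)\<close> on the vertex set \<open>G\<close>, with \<open>G\<close> acting on \<open>m\<close> by
  conjugation up to a phase, and the complex splits over the conjugacy classes of \<open>m\<close>.
  If \<open>m\<close> is not a translation its centralizer is finite, and averaging cones over the centralizer
  leaves only degree zero. If \<open>m\<close> is a non-zero translation, irrationality of \<open>\<theta>\<close> makes the phase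
  character of the centralizer non-trivial and everything vanishes. The class \<open>m = 1\<close> contributes
  \<open>H\<^sup>*(\<int>\<^sup>2)\<^sup>\<Gamma>\<close>, which is one-dimensional in degrees 0 and 2 and zero elsewhere.
  So the Hochschild cohomology lives in degrees 0 and 2; the periodic cyclic cohomology is its sum,
  and degree zero is counted by the conjugacy classes of torsion elements of \<open>G\<close>.\<close>

section \<open>Simplicial cochains on lists of vertices\<close>

text \<open>In the vertex model contractions are cones and prisms, but a primitive counts only if it
  is equivariant: every auxiliary choice (apex, centralizing element, correction term) has to follow
  the conjugation of \<open>m\<close>. This dictates \<open>to_rep\<close>, \<open>cc\<close> and
  the averaging over \<open>R\<close>. For m = 1 a cone is invariant under nothing. Invariance is
  gained one lattice direction at a time by solving a difference equation, and the defect drops one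
  degree each time; the last obstruction is the period in degree 2. It survives averaging because
  the rotations have determinant 1, while degree 1 dies because the rotations have no eigenvalue 1,
  so that the group has finite abelianization. The dimensions: torsion classes with rotation part h
  \<noteq> 1 are the orbits of the rotation group on the cokernel of 1 - h, which has det (1 - h) =
  2 - tr h elements. This gives 3 + 3 classes for the group of order 3, 2 + 3 + 2 for order 4 and 1
  + 2 + 2 + 2 + 1 for order 6. The identity and the area class in degree 2 add two more, hence 8, 9,
  10.\<close>

fun sd :: "('v list \<Rightarrow> complex) \<Rightarrow> 'v list \<Rightarrow> complex" where
  "sd F [] = 0"
| "sd F (y # ys) = F ys - sd (\<lambda>zs. F (y # zs)) ys"

lemma sd_diff: "sd (\<lambda>zs. F zs - G zs) ys = sd F ys - sd G ys"
  by (induction ys arbitrary: F G) (simp_all add: algebra_simps)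

lemma sd_add: "sd (\<lambda>zs. F zs + G zs) ys = sd F ys + sd G ys"
  by (induction ys arbitrary: F G) (simp_all add: algebra_simps)

lemma sd_scale: "sd (\<lambda>zs. c * F zs) ys = c * sd F ys"
  by (induction ys arbitrary: F) (simp_all add: algebra_simps)

lemma sd_divide: "sd (\<lambda>zs. F zs / c) ys = sd F ys / c"
  by (induction ys arbitrary: F) (simp_all add: diff_divide_distrib)

lemma sd_zero [simp]: "sd (\<lambda>zs. 0) ys = 0"
  by (induction ys) simp_all

lemma sd_sum: "sd (\<lambda>zs. \<Sum>s\<in>S. F s zs) ys = (\<Sum>s\<in>S. sd (F s) ys)"
  by (induction S rule: infinite_finite_induct) (simp_all add: sd_add)

lemma sd_map: "sd (\<lambda>zs. F (map c zs)) ys = sd F (map c ys)"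
  by (induction ys arbitrary: F) simp_all

lemma sd_cong:
  "(\<And>zs. length ys = Suc (length zs) \<Longrightarrow> F zs = G zs) \<Longrightarrow> sd F ys = sd G ys"
proof (induction ys arbitrary: F G)
  case (Cons y ys)
  have "sd (\<lambda>zs. F (y # zs)) ys = sd (\<lambda>zs. G (y # zs)) ys"
    by (rule Cons.IH) (use Cons.prems in simp)
  then show ?case using Cons.prems by simp
qed simp

lemma sd_sd: "sd (sd F) ys = 0"
  by (induction ys arbitrary: F) (simp_all add: sd_diff)

lemma sd_eq_sum:
  "sd F ys = (\<Sum>i<length ys. (-1) ^ i * F (take i ys @ drop (Suc i) ys))"
proof (induction ys arbitrary: F)
  case (Cons y ys)
  show ?case
    by (simp only: sd.simps Cons.IH list.size add_Suc_right add_0_right sum.lessThan_Suc_shift)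
      (simp add: sum_negf)
qed simp

text \<open>The signed sum of F (y_0, ..., y_i, c y_i, ..., c y_n) over i: the prism operator, a
  homotopy between the identity and the vertex map c.\<close>

fun prism :: "('v \<Rightarrow> 'v) \<Rightarrow> ('v list \<Rightarrow> complex) \<Rightarrow> 'v list \<Rightarrow> complex" where
  "prism c F [] = 0"
| "prism c F (y # ys) = F (y # map c (y # ys)) - prism c (\<lambda>zs. F (y # zs)) ys"

lemma prism_diff: "prism c (\<lambda>zs. F zs - G zs) ys = prism c F ys - prism c G ys"
  by (induction ys arbitrary: F G) (simp_all add: algebra_simps)

lemma prism_cong:
  "(\<And>zs. length zs = Suc (length ys) \<Longrightarrow> F zs = G zs) \<Longrightarrow> prism c F ys = prism c G ys"
proof (induction ys arbitrary: F G)
  case (Cons y ys)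
  have "prism c (\<lambda>zs. F (y # zs)) ys = prism c (\<lambda>zs. G (y # zs)) ys"
    by (rule Cons.IH) (use Cons.prems in simp)
  then show ?case using Cons.prems by simp
qed simp

lemma prism_zero [simp]: "prism c (\<lambda>zs. 0) ys = 0"
  by (induction ys) simp_all

lemma prism_homotopy:
  "sd (prism c F) ys + prism c (sd F) ys = F (map c ys) - F ys"
proof (induction ys arbitrary: F)
  case (Cons y ys)
  have "sd (\<lambda>zs. F (y # c y # map c zs)) ys = sd (\<lambda>zs. F (y # c y # zs)) (map c ys)"
    by (rule sd_map)
  then show ?case
    using Cons.IH[of "\<lambda>zs. F (y # zs)"] by (simp add: sd_diff prism_diff algebra_simps)
qed simp

lemma prism_map:
  assumes "\<And>y. c' (z y) = z (c y)"
  shows "prism c' F (map z ys) = prism c (\<lambda>zs. F (map z zs)) ys"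
  by (induction ys arbitrary: F) (simp_all add: assms o_def)

lemma prism_scale: "prism c (\<lambda>zs. a * F zs) ys = a * prism c F ys"
  by (induction ys arbitrary: F) (simp_all add: algebra_simps)

section \<open>Twisted group algebras\<close>

locale twisted_group = group mul one inv
  for mul :: "'g \<Rightarrow> 'g \<Rightarrow> 'g" (infixl \<open>\<odot>\<close> 70) and one :: 'g and inv :: "'g \<Rightarrow> 'g" +
  fixes \<alpha> :: "'g \<Rightarrow> 'g \<Rightarrow> complex"
  assumes \<alpha>_nz [simp]: "\<alpha> x y \<noteq> 0"
    and \<alpha>_cocycle: "\<alpha> x y * \<alpha> (x \<odot> y) z = \<alpha> y z * \<alpha> x (y \<odot> z)"
    and \<alpha>_one_left [simp]: "\<alpha> one x = 1"
    and \<alpha>_one_right [simp]: "\<alpha> x one = 1"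
begin

lemma mul_inv_cancel [simp]:
  "inv x \<odot> (x \<odot> y) = y" "x \<odot> (inv x \<odot> y) = y" "y \<odot> x \<odot> inv x = y" "y \<odot> inv x \<odot> x = y"
  by (metis assoc left_inverse left_neutral, metis assoc right_inverse left_neutral,
      metis assoc right_inverse right_neutral, metis assoc left_inverse right_neutral)

definition gmult :: "'g \<Rightarrow> 'g \<Rightarrow> 'g \<Rightarrow> complex" where
  "gmult x y = (\<lambda>z. if z = x \<odot> y then \<alpha> x y else 0)"

definition face :: "nat \<Rightarrow> ('g list \<Rightarrow> complex) \<Rightarrow> 'g list \<Rightarrow> complex" where
  "face i \<phi> xs = (-1) ^ i * (if Suc i < length xs
     then \<alpha> (xs ! i) (xs ! Suc i) * \<phi> (take i xs @ [xs ! i \<odot> xs ! Suc i] @ drop (i + 2) xs)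
     else \<alpha> (last xs) (hd xs) * \<phi> ((last xs \<odot> hd xs) # tl (butlast xs)))"

definition hb :: "('g list \<Rightarrow> complex) \<Rightarrow> 'g list \<Rightarrow> complex" where
  "hb \<phi> xs = (if length xs < 2 then 0 else \<Sum>i<length xs. face i \<phi> xs)"

lemma ext_at_gmult: "ext_at \<phi> pre (gmult x y) post = \<alpha> x y * \<phi> (pre @ [x \<odot> y] @ post)"
proof -
  have "{z. gmult x y z \<noteq> 0} = {x \<odot> y}" by (auto simp: gmult_def)
  then show ?thesis by (simp add: ext_at_def gmult_def)
qed

lemma hoch_b_gmult: "hoch_b gmult \<phi> xs = hb \<phi> xs"
proof (cases "length xs < 2")
  case False
  then obtain n where n: "length xs = Suc (Suc n)"
    by (metis add_2_eq_Suc le_Suc_ex not_less)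
  have "(\<Sum>i<Suc n. (-1) ^ i * ext_at \<phi> (take i xs) (gmult (xs ! i) (xs ! (i + 1))) (drop (i + 2) xs))
      = (\<Sum>i<Suc n. face i \<phi> xs)"
    by (rule sum.cong) (auto simp: ext_at_gmult face_def n)
  moreover have "(-1) ^ (length xs - 1) * ext_at \<phi> [] (gmult (last xs) (hd xs)) (tl (butlast xs))
      = face (Suc n) \<phi> xs"
    by (simp add: ext_at_gmult face_def n)
  ultimately show ?thesis using False by (simp add: hoch_b_def hb_def n)
qed (simp add: hoch_b_def hb_def)

section \<open>Cyclic rotation, norm and Connes' operator\<close>

definition rot :: "('g list \<Rightarrow> complex) \<Rightarrow> 'g list \<Rightarrow> complex" where
  "rot \<phi> xs = (-1) ^ (length xs - 1) * \<phi> (rotate1 xs)"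

lemma rot_pow: "(rot ^^ j) \<phi> xs = (-1) ^ ((length xs - 1) * j) * \<phi> (rotate j xs)"
proof (induction j arbitrary: \<phi>)
  case (Suc j)
  have "(rot ^^ Suc j) \<phi> xs = (rot ^^ j) (rot \<phi>) xs" by (simp add: funpow_swap1)
  also have "\<dots> = (-1) ^ ((length xs - 1) * j) * rot \<phi> (rotate j xs)" by (rule Suc)
  also have "rot \<phi> (rotate j xs) = (-1) ^ (length xs - 1) * \<phi> (rotate (Suc j) xs)"
    by (simp add: rot_def)
  finally show ?case by (simp add: power_add mult_ac del: funpow.simps)
qed simp

lemma rot_pow_length: "length xs = n \<Longrightarrow> (rot ^^ n) \<phi> xs = \<phi> xs"
  by (simp add: rot_pow minus_one_power_iff)

definition cnorm :: "('g list \<Rightarrow> complex) \<Rightarrow> 'g list \<Rightarrow> complex" where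
  "cnorm \<phi> xs = (\<Sum>j<length xs. (rot ^^ j) \<phi> xs)"

lemma cnorm_lin:
  "cnorm (\<lambda>xs. \<phi> xs - \<psi> xs) xs = cnorm \<phi> xs - cnorm \<psi> xs"
  "cnorm (\<lambda>xs. \<phi> xs + \<psi> xs) xs = cnorm \<phi> xs + cnorm \<psi> xs"
  "cnorm (\<lambda>xs. c * \<phi> xs) xs = c * cnorm \<phi> xs"
  by (simp_all add: cnorm_def rot_pow algebra_simps sum_subtractf sum.distrib sum_distrib_left)

lemma cnorm_sum: "cnorm (\<lambda>xs. \<Sum>i\<in>I. \<phi> i xs) xs = (\<Sum>i\<in>I. cnorm (\<phi> i) xs)"
  by (induction I rule: infinite_finite_induct)
    (simp_all add: cnorm_lin, simp_all add: cnorm_def rot_pow)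

lemma cnorm_cong: "(\<And>ys. length ys = length xs \<Longrightarrow> \<phi> ys = \<psi> ys) \<Longrightarrow> cnorm \<phi> xs = cnorm \<psi> xs"
  by (simp add: cnorm_def rot_pow)

lemma cnorm_rot: "cnorm (rot \<phi>) xs = cnorm \<phi> xs"
proof -
  let ?n = "length xs"
  have "cnorm (rot \<phi>) xs = (\<Sum>j<?n. (rot ^^ Suc j) \<phi> xs)"
    by (simp add: cnorm_def funpow_swap1)
  also have "\<dots> = (\<Sum>j<Suc ?n. (rot ^^ j) \<phi> xs) - \<phi> xs"
    by (subst sum.lessThan_Suc_shift) simp
  also have "\<dots> = cnorm \<phi> xs" by (simp add: cnorm_def rot_pow_length)
  finally show ?thesis .
qed

lemma rot_cnorm: "rot (cnorm \<phi>) xs = cnorm \<phi> xs"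
proof -
  let ?n = "length xs"
  have "rot (cnorm \<phi>) xs = (\<Sum>j<?n. (rot ^^ Suc j) \<phi> xs)"
    by (simp add: cnorm_def rot_def sum_distrib_left)
  also have "\<dots> = (\<Sum>j<Suc ?n. (rot ^^ j) \<phi> xs) - \<phi> xs"
    by (subst sum.lessThan_Suc_shift) simp
  also have "\<dots> = cnorm \<phi> xs" by (simp add: cnorm_def rot_pow_length)
  finally show ?thesis .
qed

lemma face_lin:
  "face i (\<lambda>xs. \<phi> xs - \<psi> xs) xs = face i \<phi> xs - face i \<psi> xs"
  "face i (\<lambda>xs. \<phi> xs + \<psi> xs) xs = face i \<phi> xs + face i \<psi> xs"
  "face i (\<lambda>xs. c * \<phi> xs) xs = c * face i \<phi> xs"
  by (simp_all add: face_def algebra_simps)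

lemma face_cong:
  assumes "\<And>ys. Suc (length ys) = length xs \<Longrightarrow> \<phi> ys = \<psi> ys" "2 \<le> length xs"
  shows "face i \<phi> xs = face i \<psi> xs"
  using assms by (simp add: face_def)

text \<open>Rotation moves the merged pair by one place. The sign of \<open>rot\<close> on words of
  lengths differing by one changes by the same -1 as the sign of consecutive faces.\<close>

lemma face_rot:
  assumes "Suc i < length xs"
  shows "face (Suc i) (rot \<phi>) xs = rot (face i \<phi>) xs"
proof -
  obtain x ys where xs: "xs = x # ys" and ys: "ys \<noteq> []"
    using assms by (cases xs; cases "tl xs") auto
  show ?thesis
  proof (cases "Suc (Suc i) < length xs")
    case True
    then obtain k where k: "length ys = Suc (Suc (i + k))"
      by (auto simp: xs dest: less_imp_Suc_add)
    show ?thesis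
      by (simp add: face_def rot_def xs nth_append k)
  next
    case False
    then have i: "length ys = Suc i" using assms by (simp add: xs)
    have l: "last ys = ys ! i" using ys i by (simp add: last_conv_nth)
    have "take i ys = butlast ys" using i by (simp add: butlast_conv_take)
    then show ?thesis using i ys l
      by (simp add: face_def rot_def xs nth_append)
  qed
qed

text \<open>The last face merges the last letter with the first; on the rotated word these are the
  first two letters of the original one.\<close>

lemma rot_face_last:
  assumes "length xs = Suc (Suc n)"
  shows "rot (face (Suc n) \<phi>) xs = face 0 \<phi> xs"
proof -
  obtain x y ys where xs: "xs = x # y # ys" using assms by (cases xs; cases "tl xs") auto
  show ?thesis using assms by (simp add: xs face_def rot_def butlast_append)
qed

lemma face_sum: "face i (\<lambda>xs. \<Sum>j\<in>J. \<phi> j xs) xs = (\<Sum>j\<in>J. face i (\<phi> j) xs)"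
  by (simp add: face_def sum_distrib_left)

definition ins :: "('g list \<Rightarrow> complex) \<Rightarrow> 'g list \<Rightarrow> complex" where
  "ins \<phi> xs = \<phi> (one # xs)"

definition omr :: "('g list \<Rightarrow> complex) \<Rightarrow> 'g list \<Rightarrow> complex" where
  "omr \<phi> xs = \<phi> xs - rot \<phi> xs"

lemma connes_B_eq: "connes_B one \<phi> = cnorm (ins (omr \<phi>))"
proof
  fix xs :: "'g list"
  show "connes_B one \<phi> xs = cnorm (ins (omr \<phi>)) xs"
    by (auto simp: connes_B_def connes_B0_def cnorm_def rot_pow ins_def omr_def rot_def
        rotate_drop_take intro!: sum.cong)
qed

definition hb_but_last :: "('g list \<Rightarrow> complex) \<Rightarrow> 'g list \<Rightarrow> complex" where
  "hb_but_last \<phi> xs = (\<Sum>i<length xs - 1. face i \<phi> xs)"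

definition hb_but_first :: "('g list \<Rightarrow> complex) \<Rightarrow> 'g list \<Rightarrow> complex" where
  "hb_but_first \<phi> xs = (\<Sum>i<length xs - 1. face (Suc i) \<phi> xs)"

lemma omr_hb:
  assumes "2 \<le> length xs"
  shows "omr (hb \<phi>) xs = hb_but_first (omr \<phi>) xs"
proof -
  obtain n where n: "length xs = Suc (Suc n)" using assms by (metis add_2_eq_Suc le_Suc_ex)
  have "rot (hb \<phi>) xs = (\<Sum>i<Suc (Suc n). rot (face i \<phi>) xs)"
    by (simp add: rot_def hb_def n sum_distrib_left algebra_simps)
  also have "\<dots> = (\<Sum>i<Suc n. face (Suc i) (rot \<phi>) xs) + face 0 \<phi> xs"
    by (simp add: face_rot n rot_face_last)
  finally have "rot (hb \<phi>) xs = (\<Sum>i<Suc n. face (Suc i) (rot \<phi>) xs) + face 0 \<phi> xs" .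
  moreover have "hb \<phi> xs = face 0 \<phi> xs + (\<Sum>i<Suc n. face (Suc i) \<phi> xs)"
    using sum.lessThan_Suc_shift[of "\<lambda>i. face i \<phi> xs" "Suc n"]
    by (simp add: hb_def n del: sum.lessThan_Suc)
  moreover have "hb_but_first (omr \<phi>) xs
      = (\<Sum>i<Suc n. face (Suc i) \<phi> xs) - (\<Sum>i<Suc n. face (Suc i) (rot \<phi>) xs)"
    unfolding hb_but_first_def omr_def n by (simp only: face_lin sum_subtractf diff_Suc_1)
  ultimately show ?thesis by (simp add: omr_def)
qed

lemma face_cnorm:
  "i < length xs \<Longrightarrow> 2 \<le> length xs \<Longrightarrow> face i (cnorm \<phi>) xs = (rot ^^ i) (face 0 (cnorm \<phi>)) xs"
proof (induction i arbitrary: xs)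
  case (Suc i)
  have "face (Suc i) (cnorm \<phi>) xs = face (Suc i) (rot (cnorm \<phi>)) xs"
    by (rule face_cong) (use Suc.prems in \<open>simp_all add: rot_cnorm\<close>)
  also have "\<dots> = rot (face i (cnorm \<phi>)) xs" using Suc.prems by (simp add: face_rot)
  also have "\<dots> = rot ((rot ^^ i) (face 0 (cnorm \<phi>))) xs"
    using Suc.IH[of "rotate1 xs"] Suc.prems by (simp add: rot_def[of "face i _"] rot_def[of "(rot ^^ i) _"])
  finally show ?case by simp
qed simp

lemma cnorm_face_shift:
  "i + k < length xs \<Longrightarrow> cnorm (face i \<phi>) xs = cnorm (face (i + k) ((rot ^^ k) \<phi>)) xs"
proof (induction k)
  case (Suc k)
  have "cnorm (face (i + k) ((rot ^^ k) \<phi>)) xs = cnorm (rot (face (i + k) ((rot ^^ k) \<phi>))) xs"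
    by (simp add: cnorm_rot)
  also have "\<dots> = cnorm (face (Suc (i + k)) (rot ((rot ^^ k) \<phi>))) xs"
    by (rule cnorm_cong) (use Suc.prems in \<open>simp add: face_rot\<close>)
  finally show ?case using Suc by simp
qed simp

text \<open>The norm absorbs rotations, so both sides can be moved onto face 0. The faces kept by
  \<open>hb_but_last\<close> collect each of the \<open>Suc n\<close> rotations of a word of length
  \<open>Suc n\<close> exactly once, and these form a norm inside face 0; this is why one face has
  to be dropped.\<close>

lemma hb_cnorm:
  assumes "2 \<le> length xs"
  shows "hb (cnorm \<phi>) xs = cnorm (hb_but_last \<phi>) xs"
proof -
  obtain n where n: "length xs = Suc (Suc n)" using assms by (metis add_2_eq_Suc le_Suc_ex)
  have a: "hb (cnorm \<phi>) xs = cnorm (face 0 (cnorm \<phi>)) xs"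
    unfolding hb_def cnorm_def[of "face 0 _"] using assms by (simp add: face_cnorm)
  have f: "cnorm (face i \<phi>) xs = cnorm (face 0 ((rot ^^ Suc (n - i)) \<phi>)) xs" if "i < Suc n" for i
  proof -
    \<comment> \<open>Rotations lead up to the wrap-around face \<open>Suc n\<close>; one more turns
      it into face 0.\<close>
    have "cnorm (face i \<phi>) xs = cnorm (face (Suc n) ((rot ^^ Suc (n - i)) \<phi>)) xs"
      using cnorm_face_shift[of i "Suc (n - i)" xs \<phi>] that n by simp
    also have "\<dots> = cnorm (rot (face (Suc n) ((rot ^^ Suc (n - i)) \<phi>))) xs"
      by (simp only: cnorm_rot)
    also have "\<dots> = cnorm (face 0 ((rot ^^ Suc (n - i)) \<phi>)) xs"
      by (rule cnorm_cong) (simp only: n rot_face_last)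
    finally show ?thesis .
  qed
  have "cnorm (hb_but_last \<phi>) xs = cnorm (\<lambda>xs. \<Sum>i<Suc n. face i \<phi> xs) xs"
    by (rule cnorm_cong) (simp add: hb_but_last_def n)
  also have "\<dots> = (\<Sum>i<Suc n. cnorm (face 0 ((rot ^^ Suc (n - i)) \<phi>)) xs)"
    unfolding cnorm_sum by (rule sum.cong) (use f in auto)
  also have "\<dots> = (\<Sum>i<Suc n. cnorm (face 0 ((rot ^^ Suc i) \<phi>)) xs)"
    using sum.nat_diff_reindex[of "\<lambda>i. cnorm (face 0 ((rot ^^ Suc i) \<phi>)) xs" "Suc n"] by simp
  also have "\<dots> = cnorm (face 0 (\<lambda>xs. \<Sum>i<Suc n. (rot ^^ Suc i) \<phi> xs)) xs"
    unfolding cnorm_sum[symmetric] by (rule cnorm_cong) (simp only: face_sum)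
  also have "\<dots> = cnorm (face 0 (cnorm \<phi>)) xs"
  proof (rule cnorm_cong, rule face_cong)
    fix ys zs :: "'g list"
    assume "length ys = length xs" "Suc (length zs) = length ys"
    then have "length zs = Suc n" using n by simp
    then show "(\<Sum>i<Suc n. (rot ^^ Suc i) \<phi> zs) = cnorm \<phi> zs"
      using cnorm_rot[of \<phi> zs] by (simp add: cnorm_def funpow_swap1)
  qed (use assms in simp)
  finally show ?thesis using a by simp
qed

text \<open>The extra degeneracy of the bar complex: face 0 swallows the inserted unit, and the
  remaining faces cancel because the insertion shifts their index, hence their sign, by one.\<close>

lemma ins_hb_but_last:
  assumes "xs \<noteq> []"
  shows "ins (hb_but_last \<phi>) xs + hb_but_last (ins \<phi>) xs = \<phi> xs"
proof -
  obtain x ys where xs: "xs = x # ys" using assms by (cases xs) auto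
  have "face (Suc i) \<phi> (one # xs) = - face i (ins \<phi>) xs" if "i < length ys" for i
    using that by (simp add: face_def ins_def xs)
  then have "(\<Sum>i<length ys. face (Suc i) \<phi> (one # xs)) = - (\<Sum>i<length ys. face i (ins \<phi>) xs)"
    by (simp add: sum_negf)
  moreover have "face 0 \<phi> (one # xs) = \<phi> xs" by (simp add: face_def xs)
  ultimately show ?thesis
    by (simp add: ins_def[of "hb_but_last _"] hb_but_last_def xs sum.lessThan_Suc_shift
        del: sum.lessThan_Suc)
qed

text \<open>Merging the last letter with a leading unit is an inverse rotation up to the sign -1,
  and the norm does not see rotations.\<close>

lemma cnorm_face_last:
  "cnorm (\<lambda>ys. face (length ys) \<psi> (one # ys)) xs = - cnorm \<psi> xs"
proof (cases "xs = []")
  case False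
  have "rot (\<lambda>ys. face (length ys) \<psi> (one # ys)) ys = (-1) * \<psi> ys" if l: "length ys = length xs" for ys
  proof -
    have "ys \<noteq> []" using l False by auto
    then obtain y zs where ys: "ys = y # zs" by (cases ys) auto
    show ?thesis by (simp add: rot_def face_def ys)
  qed
  then have "cnorm (rot (\<lambda>ys. face (length ys) \<psi> (one # ys))) xs = cnorm (\<lambda>ys. (-1) * \<psi> ys) xs"
    by (rule cnorm_cong)
  then show ?thesis by (simp only: cnorm_rot cnorm_lin) simp
qed (simp add: cnorm_def)

text \<open>With \<open>B = N s (1 - T)\<close> this follows from \<open>b N = N b'\<close>, \<open>(1 - T) b = b'' (1 - T)\<close> and \<open>s b' + b' s = 1\<close>,
  where \<open>b'\<close> and \<open>b''\<close> lack the last and the first face.\<close>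

lemma hb_connes_B: "hb (connes_B one \<phi>) xs + connes_B one (hb \<phi>) xs = 0"
proof (cases "xs = []")
  case False
  let ?\<psi> = "omr \<phi>"
  have 1: "hb (connes_B one \<phi>) xs = cnorm (hb_but_last (ins ?\<psi>)) xs"
  proof (cases "2 \<le> length xs")
    case False
    with \<open>xs \<noteq> []\<close> obtain x where "xs = [x]" by (cases xs; cases "tl xs") auto
    then show ?thesis by (simp add: hb_def cnorm_def hb_but_last_def)
  qed (simp add: connes_B_eq hb_cnorm)
  have "connes_B one (hb \<phi>) xs
      = cnorm (\<lambda>ys. ins (hb_but_last ?\<psi>) ys + (face (length ys) ?\<psi> (one # ys) - ?\<psi> ys)) xs"
    unfolding connes_B_eq
  proof (rule cnorm_cong)
    fix ys :: "'g list"
    assume "length ys = length xs"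
    then obtain y zs where ys: "ys = y # zs" using False by (metis length_0_conv neq_Nil_conv)
    have "ins (omr (hb \<phi>)) ys = hb_but_first ?\<psi> (one # ys)"
      by (simp add: ins_def omr_hb ys)
    also have "\<dots> = (\<Sum>i<Suc (length ys). face i ?\<psi> (one # ys)) - face 0 ?\<psi> (one # ys)"
      by (subst sum.lessThan_Suc_shift) (simp add: hb_but_first_def)
    also have "face 0 ?\<psi> (one # ys) = ?\<psi> ys" by (simp add: face_def ys)
    finally show "ins (omr (hb \<phi>)) ys
        = ins (hb_but_last ?\<psi>) ys + (face (length ys) ?\<psi> (one # ys) - ?\<psi> ys)"
      by (simp add: hb_but_last_def ins_def[of "hb_but_last _"])
  qed
  then have 2: "connes_B one (hb \<phi>) xs = cnorm (ins (hb_but_last ?\<psi>)) xs - 2 * cnorm ?\<psi> xs"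
    by (simp add: cnorm_lin cnorm_face_last)
  have "cnorm (hb_but_last (ins ?\<psi>)) xs + cnorm (ins (hb_but_last ?\<psi>)) xs = cnorm ?\<psi> xs"
    unfolding cnorm_lin(2)[symmetric]
    by (rule cnorm_cong) (metis False ins_hb_but_last add.commute length_0_conv)
  moreover have "cnorm ?\<psi> xs = 0"
    unfolding omr_def by (simp add: cnorm_lin cnorm_rot)
  ultimately show ?thesis using 1 2 by simp
qed (simp add: hb_def connes_B_def)

lemma connes_B_connes_B: "connes_B one (connes_B one \<phi>) xs = 0"
proof -
  have "omr (cnorm \<psi>) = (\<lambda>_. 0)" for \<psi> by (simp add: omr_def rot_cnorm fun_eq_iff)
  then show ?thesis by (simp add: connes_B_eq ins_def cnorm_def rot_pow)
qed

section \<open>Hochschild cochains as equivariant simplicial cochains\<close>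

text \<open>For the basis elements u of the twisted group algebra, u_z u_m =
  \<open>conj_phase z m\<close> u_(z m z^-1) u_z.\<close>

definition conj_phase :: "'g \<Rightarrow> 'g \<Rightarrow> complex" where
  "conj_phase z m = \<alpha> z m / \<alpha> (z \<odot> m \<odot> inv z) z"

lemma conj_phase_nz [simp]: "conj_phase z m \<noteq> 0"
  by (simp add: conj_phase_def)

lemma conj_phase_one [simp]: "conj_phase one m = 1" "conj_phase z one = 1"
  by (simp_all add: conj_phase_def)

lemma conj_phase_mult:
  "conj_phase (a \<odot> b) m = conj_phase a (b \<odot> m \<odot> inv b) * conj_phase b m"
proof -
  let ?m1 = "b \<odot> m \<odot> inv b"
  let ?m2 = "a \<odot> ?m1 \<odot> inv a"
  have m2: "a \<odot> b \<odot> m \<odot> inv (a \<odot> b) = ?m2" by (simp add: inverse_distrib_swap assoc)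
  have 1: "\<alpha> a b * \<alpha> (a \<odot> b) m = \<alpha> b m * \<alpha> a (b \<odot> m)" by (rule \<alpha>_cocycle)
  have 2: "\<alpha> a ?m1 * \<alpha> (a \<odot> ?m1) b = \<alpha> ?m1 b * \<alpha> a (b \<odot> m)"
    using \<alpha>_cocycle[of a ?m1 b] by simp
  have 3: "\<alpha> ?m2 a * \<alpha> (a \<odot> ?m1) b = \<alpha> a b * \<alpha> ?m2 (a \<odot> b)"
    using \<alpha>_cocycle[of ?m2 a b] by simp
  \<comment> \<open>This common factor allows three instances of the cocycle identity to be
    substituted side by side, and is then cancelled.\<close>
  have nz: "\<alpha> (a \<odot> ?m1) b * \<alpha> a b * \<alpha> a (b \<odot> m) \<noteq> 0" by simp
  have "\<alpha> (a \<odot> b) m * (\<alpha> ?m2 a * \<alpha> ?m1 b) * (\<alpha> (a \<odot> ?m1) b * \<alpha> a b * \<alpha> a (b \<odot> m))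
      = (\<alpha> a b * \<alpha> (a \<odot> b) m) * (\<alpha> ?m2 a * \<alpha> (a \<odot> ?m1) b) * (\<alpha> ?m1 b * \<alpha> a (b \<odot> m))"
    by (simp add: ac_simps)
  also have "\<dots> = (\<alpha> b m * \<alpha> a (b \<odot> m)) * (\<alpha> a b * \<alpha> ?m2 (a \<odot> b)) * (\<alpha> a ?m1 * \<alpha> (a \<odot> ?m1) b)"
    by (simp only: 1 2 3)
  also have "\<dots> = \<alpha> a ?m1 * \<alpha> b m * \<alpha> ?m2 (a \<odot> b) * (\<alpha> (a \<odot> ?m1) b * \<alpha> a b * \<alpha> a (b \<odot> m))"
    by (simp add: ac_simps)
  finally have "\<alpha> (a \<odot> b) m * (\<alpha> ?m2 a * \<alpha> ?m1 b) = \<alpha> a ?m1 * \<alpha> b m * \<alpha> ?m2 (a \<odot> b)"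
    using nz by (simp only: mult_cancel_right) blast
  then show ?thesis unfolding conj_phase_def m2 by (simp add: field_simps)
qed

definition equivariant :: "('g list \<Rightarrow> 'g \<Rightarrow> complex) \<Rightarrow> bool" where
  "equivariant A \<longleftrightarrow>
     (\<forall>z ys m. A (map ((\<odot>) z) ys) (z \<odot> m \<odot> inv z) * conj_phase z m = A ys m)"

lemma equivariantD:
  "equivariant A \<Longrightarrow> A (map ((\<odot>) z) ys) (z \<odot> m \<odot> inv z) * conj_phase z m = A ys m"
  by (simp add: equivariant_def)

abbreviation gd :: "('g list \<Rightarrow> 'g \<Rightarrow> complex) \<Rightarrow> 'g list \<Rightarrow> 'g \<Rightarrow> complex" where
  "gd A ys m \<equiv> sd (\<lambda>zs. A zs m) ys"

lemma equivariant_gd: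
  assumes "equivariant A"
  shows "equivariant (gd A)"
  unfolding equivariant_def
proof (intro allI)
  fix z ys m
  have "gd A (map ((\<odot>) z) ys) (z \<odot> m \<odot> inv z) * conj_phase z m
      = sd (\<lambda>zs. conj_phase z m * A (map ((\<odot>) z) zs) (z \<odot> m \<odot> inv z)) ys"
    by (simp add: sd_scale sd_map[symmetric])
  also have "\<dots> = gd A ys m"
    using equivariantD[OF assms, of z _ m] by (simp add: mult.commute)
  finally show "gd A (map ((\<odot>) z) ys) (z \<odot> m \<odot> inv z) * conj_phase z m = gd A ys m" .
qed

section \<open>Words of group elements and paths of vertices\<close>

fun prd :: "'g list \<Rightarrow> 'g" where
  "prd [] = one"
| "prd (x # xs) = x \<odot> prd xs"

text \<open>The scalar by which the product of the basis elements of the letters differs from the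
  basis element of \<open>prd xs\<close>.\<close>

fun \<kappa> :: "'g list \<Rightarrow> complex" where
  "\<kappa> [] = 1"
| "\<kappa> (x # xs) = \<alpha> x (prd xs) * \<kappa> xs"

fun path :: "'g \<Rightarrow> 'g list \<Rightarrow> 'g list" where
  "path y [] = [y]"
| "path y (x # xs) = y # path (y \<odot> x) xs"

fun steps :: "'g \<Rightarrow> 'g list \<Rightarrow> 'g list" where
  "steps y [] = []"
| "steps y (z # zs) = (inv y \<odot> z) # steps z zs"

lemma prd_append: "prd (xs @ ys) = prd xs \<odot> prd ys"
  by (induction xs) (simp_all add: assoc)

lemma \<kappa>_nz [simp]: "\<kappa> xs \<noteq> 0"
  by (induction xs) simp_all

lemma \<kappa>_append: "\<kappa> (xs @ ys) = \<kappa> xs * \<kappa> ys * \<alpha> (prd xs) (prd ys)"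
proof (induction xs)
  case (Cons x xs)
  then show ?case using \<alpha>_cocycle[of x "prd xs" "prd ys"] by (simp add: prd_append ac_simps)
qed simp

lemma \<kappa>_merge: "\<kappa> (xs @ x # y # ys) = \<alpha> x y * \<kappa> (xs @ (x \<odot> y) # ys)"
  using \<alpha>_cocycle[of x y "prd ys"] by (simp add: \<kappa>_append assoc ac_simps)

lemma path_neq_Nil [simp]: "path y xs \<noteq> []"
  by (cases xs) simp_all

lemma length_path [simp]: "length (path y xs) = Suc (length xs)"
  by (induction xs arbitrary: y) simp_all

lemma length_steps [simp]: "length (steps y zs) = length zs"
  by (induction zs arbitrary: y) simp_all

lemma map_path: "map ((\<odot>) z) (path y xs) = path (z \<odot> y) xs"
  by (induction xs arbitrary: y) (simp_all add: assoc)

lemma steps_path: "steps y (tl (path y xs)) = xs"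
proof (induction xs arbitrary: y)
  case (Cons x xs)
  obtain ws where "path (y \<odot> x) xs = (y \<odot> x) # ws" by (cases xs) auto
  then show ?case using Cons[of "y \<odot> x"] by simp
qed simp

lemma path_steps: "path y (steps y zs) = y # zs"
  by (induction zs arbitrary: y) simp_all

lemma steps_map: "steps (z \<odot> y) (map ((\<odot>) z) zs) = steps y zs"
  by (induction zs arbitrary: y) (simp_all add: inverse_distrib_swap assoc)

lemma last_path: "last (path y xs) = y \<odot> prd xs"
  by (induction xs arbitrary: y) (simp_all add: assoc)

lemma path_Cons: "path y xs = y # tl (path y xs)"
  by (cases xs) simp_all

lemma take_path: "i < length xs \<Longrightarrow> take (Suc i) (path y xs) = path y (take i xs)"
proof (induction xs arbitrary: y i)
  case (Cons x xs)
  then show ?case by (cases i) simp_all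
qed simp

lemma path_omit:
  "Suc i < length xs \<Longrightarrow> take (Suc i) (path y xs) @ drop (Suc (Suc i)) (path y xs)
     = path y (take i xs @ [xs ! i \<odot> xs ! Suc i] @ drop (i + 2) xs)"
proof (induction i arbitrary: xs y)
  case 0
  then obtain a b zs where "xs = a # b # zs" by (cases xs; cases "tl xs") auto
  then show ?case by (simp add: assoc)
next
  case (Suc i)
  then obtain a zs where xs: "xs = a # zs" by (cases xs) auto
  show ?case using Suc.IH[of zs "y \<odot> a"] Suc.prems by (simp add: xs)
qed

text \<open>The vertices \<open>y\<^sub>0, \<dots>, y\<^sub>n\<close> together with \<open>m\<close> encode the word
  \<open>(y\<^sub>n\<inverse> m y\<^sub>0, y\<^sub>0\<inverse> y\<^sub>1, \<dots>, y\<^sub>n\<^sub>-\<^sub>1\<inverse> y\<^sub>n)\<close>; multiplying two adjacent letters omits a vertex.\<close>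

definition \<Theta> :: "('g list \<Rightarrow> 'g \<Rightarrow> complex) \<Rightarrow> 'g list \<Rightarrow> complex" where
  "\<Theta> A xs = (case xs of [] \<Rightarrow> 0
     | x # ys \<Rightarrow> \<kappa> (ys @ [x]) * A (path one ys) (prd (ys @ [x])))"

text \<open>Only the first face uses equivariance: it omits the base vertex \<open>one\<close>, so
  the remaining path starts at the letter x1 and has to be translated back. The interior and the
  wrap-around face omit a later vertex outright, with \<open>\<kappa>\<close> supplying the
  phase.\<close>

lemma face_\<Theta>:
  assumes A: "equivariant A" and i: "i < length xs" and l: "2 \<le> length xs"
  shows "face i (\<Theta> A) xs = \<Theta> (\<lambda>ys m. (-1) ^ i * A (take i ys @ drop (Suc i) ys) m) xs"
proof -
  obtain x0 x1 ys where xs: "xs = x0 # x1 # ys" using l by (cases xs; cases "tl xs") auto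
  consider "i = 0" | j where "i = Suc j" "Suc i < length xs" | "i = Suc (length ys)"
    using i by (cases i) (auto simp: xs, meson less_SucE)
  then show ?thesis
  proof cases
    case 1
    let ?P = "prd (ys @ [x0])"
    let ?m = "?P \<odot> x1"
    have A1: "A (path x1 ys) (x1 \<odot> ?P) * conj_phase x1 ?m = A (path one ys) ?m"
      using equivariantD[OF A, of x1 "path one ys" ?m] by (simp add: map_path assoc)
    have c: "conj_phase x1 ?m * \<alpha> ?P x1 = \<alpha> x1 ?P"
      using \<alpha>_cocycle[of x1 ?P x1] by (simp add: conj_phase_def assoc[symmetric] field_simps)
    have k: "\<alpha> x0 x1 * \<kappa> (ys @ [x0 \<odot> x1]) = \<kappa> (ys @ [x0]) * \<alpha> ?P x1"
      using \<kappa>_merge[of ys x0 x1 "[]"] \<kappa>_append[of "ys @ [x0]" "[x1]"] by simp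
    have "\<alpha> x0 x1 * \<kappa> (ys @ [x0 \<odot> x1]) * A (path one ys) ?m
        = \<kappa> (ys @ [x0]) * \<alpha> ?P x1 * (A (path x1 ys) (x1 \<odot> ?P) * conj_phase x1 ?m)"
      by (simp only: A1 k)
    also have "\<dots> = \<kappa> (ys @ [x0]) * (conj_phase x1 ?m * \<alpha> ?P x1) * A (path x1 ys) (x1 \<odot> ?P)"
      by (simp add: mult_ac)
    finally have "\<alpha> x0 x1 * \<kappa> (ys @ [x0 \<odot> x1]) * A (path one ys) ?m
        = \<kappa> (ys @ [x0]) * \<alpha> x1 ?P * A (path x1 ys) (x1 \<odot> ?P)"
      by (simp only: c)
    then show ?thesis
      by (simp add: 1 face_def \<Theta>_def xs prd_append assoc mult_ac)
  next
    case (2 j)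
    then have j: "j < length ys" by (simp add: xs)
    let ?zs = "x1 # ys"
    let ?ws = "take j ?zs @ [?zs ! j \<odot> ?zs ! Suc j] @ drop (j + 2) ?zs"
    have zs: "?zs = take j ?zs @ ?zs ! j # ?zs ! Suc j # drop (j + 2) ?zs"
      using j id_take_nth_drop[of j ?zs] Cons_nth_drop_Suc[of "Suc j" ?zs] by simp
    have k: "\<kappa> (?zs @ [x0]) = \<alpha> (?zs ! j) (?zs ! Suc j) * \<kappa> (?ws @ [x0])"
      by (subst zs) (simp add: \<kappa>_merge del: nth_Cons_Suc)
    have p: "prd (?zs @ [x0]) = prd (?ws @ [x0])"
      by (subst zs) (simp add: prd_append assoc del: nth_Cons_Suc)
    have o: "take i (path one ?zs) @ drop (Suc i) (path one ?zs) = path one ?ws"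
      using path_omit[of j ?zs one] j 2 by simp
    have f: "face i (\<Theta> A) xs = (-1) ^ i * (\<alpha> (?zs ! j) (?zs ! Suc j) * \<Theta> A (x0 # ?ws))"
      using 2 j by (simp add: face_def xs)
    have "\<Theta> (\<lambda>ys m. (-1) ^ i * A (take i ys @ drop (Suc i) ys) m) xs
        = \<kappa> (?zs @ [x0]) * ((-1) ^ i * A (path one ?ws) (prd (?zs @ [x0])))"
      unfolding \<Theta>_def xs list.case o ..
    then show ?thesis unfolding f k p by (simp add: \<Theta>_def)
  next
    case 3
    let ?zs = "x1 # ys"
    have z: "?zs = butlast ?zs @ [last ?zs]" by simp
    have o: "take i (path one ?zs) @ drop (Suc i) (path one ?zs) = path one (butlast ?zs)"
      using take_path[of "length ys" ?zs one] by (simp add: 3 butlast_conv_take)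
    have k: "\<kappa> (?zs @ [x0]) = \<alpha> (last ?zs) x0 * \<kappa> (butlast ?zs @ [last ?zs \<odot> x0])"
      by (subst z) (simp only: append_assoc append_Cons append_Nil \<kappa>_merge)
    have p: "prd (?zs @ [x0]) = prd (butlast ?zs @ [last ?zs \<odot> x0])"
      by (subst z) (simp only: append_assoc append_Cons append_Nil prd_append prd.simps assoc right_neutral)
    have f: "face i (\<Theta> A) xs = (-1) ^ i * (\<alpha> (last ?zs) x0 * \<Theta> A ((last ?zs \<odot> x0) # butlast ?zs))"
      by (simp add: face_def xs 3)
    have "\<Theta> (\<lambda>ys m. (-1) ^ i * A (take i ys @ drop (Suc i) ys) m) xs
        = \<kappa> (?zs @ [x0]) * ((-1) ^ i * A (path one (butlast ?zs)) (prd (?zs @ [x0])))"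
      unfolding \<Theta>_def xs list.case o ..
    then show ?thesis unfolding f k p by (simp add: \<Theta>_def)
  qed
qed

lemma hb_\<Theta>:
  assumes "equivariant A" "2 \<le> length xs"
  shows "hb (\<Theta> A) xs = \<Theta> (gd A) xs"
proof -
  obtain x ys where xs: "xs = x # ys" using assms by (cases xs) auto
  have "hb (\<Theta> A) xs = (\<Sum>i<length xs. \<Theta> (\<lambda>ys m. (-1) ^ i * A (take i ys @ drop (Suc i) ys) m) xs)"
    using assms by (simp add: hb_def face_\<Theta>)
  also have "\<dots> = \<Theta> (gd A) xs"
    by (simp add: \<Theta>_def xs sd_eq_sum sum_distrib_left del: sum.lessThan_Suc)
  finally show ?thesis .
qed

text \<open>Equivariance moves the first vertex to \<open>one\<close>; there the first letter of the
  word can be solved for so that any \<open>m\<close> occurs.\<close>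

lemma \<Theta>_inject:
  assumes A: "equivariant A" and z: "\<And>xs. length xs = length ys \<Longrightarrow> \<Theta> A xs = 0" and ys: "ys \<noteq> []"
  shows "A ys m = 0"
proof -
  obtain y zs where yz: "ys = y # zs" using ys by (cases ys) auto
  let ?m = "inv y \<odot> m \<odot> y"
  define x where "x = inv (prd (steps y zs)) \<odot> ?m"
  have "\<Theta> A (x # steps y zs) = 0" by (rule z) (simp add: yz)
  moreover have "prd (steps y zs @ [x]) = ?m" by (simp add: prd_append x_def)
  ultimately have "A (path one (steps y zs)) ?m = 0" by (simp add: \<Theta>_def)
  moreover have "map ((\<odot>) (inv y)) ys = path one (steps y zs)"
    using map_path[of "inv y" y "steps y zs"] by (simp add: path_steps yz)
  ultimately show ?thesis
    using equivariantD[OF A, of "inv y" ys m] by simp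
qed

text \<open>The inverse of \<open>\<Theta>\<close>: the vertices are translated to the base point by
  \<open>inv y\<close>, \<open>conj_phase\<close> is the factor that equivariance attaches to this,
  and \<open>\<kappa>\<close> undoes the factor in \<open>\<Theta>\<close>.\<close>

definition unfold_cochain :: "('g list \<Rightarrow> complex) \<Rightarrow> 'g list \<Rightarrow> 'g \<Rightarrow> complex" where
  "unfold_cochain \<phi> ys m = (case ys of [] \<Rightarrow> 0 | y # zs \<Rightarrow>
     let x = inv (last ys) \<odot> m \<odot> y
     in conj_phase (inv y) m / \<kappa> (steps y zs @ [x]) * \<phi> (x # steps y zs))"

lemma equivariant_unfold: "equivariant (unfold_cochain \<phi>)"
  unfolding equivariant_def
proof (intro allI)
  fix z ys m
  show "unfold_cochain \<phi> (map ((\<odot>) z) ys) (z \<odot> m \<odot> inv z) * conj_phase z m = unfold_cochain \<phi> ys m"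
  proof (cases ys)
    case (Cons y zs)
    have l: "last (map ((\<odot>) z) ys) = z \<odot> last ys" using Cons by (simp add: last_map)
    have x: "inv (z \<odot> last ys) \<odot> (z \<odot> m \<odot> inv z) \<odot> (z \<odot> y) = inv (last ys) \<odot> m \<odot> y"
      by (simp add: inverse_distrib_swap assoc)
    have "conj_phase (inv y) m = conj_phase (inv (z \<odot> y)) (z \<odot> m \<odot> inv z) * conj_phase z m"
      using conj_phase_mult[of "inv (z \<odot> y)" z m] by (simp add: inverse_distrib_swap)
    then show ?thesis
      using l x by (simp add: unfold_cochain_def Cons Let_def steps_map)
  qed (simp add: unfold_cochain_def)
qed

lemma \<Theta>_unfold: "xs \<noteq> [] \<Longrightarrow> \<Theta> (unfold_cochain \<phi>) xs = \<phi> xs"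
proof -
  assume "xs \<noteq> []"
  then obtain x ys where xs: "xs = x # ys" by (cases xs) auto
  have "inv (last (path one ys)) \<odot> prd (ys @ [x]) \<odot> one = x"
    by (simp add: last_path prd_append)
  then show ?thesis
    using steps_path[of one ys] path_Cons[of one ys]
    by (auto simp: \<Theta>_def xs unfold_cochain_def Let_def split: list.splits)
qed

lemma \<Theta>_cong: "(\<And>ys m. length ys = length xs \<Longrightarrow> A ys m = A' ys m) \<Longrightarrow> \<Theta> A xs = \<Theta> A' xs"
  by (cases xs) (simp_all add: \<Theta>_def)

lemma \<Theta>_lin:
  "\<Theta> (\<lambda>ys m. A ys m - A' ys m) xs = \<Theta> A xs - \<Theta> A' xs"
  "\<Theta> (\<lambda>ys m. A ys m + A' ys m) xs = \<Theta> A xs + \<Theta> A' xs"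
  "\<Theta> (\<lambda>ys m. c * A ys m) xs = c * \<Theta> A xs"
  "\<Theta> (\<lambda>ys m. 0) xs = 0"
  by (simp_all add: \<Theta>_def algebra_simps split: list.split)

lemma hb_cong:
  "(\<And>ys. Suc (length ys) = length xs \<Longrightarrow> \<phi> ys = \<psi> ys) \<Longrightarrow> hb \<phi> xs = hb \<psi> xs"
  unfolding hb_def by (intro if_cong refl sum.cong face_cong) simp_all

text \<open>Read off from \<open>sd_sd\<close> in the vertex model, which replaces the combinatorics
  of double faces.\<close>

lemma hb_hb: "hb (hb \<phi>) xs = 0"
proof (cases "3 \<le> length xs")
  case True
  let ?F = "unfold_cochain \<phi>"
  note eq = equivariant_unfold[of \<phi>]
  have "hb (hb \<phi>) xs = hb (\<Theta> (gd ?F)) xs"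
  proof (rule hb_cong)
    fix ys :: "'g list"
    assume ys: "Suc (length ys) = length xs"
    have "hb \<phi> ys = hb (\<Theta> ?F) ys"
    proof (rule hb_cong)
      fix zs :: "'g list"
      assume "Suc (length zs) = length ys"
      then have "zs \<noteq> []" using ys True by auto
      then show "\<phi> zs = \<Theta> ?F zs" by (simp add: \<Theta>_unfold)
    qed
    then show "hb \<phi> ys = \<Theta> (gd ?F) ys" using hb_\<Theta>[OF eq, of ys] ys True by simp
  qed
  also have "\<dots> = \<Theta> (gd (gd ?F)) xs"
    using hb_\<Theta>[OF equivariant_gd[OF eq], of xs] True by simp
  also have "\<dots> = 0" by (simp add: sd_sd \<Theta>_lin)
  finally show ?thesis .
next
  case False
  have "hb \<psi> ys = 0" if "length ys < 2" for \<psi> ys using that by (simp add: hb_def)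
  with hb_cong[of xs "hb \<phi>" "\<lambda>_. 0"] have "hb (hb \<phi>) xs = hb (\<lambda>_. 0) xs" using False by simp
  also have "hb (\<lambda>_. 0) xs = 0"
  proof -
    have "face i (\<lambda>_. 0) xs = 0" for i by (simp add: face_def)
    then show ?thesis by (simp add: hb_def)
  qed
  finally show ?thesis .
qed

end

section \<open>Invariant cochains of a free abelian group of rank two\<close>

text \<open>The discrete primitive of g that vanishes at 0; the sign on the negative side makes
  \<open>intsum_step\<close> hold on all integers.\<close>

definition intsum :: "(int \<Rightarrow> complex) \<Rightarrow> int \<Rightarrow> complex" where
  "intsum g k = (if 0 \<le> k then \<Sum>i\<in>{0..<k}. g i else - (\<Sum>i\<in>{k..<0}. g i))"

lemma intsum_step: "intsum g (1 + k) = intsum g k + g k"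
proof (cases "0 \<le> k")
  case True
  then have "{0..<1 + k} = insert k {0..<k}" by auto
  then show ?thesis using True by (simp add: intsum_def)
next
  case False
  then have "{k..<0} = insert k {1 + k..<0}" by auto
  then show ?thesis using False by (simp add: intsum_def)
qed

context twisted_group
begin

definition invariant_under :: "'g set \<Rightarrow> ('g list \<Rightarrow> complex) \<Rightarrow> bool" where
  "invariant_under H F \<longleftrightarrow> (\<forall>h\<in>H. \<forall>ys. F (map ((\<odot>) h) ys) = F ys)"

lemma invariant_underD: "invariant_under H F \<Longrightarrow> h \<in> H \<Longrightarrow> F (map ((\<odot>) h) ys) = F ys"
  by (simp add: invariant_under_def)

lemma map_mul_mul: "map ((\<odot>) x) (map ((\<odot>) y) ys) = map ((\<odot>) (x \<odot> y)) ys"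
  by (simp add: assoc)

lemma map_mul_one [simp]: "map ((\<odot>) one) ys = ys"
  by (induction ys) simp_all

lemma invariant_under_Un:
  "invariant_under (H \<union> K) F \<longleftrightarrow> invariant_under H F \<and> invariant_under K F"
  by (auto simp: invariant_under_def)

end

text \<open>The picture: \<open>t\<close> is one lattice direction, \<open>co\<close> a coordinate
  along it, and \<open>H\<close> the elements under which invariance has been achieved
  already.\<close>

locale shift_group = twisted_group mul one inv \<alpha>
  for mul :: "'g \<Rightarrow> 'g \<Rightarrow> 'g" (infixl \<open>\<odot>\<close> 70) and one and inv and \<alpha> +
  fixes H :: "'g set" and t :: "int \<Rightarrow> 'g" and co :: "'g \<Rightarrow> int"
  assumes t_add: "t (i + j) = t i \<odot> t j"
    and co_t: "co (t i \<odot> y) = i + co y"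
    and co_H: "h \<in> H \<Longrightarrow> co (h \<odot> y) = co y"
    and t_H: "h \<in> H \<Longrightarrow> t i \<odot> h = h \<odot> t i"
begin

lemma t_0 [simp]: "t 0 = one"
  using t_add[of 0 0] by (metis add_0 left_cancel right_neutral)

lemma invariant_under_range_t:
  assumes "\<And>ys. F (map ((\<odot>) (t 1)) ys) = F ys"
  shows "invariant_under (range t) F"
  unfolding invariant_under_def
proof (intro ballI allI)
  fix h ys
  assume "h \<in> range t"
  then obtain i where h: "h = t i" by auto
  have "F (map ((\<odot>) (t i)) ys) = F ys" for ys
  proof (induction i rule: int_induct[where k = 0])
    case (step1 i)
    then show ?case
      using assms[of "map ((\<odot>) (t i)) ys"] t_add[of 1 i]
      by (simp only: map_mul_mul add.commute)
  next
    case (step2 i)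
    then show ?case
      using assms[of "map ((\<odot>) (t (i - 1))) ys"] t_add[of 1 "i - 1"]
      by (simp only: map_mul_mul) simp
  qed simp
  then show "F (map ((\<odot>) h) ys) = F ys" by (simp add: h)
qed

lemma antidifference:
  assumes E: "invariant_under H E"
  obtains E' where "invariant_under H E'"
    and "\<And>ys. ys \<noteq> [] \<Longrightarrow> E' (map ((\<odot>) (t 1)) ys) - E' ys = E ys"
proof
  \<comment> \<open>The summation index is the coordinate of the first vertex of the translate: the
    sum runs over the translates of \<open>ys\<close> from coordinate 0 up to, and excluding,
    \<open>ys\<close> itself. Moving \<open>ys\<close> by \<open>t 1\<close> therefore adds exactly
    the term \<open>E ys\<close>. The empty list has no first vertex and gets the value 0.\<close>
  define E' where
    "E' ys = intsum (\<lambda>i. E (map ((\<odot>) (t (i - co (hd ys)))) ys)) (if ys = [] then 0 else co (hd ys))" for ys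
  show "invariant_under H E'"
    unfolding invariant_under_def
  proof (intro ballI allI)
    fix h ys
    assume h: "h \<in> H"
    show "E' (map ((\<odot>) h) ys) = E' ys"
    proof (cases "ys = []")
      case False
      then have c: "co (hd (map ((\<odot>) h) ys)) = co (hd ys)" by (simp add: hd_map co_H h)
      have "E (map ((\<odot>) (t i)) (map ((\<odot>) h) ys)) = E (map ((\<odot>) (t i)) ys)" for i
        using invariant_underD[OF E h, of "map ((\<odot>) (t i)) ys"] t_H[OF h, of i]
        by (simp only: map_mul_mul)
      then show ?thesis unfolding E'_def c using False by simp
    qed simp
  qed
  fix ys :: "'g list"
  assume ys: "ys \<noteq> []"
  have c: "co (hd (map ((\<odot>) (t 1)) ys)) = 1 + co (hd ys)" using ys by (simp add: hd_map co_t)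
  have m: "map ((\<odot>) (t (i - (1 + k)))) (map ((\<odot>) (t 1)) ys) = map ((\<odot>) (t (i - k))) ys" for i k
    using t_add[of "i - (1 + k)" 1] by (simp only: map_mul_mul) simp
  show "E' (map ((\<odot>) (t 1)) ys) - E' ys = E ys"
    unfolding E'_def c m using ys by (simp add: intsum_step)
qed

text \<open>The connecting map of \<open>0 \<rightarrow> C(H \<times> \<langle>t\<rangle>) \<rightarrow> C(H) \<rightarrow> C(H) \<rightarrow> 0\<close>, where \<open>C(K)\<close> are the \<open>K\<close>-invariant cochains
  and the last map is \<open>t - 1\<close>, which is onto by the previous lemma.\<close>

lemma primitive_step:
  assumes F: "invariant_under (range t) F"
    and A: "invariant_under H A" "\<And>ys. length ys = Suc n \<Longrightarrow> sd A ys = F ys"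
    and E: "invariant_under H E"
      "\<And>ys. length ys = n \<Longrightarrow> A (map ((\<odot>) (t 1)) ys) - A ys = sd E ys"
    and n: "2 \<le> n"
  shows "\<exists>A'. invariant_under (H \<union> range t) A' \<and> (\<forall>ys. length ys = Suc n \<longrightarrow> sd A' ys = F ys)"
proof -
  obtain E' where E': "invariant_under H E'"
    "\<And>ys. ys \<noteq> [] \<Longrightarrow> E' (map ((\<odot>) (t 1)) ys) - E' ys = E ys"
    using antidifference[OF E(1)] by blast
  \<comment> \<open>The hypothesis on \<open>E\<close> controls \<open>A\<close> on lists of length
    n only; the cut-off makes the invariance hold on all lists.\<close>
  define A' where "A' ys = (if length ys = n then A ys - sd E' ys else 0)" for ys
  have "invariant_under H A'"
    using A(1) E'(1) by (simp add: invariant_under_def A'_def sd_map[symmetric])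
  moreover have "invariant_under (range t) A'"
  proof (rule invariant_under_range_t)
    fix ys :: "'g list"
    have "sd E' (map ((\<odot>) (t 1)) ys) - sd E' ys = sd E ys" if "length ys = n"
    proof -
      have "sd E' (map ((\<odot>) (t 1)) ys) - sd E' ys = sd (\<lambda>zs. E' (map ((\<odot>) (t 1)) zs) - E' zs) ys"
        by (simp add: sd_diff sd_map)
      \<comment> \<open>2 \<le> n keeps the faces of \<open>ys\<close> non-empty, where the
        difference equation is available.\<close>
      also have "\<dots> = sd E ys"
        by (rule sd_cong, rule E'(2)) (use n that in auto)
      finally show ?thesis .
    qed
    then show "A' (map ((\<odot>) (t 1)) ys) = A' ys"
      using E(2)[of ys] by (auto simp: A'_def algebra_simps)
  qed
  moreover have "sd A' ys = F ys" if l: "length ys = Suc n" for ys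
  proof -
    have "sd A' ys = sd (\<lambda>zs. A zs - sd E' zs) ys"
      by (rule sd_cong) (use l in \<open>simp add: A'_def\<close>)
    then show ?thesis using A(2)[OF l] by (simp add: sd_diff sd_sd)
  qed
  ultimately show ?thesis by (auto simp: invariant_under_Un)
qed

end

section \<open>Hochschild cohomology of the twisted group algebra\<close>

text \<open>The element \<open>cc m\<close> of the centralizer of \<open>m\<close> is where the phase character of that centralizer is
  non-trivial; this kills the cohomology of the sector of \<open>m\<close>.\<close>

locale crystal = twisted_group mul one inv \<alpha> +
    T1: shift_group mul one inv \<alpha> "{}" t1 co1 +
    T2: shift_group mul one inv \<alpha> "range t1" t2 co2
  for mul :: "'g \<Rightarrow> 'g \<Rightarrow> 'g" (infixl \<open>\<odot>\<close> 70) and one and inv and \<alpha> and t1 and co1 and t2 and co2 +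
  fixes cc :: "'g \<Rightarrow> 'g" and R :: "'g set" and sh :: "'g \<Rightarrow> 'g \<Rightarrow> 'g"
    and area :: "'g \<Rightarrow> 'g \<Rightarrow> 'g \<Rightarrow> complex"
  assumes cc_comm: "m \<noteq> one \<Longrightarrow> infinite {z. z \<odot> m = m \<odot> z} \<Longrightarrow> cc m \<odot> m = m \<odot> cc m"
    and cc_phase: "m \<noteq> one \<Longrightarrow> infinite {z. z \<odot> m = m \<odot> z} \<Longrightarrow> conj_phase (cc m) m \<noteq> 1"
    and cc_conj: "m \<noteq> one \<Longrightarrow> infinite {z. z \<odot> m = m \<odot> z} \<Longrightarrow> cc (z \<odot> m \<odot> inv z) = z \<odot> cc m \<odot> inv z"
    and R_finite: "finite R" and R_nonempty: "R \<noteq> {}"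
    and sh_bij: "bij_betw (sh z) R R"
    and sh: "r \<in> R \<Longrightarrow> \<exists>i j. r \<odot> z = t1 i \<odot> t2 j \<odot> sh z r"
    and no_hom: "(\<And>x y. \<chi> (x \<odot> y) = \<chi> x + \<chi> y) \<Longrightarrow> \<chi> x = (0 :: complex)"
    and area_inv: "area (z \<odot> x) (z \<odot> y) (z \<odot> w) = area x y w"
    and area_cocycle: "area y w v - area x w v + area x y v - area x y w = 0"
    and area_nz: "area one (t1 1) (t1 1 \<odot> t2 1) - area one (t2 1) (t1 1 \<odot> t2 1) \<noteq> 0"
begin

section \<open>Invariant primitives in the sector of the identity\<close>

lemma primitive_none:
  "(\<And>ys. length ys = n + 2 \<Longrightarrow> sd F ys = 0) \<Longrightarrow> length ys = n + 1 \<Longrightarrow> sd (\<lambda>zs. F (one # zs)) ys = F ys"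
  by (drule meta_spec[of _ "one # ys"]) simp

text \<open>The cone with apex \<open>one\<close> is a primitive without invariance. Its defect
  \<open>B\<close> under \<open>t1\<close> is a cocycle of one degree less, and the cone over
  \<open>B\<close> is the \<open>E\<close> that \<open>primitive_step\<close> asks for. Lists of
  length n + 1 have degree n.\<close>

lemma primitive_t1:
  assumes F: "invariant_under (range t1) F" and c: "\<And>ys. length ys = n + 2 \<Longrightarrow> sd F ys = 0"
    and n: "2 \<le> n"
  shows "\<exists>A. invariant_under (range t1) A \<and> (\<forall>ys. length ys = Suc n \<longrightarrow> sd A ys = F ys)"
proof -
  define A where "A zs = F (one # zs)" for zs
  have A: "sd A ys = F ys" if "length ys = Suc n" for ys
    unfolding A_def using primitive_none[OF c] that by simp
  define B where "B ys = A (map ((\<odot>) (t1 1)) ys) - A ys" for ys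
  have B: "sd B ys = 0" if "length ys = Suc n" for ys
    using A[of ys] A[of "map ((\<odot>) (t1 1)) ys"] that invariant_underD[OF F, of "t1 1" ys]
    by (simp add: B_def[abs_def] sd_diff sd_map)
  obtain k where k: "n = Suc k" using n by (cases n) auto
  have E: "B ys = sd (\<lambda>zs. B (one # zs)) ys" if "length ys = n" for ys
    using primitive_none[of k B ys] B that k by simp
  show ?thesis
    using T1.primitive_step[OF F, of A n "\<lambda>zs. B (one # zs)"] A E n
    by (simp add: invariant_under_def B_def)
qed

lemma t1_t2: "t1 i \<odot> t2 j = t2 j \<odot> t1 i"
  using T2.t_H[of "t1 i" j] by simp

lemma invariant_under_shift_diff:
  assumes "invariant_under (range t1) A"
  shows "invariant_under (range t1) (\<lambda>ys. A (map ((\<odot>) (t2 1)) ys) - A ys)"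
  unfolding invariant_under_def
proof (intro ballI allI)
  fix h ys assume "h \<in> range t1"
  then obtain i where h: "h = t1 i" by auto
  have "A (map ((\<odot>) (t2 1)) (map ((\<odot>) (t1 i)) ys)) = A (map ((\<odot>) (t1 i)) (map ((\<odot>) (t2 1)) ys))"
    by (simp only: map_mul_mul t1_t2)
  then show "A (map ((\<odot>) (t2 1)) (map ((\<odot>) h) ys)) - A (map ((\<odot>) h) ys) = A (map ((\<odot>) (t2 1)) ys) - A ys"
    using assms by (simp add: h invariant_under_def del: map_map)
qed

lemma sd_shift_diff:
  assumes "invariant_under (range t2) F" "\<And>ys. length ys = Suc n \<Longrightarrow> sd A ys = F ys"
    "length ys = Suc n"
  shows "sd (\<lambda>ys. A (map ((\<odot>) (t2 1)) ys) - A ys) ys = 0"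
  using assms(2)[of ys] assms(2)[of "map ((\<odot>) (t2 1)) ys"] assms(3)
    invariant_underD[OF assms(1), of "t2 1" ys] by (simp add: sd_diff sd_map)

text \<open>The defect under \<open>t2\<close> of a \<open>t1\<close>-invariant primitive is a
  \<open>t1\<close>-invariant cocycle of degree n - 1, and \<open>primitive_t1\<close> applies to it
  when 2 \<le> n - 1.\<close>

lemma primitive_t1_t2:
  assumes F: "invariant_under (range t1 \<union> range t2) F"
    and c: "\<And>ys. length ys = n + 2 \<Longrightarrow> sd F ys = 0" and n: "3 \<le> n"
  shows "\<exists>A. invariant_under (range t1 \<union> range t2) A \<and> (\<forall>ys. length ys = Suc n \<longrightarrow> sd A ys = F ys)"
proof -
  have F1: "invariant_under (range t1) F" and F2: "invariant_under (range t2) F"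
    using F by (simp_all add: invariant_under_Un)
  obtain A where A: "invariant_under (range t1) A" "\<And>ys. length ys = Suc n \<Longrightarrow> sd A ys = F ys"
    using primitive_t1[OF F1, of n, OF c] n by auto
  obtain k where k: "n = Suc k" "2 \<le> k" using n by (cases n) auto
  have s: "sd (\<lambda>ys. A (map ((\<odot>) (t2 1)) ys) - A ys) ys = 0" if "length ys = k + 2" for ys
    by (rule sd_shift_diff[OF F2 A(2)]) (use k that in auto)
  obtain E where E: "invariant_under (range t1) E"
    "\<And>ys. length ys = n \<Longrightarrow> sd E ys = A (map ((\<odot>) (t2 1)) ys) - A ys"
    using primitive_t1[OF invariant_under_shift_diff[OF A(1)], of k, OF s] k by auto
  show ?thesis
    by (rule T2.primitive_step[OF F2 A E(1)]) (use E(2) n in auto)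
qed

text \<open>Evaluation on the fundamental cycle of the torus.\<close>

definition period :: "('g list \<Rightarrow> complex) \<Rightarrow> complex" where
  "period F = F [one, t1 1, t1 1 \<odot> t2 1] - F [one, t2 1, t1 1 \<odot> t2 1]"

text \<open>Here the defect \<open>B\<close> is a \<open>t1\<close>-invariant 1-cocycle. The cone
  over it is invariant precisely if \<open>B\<close> vanishes on the edge from \<open>one\<close> to
  \<open>t1 1\<close>, and this value is minus the period of F.\<close>

lemma primitive_t1_t2_degree_2:
  assumes F: "invariant_under (range t1 \<union> range t2) F"
    and c: "\<And>ys. length ys = 4 \<Longrightarrow> sd F ys = 0" and p: "period F = 0"
  shows "\<exists>A. invariant_under (range t1 \<union> range t2) A \<and> (\<forall>ys. length ys = 3 \<longrightarrow> sd A ys = F ys)"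
proof -
  have F1: "invariant_under (range t1) F" and F2: "invariant_under (range t2) F"
    using F by (simp_all add: invariant_under_Un)
  obtain A where A: "invariant_under (range t1) A" "\<And>ys. length ys = 3 \<Longrightarrow> sd A ys = F ys"
    using primitive_t1[OF F1, of 2] c by (auto simp: numeral_3_eq_3)
  define B where "B ys = A (map ((\<odot>) (t2 1)) ys) - A ys" for ys
  have B1: "invariant_under (range t1) B"
    unfolding B_def[abs_def] by (rule invariant_under_shift_diff[OF A(1)])
  have B: "B [y, w] - B [x, w] + B [x, y] = 0" for x y w
    using sd_shift_diff[OF F2, of 2 A "[x, y, w]"] A(2) by (simp add: B_def)
  define E where "E ys = (if length ys = 1 then B (one # ys) else 0)" for ys
  have "B [one, t1 1] = - period F"
    using invariant_underD[OF A(1), of "t1 1" "[one, t2 1]"]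
    by (simp add: period_def B_def t1_t2 A(2)[symmetric])
  then have B0: "B [one, t1 1] = 0" using p by simp
  have "invariant_under (range t1) E"
  proof (rule T1.invariant_under_range_t)
    fix ys :: "'g list"
    show "E (map ((\<odot>) (t1 1)) ys) = E ys"
    proof (cases "length ys = 1")
      case True
      then obtain y where ys: "ys = [y]" by (cases ys) auto
      show ?thesis
        using B[of "t1 1" "t1 1 \<odot> y" one] B0 invariant_underD[OF B1, of "t1 1" "[one, y]"]
        by (simp add: E_def ys)
    qed (simp add: E_def)
  qed
  moreover have "A (map ((\<odot>) (t2 1)) ys) - A ys = sd E ys" if l: "length ys = 2" for ys
  proof -
    obtain y w where ys: "ys = [y, w]"
      using l by (cases ys; cases "tl ys") auto
    show ?thesis using B[of y w one] by (simp add: ys E_def B_def algebra_simps)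
  qed
  ultimately show ?thesis
    using T2.primitive_step[OF F2 A(1), of 2 E] A(2) by simp
qed

text \<open>\<open>R\<close> represents the cosets of the translation lattice. Right multiplication
  by z permutes them through \<open>sh z\<close> up to translations, which \<open>A\<close> does not
  see, so the average is invariant under the whole group; the invariance of F keeps its coboundary
  equal to F.\<close>

lemma average:
  assumes A: "invariant_under (range t1 \<union> range t2) A"
    and s: "\<And>ys. length ys = n \<Longrightarrow> sd A ys = F ys" and F: "invariant_under UNIV F"
  shows "\<exists>A. invariant_under UNIV A \<and> (\<forall>ys. length ys = n \<longrightarrow> sd A ys = F ys)"
proof (intro exI conjI allI impI)
  define A' where "A' ys = (\<Sum>r\<in>R. (1 / of_nat (card R)) * A (map ((\<odot>) r) ys))" for ys
  show "invariant_under UNIV A'"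
    unfolding invariant_under_def
  proof (intro ballI allI)
    fix z ys
    have "A (map ((\<odot>) r) (map ((\<odot>) z) ys)) = A (map ((\<odot>) (sh z r)) ys)" if "r \<in> R" for r
    proof -
      obtain i j where "r \<odot> z = t1 i \<odot> t2 j \<odot> sh z r" using sh \<open>r \<in> R\<close> by blast
      then have "map ((\<odot>) r) (map ((\<odot>) z) ys) = map ((\<odot>) (t1 i)) (map ((\<odot>) (t2 j)) (map ((\<odot>) (sh z r)) ys))"
        by (simp only: map_mul_mul assoc)
      then show ?thesis using A by (simp add: invariant_under_def del: map_map)
    qed
    then have "A' (map ((\<odot>) z) ys) = (\<Sum>r\<in>R. (1 / of_nat (card R)) * A (map ((\<odot>) (sh z r)) ys))"
      by (simp add: A'_def del: map_map)
    then show "A' (map ((\<odot>) z) ys) = A' ys"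
      using sum.reindex_bij_betw[OF sh_bij[of z], of "\<lambda>r. (1 / of_nat (card R)) * A (map ((\<odot>) r) ys)"]
      by (simp add: A'_def)
  qed
  fix ys :: "'g list"
  assume l: "length ys = n"
  have "sd A' ys = (\<Sum>r\<in>R. (1 / of_nat (card R)) * F (map ((\<odot>) r) ys))"
    using s l by (simp add: A'_def[abs_def] sd_sum sd_divide sd_scale sd_map)
  also have "\<dots> = F ys"
    using F R_finite R_nonempty by (simp add: invariant_under_def)
  finally show "sd A' ys = F ys" .
qed

section \<open>Sectors of non-trivial elements and gluing\<close>

definition fin :: "'g \<Rightarrow> bool" where
  "fin m \<longleftrightarrow> finite {z. z \<odot> m = m \<odot> z}"

definition crep :: "'g \<Rightarrow> 'g" where
  "crep m = (SOME m'. \<exists>z. m' = z \<odot> m \<odot> inv z)"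

text \<open>The conjugators from \<open>crep m\<close> to \<open>m\<close>, a coset of the
  centralizer of \<open>m\<close>. The centralizer itself moves by conjugation; this coset moves by
  left multiplication, as vertices do, so its elements can serve as apexes of an equivariant family
  of cones.\<close>

definition to_rep :: "'g \<Rightarrow> 'g set" where
  "to_rep m = {s. m \<odot> s = s \<odot> crep m}"

lemma conj_eq_one [simp]: "z \<odot> m \<odot> inv z = one \<longleftrightarrow> m = one"
  by (metis left_neutral mul_inv_cancel(4) right_inverse right_neutral left_cancel)

lemma conj_conj: "a \<odot> (b \<odot> m \<odot> inv b) \<odot> inv a = (a \<odot> b) \<odot> m \<odot> inv (a \<odot> b)"
  by (simp add: inverse_distrib_swap assoc)

lemma crep_conj: "crep (z \<odot> m \<odot> inv z) = crep m"
proof -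
  have "(\<exists>w. m' = w \<odot> (z \<odot> m \<odot> inv z) \<odot> inv w) \<longleftrightarrow> (\<exists>w. m' = w \<odot> m \<odot> inv w)" for m'
  proof
    assume "\<exists>w. m' = w \<odot> m \<odot> inv w"
    then obtain w where "m' = w \<odot> m \<odot> inv w" by blast
    then have "m' = (w \<odot> inv z) \<odot> (z \<odot> m \<odot> inv z) \<odot> inv (w \<odot> inv z)"
      by (simp add: conj_conj)
    then show "\<exists>w. m' = w \<odot> (z \<odot> m \<odot> inv z) \<odot> inv w" by blast
  qed (auto simp: conj_conj)
  then show ?thesis by (simp add: crep_def)
qed

lemma to_rep_nonempty: "to_rep m \<noteq> {}"
proof -
  obtain z where "crep m = z \<odot> m \<odot> inv z"
    using someI_ex[of "\<lambda>m'. \<exists>z. m' = z \<odot> m \<odot> inv z"] by (auto simp: crep_def)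
  then have "m \<odot> inv z = inv z \<odot> crep m" by (simp add: assoc)
  then show ?thesis by (auto simp: to_rep_def)
qed

lemma to_rep_conj: "to_rep (z \<odot> m \<odot> inv z) = (\<odot>) z ` to_rep m"
proof
  show "(\<odot>) z ` to_rep m \<subseteq> to_rep (z \<odot> m \<odot> inv z)"
    unfolding to_rep_def crep_conj by (auto simp: assoc)
  show "to_rep (z \<odot> m \<odot> inv z) \<subseteq> (\<odot>) z ` to_rep m"
  proof
    fix s assume "s \<in> to_rep (z \<odot> m \<odot> inv z)"
    then have "z \<odot> (m \<odot> (inv z \<odot> s)) = s \<odot> crep m"
      unfolding to_rep_def crep_conj by (simp add: assoc)
    then have "m \<odot> (inv z \<odot> s) = inv z \<odot> (s \<odot> crep m)"
      by (metis mul_inv_cancel(1))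
    then have "inv z \<odot> s \<in> to_rep m" by (simp add: to_rep_def assoc)
    moreover have "s = z \<odot> (inv z \<odot> s)" by simp
    ultimately show "s \<in> (\<odot>) z ` to_rep m" by blast
  qed
qed

text \<open>Two conjugators differ by an element of the centralizer.\<close>

lemma fin_to_rep: "fin m \<Longrightarrow> finite (to_rep m)"
proof -
  assume m: "fin m"
  obtain s0 where s0: "s0 \<in> to_rep m" using to_rep_nonempty by blast
  have "s \<odot> inv s0 \<in> {z. z \<odot> m = m \<odot> z}" if "s \<in> to_rep m" for s
  proof -
    have "inv s0 \<odot> m = crep m \<odot> inv s0"
      using s0 unfolding to_rep_def by (metis (mono_tags) mem_Collect_eq assoc mul_inv_cancel(1,3))
    then have "s \<odot> inv s0 \<odot> m = s \<odot> crep m \<odot> inv s0" by (simp add: assoc)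
    also have "\<dots> = m \<odot> (s \<odot> inv s0)" using that by (simp add: to_rep_def assoc[symmetric])
    finally show ?thesis by simp
  qed
  then have "(\<lambda>s. s \<odot> inv s0) ` to_rep m \<subseteq> {z. z \<odot> m = m \<odot> z}" by blast
  then have "finite ((\<lambda>s. s \<odot> inv s0) ` to_rep m)" using m finite_subset unfolding fin_def by blast
  moreover have "inj_on (\<lambda>s. s \<odot> inv s0) (to_rep m)"
    by (rule inj_onI) (metis mul_inv_cancel(4))
  ultimately show ?thesis by (rule finite_imageD)
qed

lemma fin_conj: "fin (z \<odot> m \<odot> inv z) \<longleftrightarrow> fin m"
proof -
  have *: "fin (z \<odot> m \<odot> inv z)" if "fin m" for z m
  proof -
    have "{w. w \<odot> (z \<odot> m \<odot> inv z) = (z \<odot> m \<odot> inv z) \<odot> w} \<subseteq> (\<lambda>w. z \<odot> w \<odot> inv z) ` {w. w \<odot> m = m \<odot> w}"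
    proof
      fix w assume "w \<in> {w. w \<odot> (z \<odot> m \<odot> inv z) = (z \<odot> m \<odot> inv z) \<odot> w}"
      then have w: "w \<odot> z \<odot> m \<odot> inv z = z \<odot> m \<odot> inv z \<odot> w" by (simp add: assoc)
      have "inv z \<odot> w \<odot> z \<odot> m = inv z \<odot> (w \<odot> z \<odot> m \<odot> inv z) \<odot> z" by (simp add: assoc)
      also have "\<dots> = m \<odot> (inv z \<odot> w \<odot> z)" unfolding w by (simp add: assoc)
      finally have "inv z \<odot> w \<odot> z \<in> {w. w \<odot> m = m \<odot> w}" by simp
      moreover have "w = z \<odot> (inv z \<odot> w \<odot> z) \<odot> inv z" by (simp add: assoc)
      ultimately show "w \<in> (\<lambda>w. z \<odot> w \<odot> inv z) ` {w. w \<odot> m = m \<odot> w}" by blast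
    qed
    then show ?thesis using that finite_subset unfolding fin_def by blast
  qed
  show ?thesis using *[of m z] *[of "z \<odot> m \<odot> inv z" "inv z"] by (auto simp: assoc)
qed

text \<open>Makes the scalar in front of the prism in \<open>glue_sectors\<close> constant along a
  conjugacy class.\<close>

lemma conj_phase_conj:
  assumes "c \<odot> m = m \<odot> c"
  shows "conj_phase (z \<odot> c \<odot> inv z) (z \<odot> m \<odot> inv z) = conj_phase c m"
proof -
  have "c \<odot> m \<odot> inv c = m" using assms by simp
  then have "conj_phase z m * conj_phase c m = conj_phase (z \<odot> c) m"
    using conj_phase_mult[of z c m] by simp
  also have "\<dots> = conj_phase (z \<odot> c \<odot> inv z) (z \<odot> m \<odot> inv z) * conj_phase z m"
    using conj_phase_mult[of "z \<odot> c \<odot> inv z" z m] by simp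
  finally show ?thesis by simp
qed

text \<open>The simplicial coboundary leaves \<open>m\<close> alone, so primitives may be chosen
  sector by sector; only equivariance ties together the sectors of one conjugacy class.\<close>

lemma glue_sectors:
  assumes F: "equivariant F" and c: "\<And>ys m. length ys = n + 2 \<Longrightarrow> gd F ys m = 0"
    and A1: "invariant_under UNIV A1" "\<And>ys. length ys = Suc n \<Longrightarrow> sd A1 ys = F ys one"
  shows "\<exists>A. equivariant A \<and> (\<forall>ys m. length ys = Suc n \<longrightarrow> gd A ys m = F ys m)"
proof -
  \<comment> \<open>By equivariance, translating the vertices by \<open>cc m\<close> divides F by
    the phase. The prism homotopy thus yields (1 / phase - 1) * F, and \<open>k m\<close> is the
    reciprocal of that factor.\<close>
  define k where "k m = 1 / (1 / conj_phase (cc m) m - 1)" for m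
  define A where "A ys m = (if m = one then A1 ys
    else if fin m then \<Sum>s\<in>to_rep m. 1 / of_nat (card (to_rep m)) * F (s # ys) m
    else k m * prism ((\<odot>) (cc m)) (\<lambda>zs. F zs m) ys)" for ys m
  have "equivariant A"
    unfolding equivariant_def
  proof (intro allI)
    fix z ys m
    let ?m = "z \<odot> m \<odot> inv z"
    have Fz: "F (map ((\<odot>) z) zs) ?m * conj_phase z m = F zs m" for zs
      by (rule equivariantD[OF F])
    consider "m = one" | "m \<noteq> one" "fin m" | "m \<noteq> one" "\<not> fin m" by blast
    then show "A (map ((\<odot>) z) ys) ?m * conj_phase z m = A ys m"
    proof cases
      case 1
      then show ?thesis using invariant_underD[OF A1(1)] by (simp add: A_def)
    next
      case 2
      have i: "inj_on ((\<odot>) z) (to_rep m)" by (rule inj_onI) (simp add: left_cancel)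
      have "(\<Sum>s\<in>to_rep ?m. 1 / of_nat (card (to_rep ?m)) * F (s # map ((\<odot>) z) ys) ?m) * conj_phase z m
        = (\<Sum>s\<in>to_rep m. 1 / of_nat (card (to_rep m)) * (F (map ((\<odot>) z) (s # ys)) ?m * conj_phase z m))"
        unfolding to_rep_conj by (simp add: sum.reindex[OF i] card_image[OF i] sum_distrib_right mult.assoc)
      also have "\<dots> = (\<Sum>s\<in>to_rep m. 1 / of_nat (card (to_rep m)) * F (s # ys) m)"
        by (simp only: Fz)
      finally show ?thesis using 2 by (simp add: A_def fin_conj)
    next
      case 3
      have cm: "cc m \<odot> m = m \<odot> cc m" and cz: "cc ?m = z \<odot> cc m \<odot> inv z"
        using cc_comm cc_conj 3 by (auto simp: fin_def)
      have "k ?m = k m" by (simp only: k_def cz conj_phase_conj[OF cm])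
      moreover have "prism ((\<odot>) (cc ?m)) (\<lambda>zs. F zs ?m) (map ((\<odot>) z) ys) * conj_phase z m
          = prism ((\<odot>) (cc m)) (\<lambda>zs. F zs m) ys"
      proof -
        have "prism ((\<odot>) (cc ?m)) (\<lambda>zs. F zs ?m) (map ((\<odot>) z) ys)
            = prism ((\<odot>) (cc m)) (\<lambda>zs. F (map ((\<odot>) z) zs) ?m) ys"
          unfolding cz by (rule prism_map) (simp add: assoc)
        then have "prism ((\<odot>) (cc ?m)) (\<lambda>zs. F zs ?m) (map ((\<odot>) z) ys) * conj_phase z m
            = prism ((\<odot>) (cc m)) (\<lambda>zs. conj_phase z m * F (map ((\<odot>) z) zs) ?m) ys"
          by (simp only: prism_scale mult.commute)
        also have "\<dots> = prism ((\<odot>) (cc m)) (\<lambda>zs. F zs m) ys"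
          by (rule prism_cong, subst mult.commute, rule Fz)
        finally show ?thesis .
      qed
      ultimately show ?thesis using 3 by (simp add: A_def fin_conj mult.assoc)
    qed
  qed
  moreover have "gd A ys m = F ys m" if l: "length ys = Suc n" for ys m
  proof -
    consider "m = one" | "m \<noteq> one" "fin m" | "m \<noteq> one" "\<not> fin m" by blast
    then show ?thesis
    proof cases
      case 1
      then show ?thesis using A1(2)[OF l] by (simp add: A_def)
    next
      case 2
      have "sd (\<lambda>zs. F (s # zs) m) ys = F ys m" for s
        using c[of "s # ys" m] l by simp
      then have "gd A ys m = (\<Sum>s\<in>to_rep m. 1 / of_nat (card (to_rep m)) * F ys m)"
        using 2 by (simp add: A_def sd_sum sd_divide sd_scale)
      also have "\<dots> = F ys m" using fin_to_rep[OF 2(2)] to_rep_nonempty[of m] by simp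
      finally show ?thesis .
    next
      case 3
      let ?c = "cc m"
      have cm: "?c \<odot> m \<odot> inv ?c = m" and ph: "conj_phase ?c m \<noteq> 1"
        using cc_comm cc_phase 3 by (auto simp: fin_def)
      have "F (map ((\<odot>) ?c) ys) m * conj_phase ?c m = F ys m"
        using equivariantD[OF F, of ?c ys m] cm by simp
      then have e: "F (map ((\<odot>) ?c) ys) m = F ys m / conj_phase ?c m" by (simp add: field_simps)
      have "prism ((\<odot>) ?c) (\<lambda>zs. gd F zs m) ys = prism ((\<odot>) ?c) (\<lambda>_. 0) ys"
        by (rule prism_cong) (use c l in simp)
      then have "sd (prism ((\<odot>) ?c) (\<lambda>zs. F zs m)) ys = (1 / conj_phase ?c m - 1) * F ys m"
        using prism_homotopy[of "(\<odot>) ?c" "\<lambda>zs. F zs m" ys] e by (simp add: algebra_simps)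
      moreover have "1 / conj_phase ?c m - 1 \<noteq> 0" using ph by simp
      ultimately show ?thesis using 3 by (simp add: A_def sd_divide k_def)
    qed
  qed
  ultimately show ?thesis by blast
qed

lemma invariant_sector_one: "equivariant F \<Longrightarrow> invariant_under UNIV (\<lambda>ys. F ys one)"
  unfolding invariant_under_def using equivariantD[of F _ _ one] by simp

lemma invariant_UNIV_mono: "invariant_under UNIV F \<Longrightarrow> invariant_under H F"
  by (simp add: invariant_under_def)

text \<open>Degree 1 is below the reach of the lattice primitives. There an invariant 1-cocycle in
  the sector of the identity is a homomorphism x \<mapsto> F [one, x], which \<open>no_hom\<close>
  kills.\<close>

theorem equivariant_cocycle_exact:
  assumes F: "equivariant F" and c: "\<And>ys m. length ys = n + 2 \<Longrightarrow> gd F ys m = 0"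
    and n: "n = 1 \<or> 3 \<le> n \<or> n = 2 \<and> period (\<lambda>ys. F ys one) = 0"
  shows "\<exists>A. equivariant A \<and> (\<forall>ys m. length ys = Suc n \<longrightarrow> gd A ys m = F ys m)"
proof -
  let ?F = "\<lambda>ys. F ys one"
  note iF = invariant_sector_one[OF F]
  note iF' = invariant_UNIV_mono[OF iF, of "range t1 \<union> range t2"]
  have "\<exists>A. invariant_under UNIV A \<and> (\<forall>ys. length ys = Suc n \<longrightarrow> sd A ys = ?F ys)"
  proof (cases "n = 1")
    case True
    have cy: "F [y, w] one - F [x, w] one + F [x, y] one = 0" for x y w
      using c[of "[x, y, w]" one] True by simp
    have iv: "F [z \<odot> x, z \<odot> y] one = F [x, y] one" for x y z
      using invariant_underD[OF iF, of z "[x, y]"] by simp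
    define \<chi> where "\<chi> x = F [one, x] one" for x
    have "\<chi> (x \<odot> y) = \<chi> x + \<chi> y" for x y
      using cy[of x "x \<odot> y" one] iv[of x one y] by (simp add: \<chi>_def algebra_simps)
    then have z: "\<chi> x = 0" for x by (rule no_hom)
    have "F ys one = 0" if l: "length ys = 2" for ys
    proof -
      obtain y w where ys: "ys = [y, w]"
        using l by (cases ys; cases "tl ys") auto
      show ?thesis using iv[of y one "inv y \<odot> w"] z[of "inv y \<odot> w"] by (simp add: ys \<chi>_def)
    qed
    then show ?thesis using True
      by (intro exI[of _ "\<lambda>_. 0"]) (simp add: invariant_under_def)
  next
    case False
    then have "\<exists>A. invariant_under (range t1 \<union> range t2) A \<and> (\<forall>ys. length ys = Suc n \<longrightarrow> sd A ys = ?F ys)"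
    proof (cases "3 \<le> n")
      case True
      then show ?thesis using primitive_t1_t2[OF iF', of n] c by simp
    next
      case False
      then show ?thesis using primitive_t1_t2_degree_2[OF iF'] c n \<open>n \<noteq> 1\<close> by (auto simp: numeral_3_eq_3)
    qed
    then show ?thesis using average[OF _ _ iF, of _ "Suc n"] by blast
  qed
  then obtain A1 where "invariant_under UNIV A1" "\<And>ys. length ys = Suc n \<Longrightarrow> sd A1 ys = F ys one"
    by auto
  from glue_sectors[OF F c this] show ?thesis by simp
qed

text \<open>Opposite edges of the fundamental square are translates of each other and the diagonal
  occurs twice, so everything cancels.\<close>

lemma period_exact:
  assumes A: "equivariant A" and F: "\<And>ys. length ys = 3 \<Longrightarrow> gd A ys one = F ys"
  shows "period F = 0"
proof -
  note i = invariant_underD[OF invariant_sector_one[OF A]]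
  show ?thesis
    using i[of "t1 1" "[one, t2 1]"] i[of "t2 1" "[one, t1 1]"]
    by (simp add: period_def t1_t2 F[symmetric])
qed

definition area_cochain :: "'g list \<Rightarrow> 'g \<Rightarrow> complex" where
  "area_cochain ys m = (if m = one \<and> length ys = 3 then area (ys ! 0) (ys ! 1) (ys ! 2) else 0)"

lemma equivariant_area: "equivariant area_cochain"
  by (auto simp: equivariant_def area_cochain_def area_inv)

lemma gd_area: "length ys = 4 \<Longrightarrow> gd area_cochain ys m = 0"
proof -
  assume "length ys = 4"
  then obtain x y w v where "ys = [x, y, w, v]"
    by (auto simp: length_Suc_conv numeral_eq_Suc)
  then show ?thesis using area_cocycle[of y w v x] by (simp add: area_cochain_def algebra_simps)
qed

lemma period_area: "period (\<lambda>ys. area_cochain ys one) \<noteq> 0"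
  using area_nz by (simp add: period_def area_cochain_def)

end

section \<open>Back to Hochschild cochains: exactness and the class in degree 2\<close>

context crystal
begin

lemma unfold_cocycle:
  assumes "\<And>xs. length xs = n + 2 \<Longrightarrow> hb \<phi> xs = 0" "length ys = n + 2"
  shows "gd (unfold_cochain \<phi>) ys m = 0"
proof (rule \<Theta>_inject[OF equivariant_gd[OF equivariant_unfold]])
  fix xs :: "'g list"
  assume "length xs = length ys"
  then have l: "length xs = n + 2" using assms(2) by simp
  have "\<Theta> (gd (unfold_cochain \<phi>)) xs = hb (\<Theta> (unfold_cochain \<phi>)) xs"
    using hb_\<Theta>[OF equivariant_unfold] l by simp
  also have "\<dots> = hb \<phi> xs"
  proof (rule hb_cong)
    fix zs :: "'g list"
    assume "Suc (length zs) = length xs"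
    then have "zs \<noteq> []" using l by auto
    then show "\<Theta> (unfold_cochain \<phi>) zs = \<phi> zs" by (rule \<Theta>_unfold)
  qed
  finally show "\<Theta> (gd (unfold_cochain \<phi>)) xs = 0" using assms(1)[OF l] by simp
qed (use assms(2) in auto)

lemma hb_\<Theta>_primitive:
  assumes "equivariant A" "1 \<le> n" "\<And>ys m. length ys = Suc n \<Longrightarrow> gd A ys m = F ys m" "length xs = Suc n"
  shows "hb (\<Theta> A) xs = \<Theta> F xs"
  using hb_\<Theta>[OF assms(1), of xs] \<Theta>_cong[of xs "gd A" F] assms by simp

lemma hb_exact:
  assumes n: "n = 1 \<or> 3 \<le> n" and c: "\<And>xs. length xs = n + 2 \<Longrightarrow> hb \<phi> xs = 0"
  shows "\<exists>\<psi>. \<forall>xs. length xs = Suc n \<longrightarrow> hb \<psi> xs = \<phi> xs"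
proof -
  have "\<exists>A. equivariant A \<and> (\<forall>ys m. length ys = Suc n \<longrightarrow> gd A ys m = unfold_cochain \<phi> ys m)"
    by (rule equivariant_cocycle_exact[OF equivariant_unfold]) (use unfold_cocycle[OF c] n in auto)
  then obtain A where A: "equivariant A" "\<And>ys m. length ys = Suc n \<Longrightarrow> gd A ys m = unfold_cochain \<phi> ys m"
    by blast
  have "hb (\<Theta> A) xs = \<phi> xs" if l: "length xs = Suc n" for xs
  proof -
    have "hb (\<Theta> A) xs = \<Theta> (unfold_cochain \<phi>) xs"
      by (rule hb_\<Theta>_primitive[OF A(1) _ A(2) l]) (use n in auto)
    moreover have "xs \<noteq> []" using l by auto
    ultimately show ?thesis by (simp add: \<Theta>_unfold)
  qed
  then show ?thesis by blast
qed

definition area_class :: "'g list \<Rightarrow> complex" where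
  "area_class = \<Theta> area_cochain"

lemma area_class_length: "area_class xs \<noteq> 0 \<Longrightarrow> length xs = 3"
  by (cases xs) (auto simp: area_class_def \<Theta>_def area_cochain_def split: if_splits)

lemma hb_area_class: "length xs = 4 \<Longrightarrow> hb area_class xs = 0"
  unfolding area_class_def
  using hb_\<Theta>_primitive[OF equivariant_area, of 3 "\<lambda>_ _. 0" xs] gd_area by (simp add: \<Theta>_lin)

lemma period_diff_scale: "period (\<lambda>ys. F ys - c * G ys) = period F - c * period G"
  by (simp add: period_def algebra_simps)

lemma equivariant_diff_scale:
  "equivariant A \<Longrightarrow> equivariant A' \<Longrightarrow> equivariant (\<lambda>ys m. A ys m - c * A' ys m)"
  unfolding equivariant_def by (simp add: left_diff_distrib mult.assoc)

lemma hb_exact_degree_2: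
  assumes c: "\<And>xs. length xs = 4 \<Longrightarrow> hb \<phi> xs = 0"
  shows "\<exists>c \<psi>. \<forall>xs. length xs = 3 \<longrightarrow> \<phi> xs - c * area_class xs = hb \<psi> xs"
proof -
  let ?F = "unfold_cochain \<phi>"
  \<comment> \<open>Chosen so that the corrected cochain has period 0 and the degree 2 case of
    \<open>equivariant_cocycle_exact\<close> applies.\<close>
  define k where "k = period (\<lambda>ys. ?F ys one) / period (\<lambda>ys. area_cochain ys one)"
  define F where "F ys m = ?F ys m - k * area_cochain ys m" for ys m
  have F: "equivariant F"
    unfolding F_def[abs_def] by (rule equivariant_diff_scale[OF equivariant_unfold equivariant_area])
  have "gd F ys m = 0" if "length ys = 2 + 2" for ys m
    using unfold_cocycle[of 2 \<phi> ys m] c gd_area[of ys m] that by (simp add: F_def[abs_def] sd_diff sd_scale)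
  moreover have "period (\<lambda>ys. F ys one) = 0"
    unfolding F_def period_diff_scale using period_area by (simp add: k_def)
  ultimately have "\<exists>A. equivariant A \<and> (\<forall>ys m. length ys = Suc 2 \<longrightarrow> gd A ys m = F ys m)"
    by (intro equivariant_cocycle_exact[OF F]) auto
  then obtain A where A: "equivariant A" "\<And>ys m. length ys = Suc 2 \<Longrightarrow> gd A ys m = F ys m" by blast
  have "\<phi> xs - k * area_class xs = hb (\<Theta> A) xs" if l: "length xs = 3" for xs
  proof -
    have "hb (\<Theta> A) xs = \<Theta> F xs"
      by (rule hb_\<Theta>_primitive[OF A(1) _ A(2)]) (use l in auto)
    moreover have "xs \<noteq> []" using l by auto
    ultimately show ?thesis by (simp add: F_def[abs_def] \<Theta>_lin \<Theta>_unfold area_class_def)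
  qed
  then show ?thesis by blast
qed

text \<open>The period separates: it vanishes on coboundaries but not on the area cochain.\<close>

lemma area_class_not_exact:
  assumes "\<And>xs. length xs = 3 \<Longrightarrow> hb \<psi> xs = c * area_class xs"
  shows "c = 0"
proof -
  let ?A = "unfold_cochain \<psi>"
  define F where "F ys m = gd ?A ys m - c * area_cochain ys m" for ys m
  have F: "equivariant F"
    unfolding F_def[abs_def]
    by (rule equivariant_diff_scale[OF equivariant_gd[OF equivariant_unfold] equivariant_area])
  have "F ys m = 0" if l: "length ys = 3" for ys m
  proof (rule \<Theta>_inject[OF F])
    fix xs :: "'g list"
    assume "length xs = length ys"
    then have l: "length xs = 3" using l by simp
    have "hb \<psi> xs = hb (\<Theta> ?A) xs"
    proof (rule hb_cong)
      fix zs :: "'g list"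
      assume "Suc (length zs) = length xs"
      then have "zs \<noteq> []" using l by auto
      then show "\<psi> zs = \<Theta> ?A zs" by (simp add: \<Theta>_unfold)
    qed
    then show "\<Theta> F xs = 0"
      using hb_\<Theta>[OF equivariant_unfold, of xs \<psi>] l assms[OF l]
      by (simp add: F_def[abs_def] \<Theta>_lin area_class_def)
  qed (use l in auto)
  then have "period (\<lambda>ys. c * area_cochain ys one) = 0"
    by (intro period_exact[OF equivariant_unfold[of \<psi>]]) (simp add: F_def)
  then show ?thesis using period_area by (simp add: period_def right_diff_distrib[symmetric])
qed

section \<open>The total complex\<close>

abbreviation \<delta> :: "('g list \<Rightarrow> complex) \<Rightarrow> 'g list \<Rightarrow> complex" where
  "\<delta> \<equiv> bB UNIV gmult one"

abbreviation tt :: "nat \<Rightarrow> ('g list \<Rightarrow> complex) set" where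
  "tt \<equiv> tot UNIV"

lemma \<delta>_eq: "\<delta> \<Phi> = (\<lambda>xs. hb \<Phi> xs + connes_B one \<Phi> xs)"
  by (auto simp: bB_def hoch_b_gmult hb_def connes_B_def fun_eq_iff)

lemma hb_lin:
  "hb (\<lambda>xs. \<phi> xs - \<psi> xs) xs = hb \<phi> xs - hb \<psi> xs"
  "hb (\<lambda>xs. \<phi> xs + \<psi> xs) xs = hb \<phi> xs + hb \<psi> xs"
  "hb (\<lambda>xs. c * \<phi> xs) xs = c * hb \<phi> xs"
  by (simp_all add: hb_def face_lin sum_subtractf sum.distrib sum_distrib_left)

lemma hb_zero [simp]: "hb (\<lambda>_. 0) xs = 0"
  using hb_lin(3)[of 0 "\<lambda>_. 0"] by simp

lemma connes_B_lin:
  "connes_B one (\<lambda>xs. \<phi> xs - \<psi> xs) xs = connes_B one \<phi> xs - connes_B one \<psi> xs"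
  "connes_B one (\<lambda>xs. \<phi> xs + \<psi> xs) xs = connes_B one \<phi> xs + connes_B one \<psi> xs"
  "connes_B one (\<lambda>xs. c * \<phi> xs) xs = c * connes_B one \<phi> xs"
  by (simp_all add: connes_B_def connes_B0_def algebra_simps sum_subtractf sum.distrib sum_distrib_left)

lemma connes_B_zero [simp]: "connes_B one (\<lambda>_. 0) xs = 0"
  by (simp add: connes_B_def connes_B0_def)

lemma connes_B_cong:
  assumes "\<And>ys. length ys = Suc (length xs) \<Longrightarrow> \<phi> ys = \<psi> ys"
  shows "connes_B one \<phi> xs = connes_B one \<psi> xs"
  using assms by (simp add: connes_B_def connes_B0_def)

lemma \<delta>_lin:
  "\<delta> (\<lambda>xs. \<phi> xs - \<psi> xs) xs = \<delta> \<phi> xs - \<delta> \<psi> xs"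
  "\<delta> (\<lambda>xs. \<phi> xs + \<psi> xs) xs = \<delta> \<phi> xs + \<delta> \<psi> xs"
  "\<delta> (\<lambda>xs. c * \<phi> xs) xs = c * \<delta> \<phi> xs"
  by (simp_all add: \<delta>_eq hb_lin connes_B_lin algebra_simps)

lemma \<delta>_zero [simp]: "\<delta> (\<lambda>_. 0) xs = 0"
  by (simp add: \<delta>_eq)

lemma \<delta>_\<delta>: "\<delta> (\<delta> \<Phi>) xs = 0"
  using hb_connes_B[of \<Phi> xs]
  by (simp add: \<delta>_eq hb_lin connes_B_lin hb_hb connes_B_connes_B)

lemma hb_eq_0: "(\<And>ys. Suc (length ys) = length xs \<Longrightarrow> \<phi> ys = 0) \<Longrightarrow> hb \<phi> xs = 0"
  using hb_cong[of xs \<phi> "\<lambda>_. 0"] by simp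

lemma connes_B_eq_0: "(\<And>ys. length ys = Suc (length xs) \<Longrightarrow> \<phi> ys = 0) \<Longrightarrow> connes_B one \<phi> xs = 0"
  using connes_B_cong[of xs \<phi> "\<lambda>_. 0"] by simp

lemma ttI:
  "(\<And>xs. \<Phi> xs \<noteq> 0 \<Longrightarrow> xs \<noteq> [] \<and> length xs \<le> m \<and> even (m - length xs)) \<Longrightarrow> \<Phi> \<in> tt m"
  by (simp add: tot_def)

lemma ttD: "\<Phi> \<in> tt m \<Longrightarrow> xs = [] \<or> m < length xs \<or> odd (m - length xs) \<Longrightarrow> \<Phi> xs = 0"
  by (auto simp: tot_def)

lemma tt_lin:
  assumes "\<Phi> \<in> tt m" "\<Psi> \<in> tt m"
  shows "(\<lambda>xs. \<Phi> xs - \<Psi> xs) \<in> tt m" "(\<lambda>xs. \<Phi> xs + \<Psi> xs) \<in> tt m" "(\<lambda>xs. c * \<Phi> xs) \<in> tt m"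
  using assms unfolding tot_def mem_Collect_eq
  by (metis diff_self, metis add_0, metis mult_zero_right)

lemma zero_tt [simp]: "(\<lambda>_. 0) \<in> tt m"
  by (simp add: tot_def)

lemma tt_mono: "\<Phi> \<in> tt m \<Longrightarrow> \<Phi> \<in> tt (m + 2 * k)"
  by (fastforce simp: tot_def)

lemma tt_mono': "\<Phi> \<in> tt m \<Longrightarrow> m \<le> m' \<Longrightarrow> even (m' - m) \<Longrightarrow> \<Phi> \<in> tt m'"
  using tt_mono[of \<Phi> m "(m' - m) div 2"] by simp

lemma \<delta>_tt:
  assumes "\<Phi> \<in> tt m"
  shows "\<delta> \<Phi> \<in> tt (Suc m)"
proof (rule ttI)
  fix xs assume nz: "\<delta> \<Phi> xs \<noteq> 0"
  then have xs: "xs \<noteq> []" by (auto simp: bB_def)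
  from nz have "hb \<Phi> xs \<noteq> 0 \<or> connes_B one \<Phi> xs \<noteq> 0" by (auto simp: \<delta>_eq)
  then obtain ys where ys: "\<Phi> ys \<noteq> 0" "Suc (length ys) = length xs \<or> length ys = Suc (length xs)"
    using hb_eq_0[of xs \<Phi>] connes_B_eq_0[of xs \<Phi>] by blast
  have "length ys \<le> m" "even (m - length ys)" using assms ys(1) by (auto simp: tot_def)
  moreover have "Suc m - length xs = m - length ys \<or> Suc m - length xs = Suc (Suc (m - length ys))"
    using ys(2) \<open>length ys \<le> m\<close> by arith
  ultimately have "even (Suc m - length xs)" by (auto simp del: even_diff_nat)
  moreover have "length xs \<le> Suc m" using ys(2) \<open>length ys \<le> m\<close> by arith
  ultimately show "xs \<noteq> [] \<and> length xs \<le> Suc m \<and> even (Suc m - length xs)" using xs by blast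
qed

lemma tt_lower:
  assumes "\<Phi> \<in> tt (Suc (Suc k))" "\<And>xs. length xs = Suc (Suc k) \<Longrightarrow> \<Phi> xs = 0"
  shows "\<Phi> \<in> tt k"
proof (rule ttI)
  fix xs assume nz: "\<Phi> xs \<noteq> 0"
  then have "xs \<noteq> []" "length xs \<le> Suc (Suc k)" "even (Suc (Suc k) - length xs)"
    using assms(1) by (auto simp: tot_def)
  moreover have "length xs \<noteq> Suc (Suc k)" using nz assms(2) by blast
  moreover have "length xs \<noteq> Suc k" using calculation(3) by auto
  ultimately show "xs \<noteq> [] \<and> length xs \<le> k \<and> even (k - length xs)"
    by (auto simp: Suc_diff_le)
qed

definition cut :: "nat \<Rightarrow> ('g list \<Rightarrow> complex) \<Rightarrow> 'g list \<Rightarrow> complex" where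
  "cut n \<phi> xs = (if length xs = n then \<phi> xs else 0)"

lemma cut_tt: "0 < n \<Longrightarrow> cut n \<phi> \<in> tt n"
  by (auto simp: tot_def cut_def)

lemma \<delta>_cut: "length xs = Suc n \<Longrightarrow> \<delta> (cut n \<phi>) xs = hb \<phi> xs"
  using hb_cong[of xs "cut n \<phi>" \<phi>] connes_B_eq_0[of xs "cut n \<phi>"] by (simp add: \<delta>_eq cut_def)

lemma \<delta>_top:
  assumes "\<Phi> \<in> tt m" "length xs = Suc m"
  shows "\<delta> \<Phi> xs = hb \<Phi> xs"
  using assms connes_B_eq_0[of xs \<Phi>] ttD[of \<Phi> m] by (simp add: \<delta>_eq)

text \<open>Indices of \<open>tt\<close> count letters, so \<open>tt (Suc k)\<close> has top
  Hochschild degree k. One length higher the total coboundary sees only \<open>hb\<close> of the top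
  component, which is therefore exact. Subtracting the total coboundary of a primitive removes it,
  and by parity the top drops by two.\<close>

lemma lower_degree:
  assumes k: "k = 1 \<or> 3 \<le> k" and \<Phi>: "\<Phi> \<in> tt (Suc k)" and c: "\<And>xs. length xs = k + 2 \<Longrightarrow> \<delta> \<Phi> xs = 0"
  shows "\<exists>\<Psi> \<in> tt k. (\<lambda>xs. \<Phi> xs - \<delta> \<Psi> xs) \<in> tt (k - 1)"
proof -
  have "hb \<Phi> xs = 0" if "length xs = k + 2" for xs
    using \<delta>_top[OF \<Phi>, of xs] c that by simp
  then obtain \<psi> where \<psi>: "\<And>xs. length xs = Suc k \<Longrightarrow> hb \<psi> xs = \<Phi> xs"
    using hb_exact[OF k, of \<Phi>] by blast
  obtain j where j: "k = Suc j" using k by (cases k) auto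
  have P: "cut k \<psi> \<in> tt k" using k by (intro cut_tt) auto
  have "(\<lambda>xs. \<Phi> xs - \<delta> (cut k \<psi>) xs) \<in> tt j"
  proof (rule tt_lower)
    show "(\<lambda>xs. \<Phi> xs - \<delta> (cut k \<psi>) xs) \<in> tt (Suc (Suc j))"
      using tt_lin(1)[OF \<Phi> \<delta>_tt[OF P]] j by simp
    show "\<Phi> xs - \<delta> (cut k \<psi>) xs = 0" if "length xs = Suc (Suc j)" for xs
      using that \<psi> j by (simp add: \<delta>_cut)
  qed
  then show ?thesis using P j by auto
qed

text \<open>All odd Hochschild degrees are exact, so peeling off the top component ends at
  zero.\<close>

lemma odd_exact:
  "\<Phi> \<in> tt (2 * n) \<Longrightarrow> (\<And>xs. \<delta> \<Phi> xs = 0) \<Longrightarrow> \<exists>m. \<exists>\<Psi> \<in> tt (2 * m + 1). \<delta> \<Psi> = \<Phi>"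
proof (induction n arbitrary: \<Phi>)
  case 0
  then have "\<Phi> = (\<lambda>_. 0)" by (auto simp: tot_def)
  then show ?case by (intro exI[of _ 0] bexI[of _ "\<lambda>_. 0"]) (auto simp: fun_eq_iff)
next
  case (Suc n)
  have "2 * n + 1 = 1 \<or> 3 \<le> 2 * n + 1" by arith
  from lower_degree[OF this, of \<Phi>] Suc.prems
  obtain \<Psi>1 where 1: "\<Psi>1 \<in> tt (2 * n + 1)" "(\<lambda>xs. \<Phi> xs - \<delta> \<Psi>1 xs) \<in> tt (2 * n)"
    by auto
  have "\<delta> (\<lambda>xs. \<Phi> xs - \<delta> \<Psi>1 xs) xs = 0" for xs using Suc.prems(2) by (simp add: \<delta>_lin \<delta>_\<delta>)
  from Suc.IH[OF 1(2) this] obtain m \<Psi>2 where 2: "\<Psi>2 \<in> tt (2 * m + 1)" "\<delta> \<Psi>2 = (\<lambda>xs. \<Phi> xs - \<delta> \<Psi>1 xs)"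
    by blast
  let ?M = "max m n"
  have "\<Psi>1 \<in> tt (2 * ?M + 1)" "\<Psi>2 \<in> tt (2 * ?M + 1)"
    using tt_mono'[OF 1(1), of "2 * ?M + 1"] tt_mono'[OF 2(1), of "2 * ?M + 1"] by simp_all
  then have "(\<lambda>xs. \<Psi>1 xs + \<Psi>2 xs) \<in> tt (2 * ?M + 1)" by (rule tt_lin(2))
  moreover have "\<delta> (\<lambda>xs. \<Psi>1 xs + \<Psi>2 xs) = \<Phi>" using 2(2) by (simp add: \<delta>_lin fun_eq_iff)
  ultimately show ?case by blast
qed

text \<open>Peeling has to stop at degree 2, that is at \<open>tt 3\<close>, where the area class
  obstructs.\<close>

lemma even_reduce:
  "\<Phi> \<in> tt (2 * n + 1) \<Longrightarrow> (\<And>xs. \<delta> \<Phi> xs = 0) \<Longrightarrow>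
    \<exists>m. \<exists>\<Psi> \<in> tt (2 * m). (\<lambda>xs. \<Phi> xs - \<delta> \<Psi> xs) \<in> tt 3"
proof (induction n arbitrary: \<Phi>)
  case 0
  then have "\<Phi> \<in> tt 3" using tt_mono[of \<Phi> 1 1] by (simp add: numeral_3_eq_3)
  then show ?case by (intro exI[of _ 0] bexI[of _ "\<lambda>_. 0"]) auto
next
  case (Suc n)
  show ?case
  proof (cases "n = 0")
    case True
    then show ?thesis using Suc.prems
      by (intro exI[of _ 0] bexI[of _ "\<lambda>_. 0"]) (auto simp: numeral_3_eq_3)
  next
    case False
    obtain \<Psi>1 where 1: "\<Psi>1 \<in> tt (2 * n + 2)" "(\<lambda>xs. \<Phi> xs - \<delta> \<Psi>1 xs) \<in> tt (2 * n + 1)"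
      using lower_degree[of "2 * n + 2" \<Phi>] Suc.prems False by auto
    have "\<delta> (\<lambda>xs. \<Phi> xs - \<delta> \<Psi>1 xs) xs = 0" for xs using Suc.prems(2) by (simp add: \<delta>_lin \<delta>_\<delta>)
    from Suc.IH[OF 1(2) this] obtain m \<Psi>2 where
      2: "\<Psi>2 \<in> tt (2 * m)" "(\<lambda>xs. \<Phi> xs - \<delta> \<Psi>1 xs - \<delta> \<Psi>2 xs) \<in> tt 3"
      by blast
    let ?M = "max m (Suc n)"
    have "\<Psi>1 \<in> tt (2 * ?M)" "\<Psi>2 \<in> tt (2 * ?M)"
      using tt_mono'[OF 1(1), of "2 * ?M"] tt_mono'[OF 2(1), of "2 * ?M"]
        max.cobounded2[of "Suc n" m] by simp_all
    then have "(\<lambda>xs. \<Psi>1 xs + \<Psi>2 xs) \<in> tt (2 * ?M)" by (rule tt_lin(2))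
    moreover have "(\<lambda>xs. \<Phi> xs - \<delta> (\<lambda>xs. \<Psi>1 xs + \<Psi>2 xs) xs) \<in> tt 3"
      using 2(2) by (simp add: \<delta>_lin algebra_simps)
    ultimately show ?thesis by blast
  qed
qed

text \<open>While the coboundary stays in \<open>tt 3\<close>, the top component of \<Psi> is a
  Hochschild cocycle of odd degree at least 3. It is removed by a total coboundary, which leaves
  \<open>\<delta> \<Psi>\<close> unchanged. Passing to the limit under S thus creates no further
  relations in low degree.\<close>

lemma coboundary_reduce:
  "\<Psi> \<in> tt (2 * n) \<Longrightarrow> \<delta> \<Psi> \<in> tt 3 \<Longrightarrow> \<exists>\<Psi>' \<in> tt 2. \<delta> \<Psi>' = \<delta> \<Psi>"
proof (induction n arbitrary: \<Psi>)
  case 0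
  then show ?case using tt_mono[of \<Psi> 0 1] by (auto simp: numeral_2_eq_2)
next
  case (Suc n)
  show ?case
  proof (cases "n = 0")
    case True
    then show ?thesis using Suc.prems by auto
  next
    case False
    have "\<delta> \<Psi> xs = 0" if "length xs = 2 * n + 1 + 2" for xs
      using ttD[OF Suc.prems(2), of xs] that False by simp
    then obtain X where X: "X \<in> tt (2 * n + 1)" "(\<lambda>xs. \<Psi> xs - \<delta> X xs) \<in> tt (2 * n)"
      using lower_degree[of "2 * n + 1" \<Psi>] Suc.prems False by auto
    have "\<delta> (\<lambda>xs. \<Psi> xs - \<delta> X xs) = \<delta> \<Psi>" by (simp add: \<delta>_lin \<delta>_\<delta> fun_eq_iff)
    then show ?thesis using Suc.IH[OF X(2)] Suc.prems(2) by simp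
  qed
qed

text \<open>The degree two class extends to a cocycle of the total complex because the first Hochschild
  cohomology vanishes.\<close>

lemma area_class_extends:
  obtains S where "S \<in> tt 3" "\<And>xs. length xs = 3 \<Longrightarrow> S xs = area_class xs" "\<And>xs. \<delta> S xs = 0"
proof -
  \<comment> \<open>From b B = - B b. The degree 0 primitive \<open>s\<close> of this 1-cocycle is
    then subtracted, so that b of the correction cancels B of the area class.\<close>
  have "hb (connes_B one area_class) xs = 0" if l: "length xs = 3" for xs
    using hb_connes_B[of area_class xs] connes_B_eq_0[of xs "hb area_class"] hb_area_class l by simp
  then obtain s where s: "\<And>xs. length xs = 2 \<Longrightarrow> hb s xs = connes_B one area_class xs"
    using hb_exact[of 1 "connes_B one area_class"] by (auto simp: numeral_2_eq_2 numeral_3_eq_3)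
  define S where "S xs = area_class xs - cut 1 s xs" for xs
  have a: "area_class \<in> tt 3" by (rule ttI, drule area_class_length) auto
  have S: "S \<in> tt 3"
    unfolding S_def[abs_def] using tt_lin(1)[OF a, of "cut 1 s"] tt_mono[OF cut_tt, of 1 s 1] by (simp add: numeral_3_eq_3)
  have z: "S xs = 0" if "length xs \<noteq> 1" "length xs \<noteq> 3" for xs
    using area_class_length that by (auto simp: S_def cut_def)
  have "\<delta> S xs = 0" for xs
  proof -
    consider "length xs = 2" | "length xs = 4" | "length xs < 2" | "length xs = 3" | "4 < length xs"
      by linarith
    then show ?thesis
    proof cases
      case 1
      have "hb S xs = - hb s xs"
        using hb_cong[of xs S "\<lambda>xs. (-1) * s xs"] 1 area_class_length hb_lin(3)[of "-1" s xs]
        by (force simp: S_def cut_def)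
      moreover have "connes_B one S xs = connes_B one area_class xs"
        by (rule connes_B_cong) (use 1 in \<open>simp add: S_def cut_def\<close>)
      ultimately show ?thesis using s[OF 1] by (simp add: \<delta>_eq)
    next
      case 2
      have "hb S xs = hb area_class xs"
        by (rule hb_cong) (use 2 in \<open>simp add: S_def cut_def\<close>)
      moreover have "connes_B one S xs = 0" using connes_B_eq_0[of xs S] z 2 by simp
      ultimately show ?thesis using hb_area_class[OF 2] by (simp add: \<delta>_eq)
    next
      case 3
      have "connes_B one S xs = 0"
      proof (cases "xs = []")
        case False
        then have "length xs = 1" using 3 by (cases xs) auto
        then show ?thesis by (intro connes_B_eq_0 z) auto
      qed (simp add: connes_B_def)
      then show ?thesis using 3 by (simp add: \<delta>_eq hb_def)
    next
      case 4
      then show ?thesis using hb_eq_0[of xs S] connes_B_eq_0[of xs S] z by (simp add: \<delta>_eq)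
    next
      case 5
      have "hb S xs = 0" by (intro hb_eq_0 z) (use 5 in linarith)+
      moreover have "connes_B one S xs = 0" by (intro connes_B_eq_0 z) (use 5 in linarith)+
      ultimately show ?thesis by (simp add: \<delta>_eq)
    qed
  qed
  moreover have "S xs = area_class xs" if "length xs = 3" for xs using that by (simp add: S_def cut_def)
  ultimately show thesis using S that by blast
qed

lemma HP_odd: "quot_dim (HP_cocycles UNIV gmult one 1) (HP_coboundaries UNIV gmult one 1) 0"
proof -
  have "\<Phi> \<in> HP_coboundaries UNIV gmult one 1" if "\<Phi> \<in> HP_cocycles UNIV gmult one 1" for \<Phi>
  proof -
    obtain n where "\<Phi> \<in> tt (2 * n + 1 + 1)" "\<delta> \<Phi> = (\<lambda>_. 0)"
      using \<open>\<Phi> \<in> HP_cocycles UNIV gmult one 1\<close> unfolding HP_cocycles_def cyc_Z_def by blast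
    then have "\<Phi> \<in> tt (2 * Suc n)" "\<And>xs. \<delta> \<Phi> xs = 0" by simp_all
    then obtain m \<Psi> where "\<Psi> \<in> tt (2 * m + 1)" "\<delta> \<Psi> = \<Phi>" using odd_exact by blast
    then show ?thesis unfolding HP_coboundaries_def cyc_B_def by blast
  qed
  then show ?thesis by (simp add: quot_dim_def)
qed

end

section \<open>Twisted traces and the even periodic cohomology\<close>

text \<open>Applied to z in the centralizer, \<open>\<upsilon>_conj\<close> says that the phase
  character there is trivial, so each of the \<open>d\<close> classes numbered by \<open>cls\<close>
  carries exactly one trace up to scale.\<close>

locale crystal_traces = crystal mul one inv \<alpha> t1 co1 t2 co2 cc R sh area
  for mul :: "'g \<Rightarrow> 'g \<Rightarrow> 'g" (infixl \<open>\<odot>\<close> 70) and one and inv and \<alpha> and t1 and co1 and t2 and co2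
    and cc and R and sh and area +
  fixes \<upsilon> :: "'g \<Rightarrow> complex" and cls :: "'g \<Rightarrow> nat" and rep :: "nat \<Rightarrow> 'g" and d :: nat
  assumes \<upsilon>_nz: "m = one \<or> fin m \<Longrightarrow> \<upsilon> m \<noteq> 0"
    and \<upsilon>_conj: "m = one \<or> fin m \<Longrightarrow> conj_phase z m * \<upsilon> (z \<odot> m \<odot> inv z) = \<upsilon> m"
    and cls_conj: "m = one \<or> fin m \<Longrightarrow> cls (z \<odot> m \<odot> inv z) = cls m"
    and cls_less: "m = one \<or> fin m \<Longrightarrow> cls m < d"
    and rep_fin: "i < d \<Longrightarrow> rep i = one \<or> fin (rep i)"
    and cls_rep: "i < d \<Longrightarrow> cls (rep i) = i"
    and conj_rep: "m = one \<or> fin m \<Longrightarrow> \<exists>z. z \<odot> m \<odot> inv z = rep (cls m)"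
begin

definition class_fun :: "nat \<Rightarrow> 'g \<Rightarrow> complex" where
  "class_fun i m = (if (m = one \<or> fin m) \<and> cls m = i then \<upsilon> m else 0)"

definition tr :: "nat \<Rightarrow> 'g list \<Rightarrow> complex" where
  "tr i xs = (if length xs = 1 then class_fun i (hd xs) else 0)"

lemma tr_tt: "tr i \<in> tt 1"
  by (auto simp: tot_def tr_def)

lemma \<delta>_tr: "\<delta> (tr i) xs = 0"
proof -
  define F where "F ys m = (if length ys = 1 then class_fun i m else 0)" for ys :: "'g list" and m
  have "conj_phase z m * class_fun i (z \<odot> m \<odot> inv z) = class_fun i m" for z m
    using \<upsilon>_conj[of m z] cls_conj[of m z]
    by (cases "m = one \<or> fin m") (auto simp: class_fun_def fin_conj)
  then have F: "equivariant F" by (simp add: equivariant_def F_def mult.commute)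
  have t: "\<Theta> F = tr i"
    by (auto simp: \<Theta>_def F_def tr_def fun_eq_iff split: list.splits)
  have B: "connes_B one (tr i) xs = 0"
  proof (cases "xs = []")
    case False
    then show ?thesis by (intro connes_B_eq_0) (simp add: tr_def)
  qed (simp add: connes_B_def)
  have "hb (tr i) xs = 0"
  proof (cases "length xs = 2")
    case True
    have "gd F ys m = 0" if l: "length ys = 2" for ys m
    proof -
      obtain y w where "ys = [y, w]" using l by (cases ys; cases "tl ys") auto
      then show ?thesis by (simp add: F_def)
    qed
    then have "hb (\<Theta> F) xs = \<Theta> (\<lambda>_ _. 0) xs"
      using hb_\<Theta>_primitive[OF F, of 1 "\<lambda>_ _. 0" xs] True by (simp add: numeral_2_eq_2)
    then show ?thesis by (simp add: t \<Theta>_lin)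
  next
    case False
    then show ?thesis by (intro hb_eq_0) (auto simp: tr_def)
  qed
  then show ?thesis using B by (simp add: \<delta>_eq)
qed

text \<open>A degree 0 cocycle does not depend on its vertex, so equivariance makes it a twisted
  class function: it is determined by its values at the representatives, and zero where
  \<open>cc\<close> has a non-trivial phase.\<close>

lemma trace_expansion:
  assumes c: "\<And>xs. length xs = 2 \<Longrightarrow> hb \<phi> xs = 0"
  shows "\<phi> [x] = (\<Sum>i<d. \<phi> [rep i] / \<upsilon> (rep i) * tr i [x])"
proof -
  let ?F = "unfold_cochain \<phi>"
  define f where "f m = ?F [one] m" for m
  have fphi: "\<phi> [m] = f m" for m
    using \<Theta>_unfold[of "[m]" \<phi>] by (simp add: \<Theta>_def f_def)
  have e: "?F [w] m = ?F [y] m" for y w m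
    using unfold_cocycle[of 0 \<phi> "[y, w]" m] c by simp
  have f: "f (z \<odot> m \<odot> inv z) * conj_phase z m = f m" for z m
    using equivariantD[OF equivariant_unfold, of \<phi> z "[one]" m] e[of z "z \<odot> m \<odot> inv z" one]
    by (simp add: f_def)
  show ?thesis
  proof (cases "x = one \<or> fin x")
    case True
    obtain z where z: "z \<odot> x \<odot> inv z = rep (cls x)" using conj_rep[OF True] by blast
    have "f x = f (rep (cls x)) * conj_phase z x" using f[of z x] z by simp
    moreover have "conj_phase z x * \<upsilon> (rep (cls x)) = \<upsilon> x" using \<upsilon>_conj[OF True, of z] z by simp
    moreover have "\<upsilon> (rep (cls x)) \<noteq> 0" using \<upsilon>_nz rep_fin cls_less[OF True] by blast
    ultimately have "f x = f (rep (cls x)) / \<upsilon> (rep (cls x)) * \<upsilon> x" by (simp add: field_simps)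
    moreover have "(\<Sum>i<d. \<phi> [rep i] / \<upsilon> (rep i) * tr i [x])
        = (\<Sum>i<d. if i = cls x then \<phi> [rep i] / \<upsilon> (rep i) * \<upsilon> x else 0)"
      using True by (intro sum.cong) (auto simp: tr_def class_fun_def)
    ultimately show ?thesis using cls_less[OF True] by (simp add: fphi)
  next
    case False
    then have "cc x \<odot> x = x \<odot> cc x" "conj_phase (cc x) x \<noteq> 1"
      using cc_comm[of x] cc_phase[of x] by (auto simp: fin_def)
    then have "f x = 0" using f[of "cc x" x] by simp
    then show ?thesis using False by (simp add: fphi tr_def class_fun_def)
  qed
qed

lemma tr_rep: "i < d \<Longrightarrow> (\<Sum>j<d. c j * tr j [rep i]) = c i * \<upsilon> (rep i)"
proof -
  assume i: "i < d"
  have "(\<Sum>j<d. c j * tr j [rep i]) = (\<Sum>j<d. if j = i then c j * \<upsilon> (rep i) else 0)"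
    using rep_fin[OF i] cls_rep[OF i] by (intro sum.cong) (auto simp: tr_def class_fun_def)
  then show ?thesis using i by simp
qed

text \<open>The \<open>d\<close> traces and, at index \<open>d\<close>, the total cocycle
  \<open>S\<close> extending the area class form a basis.\<close>

lemma HP_even:
  "quot_dim (HP_cocycles UNIV gmult one 0) (HP_coboundaries UNIV gmult one 0) (Suc d)"
proof -
  obtain S where S: "S \<in> tt 3" "\<And>xs. length xs = 3 \<Longrightarrow> S xs = area_class xs" "\<And>xs. \<delta> S xs = 0"
    using area_class_extends by blast
  define f where "f i = (if i < d then tr i else S)" for i
  have fs: "(\<Sum>i<Suc d. c i * f i xs) = (\<Sum>i<d. c i * tr i xs) + c d * S xs" for c xs
    by (simp add: f_def)
  have Z: "\<Phi> \<in> HP_cocycles UNIV gmult one 0 \<longleftrightarrow> (\<exists>n. \<Phi> \<in> tt (2 * n + 1)) \<and> (\<forall>xs. \<delta> \<Phi> xs = 0)" for \<Phi>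
    by (auto simp: HP_cocycles_def cyc_Z_def fun_eq_iff)
  have Bd: "\<Phi> \<in> HP_coboundaries UNIV gmult one 0 \<longleftrightarrow> (\<exists>n. \<exists>\<Psi> \<in> tt (2 * n). \<delta> \<Psi> = \<Phi>)" for \<Phi>
    by (auto simp: HP_coboundaries_def cyc_B_def)
  have tr_sum: "(\<lambda>xs. \<Sum>i\<in>I. c i * tr i xs) \<in> tt 1" for c I
  proof (rule ttI)
    fix xs assume "(\<Sum>i\<in>I. c i * tr i xs) \<noteq> 0"
    then have "length xs = 1" by (rule contrapos_np) (simp add: tr_def)
    then show "xs \<noteq> [] \<and> length xs \<le> 1 \<and> even (1 - length xs)" by auto
  qed
  have 1: "f i \<in> HP_cocycles UNIV gmult one 0" for i
  proof (cases "i < d")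
    case True
    then have "f i \<in> tt (2 * 0 + 1)" "\<forall>xs. \<delta> (f i) xs = 0" using tr_tt \<delta>_tr by (simp_all add: f_def)
    then show ?thesis unfolding Z by blast
  next
    case False
    then have "f i \<in> tt (2 * 1 + 1)" "\<forall>xs. \<delta> (f i) xs = 0" using S by (simp_all add: f_def numeral_3_eq_3)
    then show ?thesis unfolding Z by blast
  qed
  have 2: "\<exists>c. (\<lambda>xs. \<Phi> xs - (\<Sum>i<Suc d. c i * f i xs)) \<in> HP_coboundaries UNIV gmult one 0"
    if "\<Phi> \<in> HP_cocycles UNIV gmult one 0" for \<Phi>
  proof -
    obtain n where \<Phi>: "\<Phi> \<in> tt (2 * n + 1)" "\<And>xs. \<delta> \<Phi> xs = 0"
      using \<open>\<Phi> \<in> HP_cocycles UNIV gmult one 0\<close> unfolding Z by blast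
    obtain m \<Psi>1 where \<Psi>1: "\<Psi>1 \<in> tt (2 * m)" "(\<lambda>xs. \<Phi> xs - \<delta> \<Psi>1 xs) \<in> tt 3"
      using even_reduce[OF \<Phi>] by blast
    define \<Phi>1 where "\<Phi>1 xs = \<Phi> xs - \<delta> \<Psi>1 xs" for xs
    have \<Phi>1: "\<Phi>1 \<in> tt 3" "\<And>xs. \<delta> \<Phi>1 xs = 0"
      using \<Psi>1(2) \<Phi>(2) by (simp_all add: \<Phi>1_def[abs_def] \<delta>_lin \<delta>_\<delta>)
    have "hb \<Phi>1 xs = 0" if "length xs = 4" for xs
      using \<delta>_top[OF \<Phi>1(1), of xs] \<Phi>1(2) that by simp
    then obtain k \<psi> where \<psi>: "\<And>xs. length xs = 3 \<Longrightarrow> \<Phi>1 xs - k * area_class xs = hb \<psi> xs"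
      using hb_exact_degree_2[of \<Phi>1] by blast
    define \<Psi>2 where "\<Psi>2 = cut 2 \<psi>"
    have \<Psi>2: "\<Psi>2 \<in> tt 2" by (simp add: \<Psi>2_def cut_tt)
    define \<Phi>2 where "\<Phi>2 xs = \<Phi>1 xs - k * S xs - \<delta> \<Psi>2 xs" for xs
    have "\<Phi>2 \<in> tt (Suc (Suc 1))"
      unfolding \<Phi>2_def[abs_def]
      using tt_lin(1)[OF tt_lin(1)[OF \<Phi>1(1) tt_lin(3)[OF S(1) S(1), of k]]] \<delta>_tt[OF \<Psi>2]
      by (simp add: numeral_3_eq_3 numeral_2_eq_2)
    then have \<Phi>2: "\<Phi>2 \<in> tt 1"
    proof (rule tt_lower)
      fix xs :: "'g list" assume "length xs = Suc (Suc 1)"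
      then have l: "length xs = 3" by simp
      show "\<Phi>2 xs = 0"
        using \<psi>[OF l] S(2)[OF l] \<delta>_cut[of xs 2 \<psi>] l by (simp add: \<Phi>2_def \<Psi>2_def)
    qed
    have d2: "\<delta> \<Phi>2 xs = 0" for xs
      using \<Phi>1(2) S(3) by (simp add: \<Phi>2_def[abs_def] \<delta>_lin \<delta>_\<delta>)
    have "hb \<Phi>2 xs = 0" if "length xs = 2" for xs
      using \<delta>_top[OF \<Phi>2, of xs] d2 that by simp
    note ex = trace_expansion[OF this]
    define c where "c i = (if i < d then \<Phi>2 [rep i] / \<upsilon> (rep i) else k)" for i
    have e: "\<Phi>2 xs = (\<Sum>i<d. c i * tr i xs)" for xs
    proof (cases "length xs = 1")
      case True
      then obtain x where "xs = [x]" by (cases xs) auto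
      then show ?thesis using ex[of x] by (simp add: c_def)
    next
      case False
      then have "xs = [] \<or> 1 < length xs" by (cases xs) auto
      then have "\<Phi>2 xs = 0" using ttD[OF \<Phi>2, of xs] by blast
      then show ?thesis using False by (simp add: tr_def)
    qed
    let ?M = "max m 1"
    have "\<Psi>1 \<in> tt (2 * ?M)" "\<Psi>2 \<in> tt (2 * ?M)"
      using tt_mono'[OF \<Psi>1(1), of "2 * ?M"] tt_mono'[OF \<Psi>2, of "2 * ?M"] by simp_all
    then have "(\<lambda>xs. \<Psi>1 xs + \<Psi>2 xs) \<in> tt (2 * ?M)" by (rule tt_lin(2))
    moreover have "\<delta> (\<lambda>xs. \<Psi>1 xs + \<Psi>2 xs) xs = \<Phi> xs - (\<Sum>i<Suc d. c i * f i xs)" for xs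
    proof -
      have "\<delta> (\<lambda>xs. \<Psi>1 xs + \<Psi>2 xs) xs = \<Phi> xs - (\<Phi>2 xs + k * S xs)"
        by (simp add: \<delta>_lin \<Phi>2_def \<Phi>1_def)
      also have "\<Phi>2 xs + k * S xs = (\<Sum>i<Suc d. c i * f i xs)"
        by (simp only: fs e) (simp add: c_def)
      finally show ?thesis .
    qed
    ultimately show ?thesis unfolding Bd by (intro exI[of _ c]) blast
  qed
  have 3: "\<forall>i<Suc d. c i = 0"
    if cb: "(\<lambda>xs. \<Sum>i<Suc d. c i * f i xs) \<in> HP_coboundaries UNIV gmult one 0" for c
  proof -
    obtain n \<Psi>0 where \<Psi>0: "\<Psi>0 \<in> tt (2 * n)" "\<delta> \<Psi>0 = (\<lambda>xs. \<Sum>i<Suc d. c i * f i xs)"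
      using cb unfolding Bd by blast
    have "(\<lambda>xs. \<Sum>i<d. c i * tr i xs) \<in> tt 3"
      using tt_mono[OF tr_sum, of c "{..<d}" 1] by (simp add: numeral_3_eq_3)
    from tt_lin(2)[OF this tt_lin(3)[OF S(1) S(1), of "c d"]]
    have "\<delta> \<Psi>0 \<in> tt 3" by (simp only: \<Psi>0(2) fs)
    then obtain \<Psi> where \<Psi>: "\<Psi> \<in> tt 2" "\<delta> \<Psi> = \<delta> \<Psi>0" using coboundary_reduce[OF \<Psi>0(1)] by blast
    have d: "\<delta> \<Psi> xs = (\<Sum>i<d. c i * tr i xs) + c d * S xs" for xs
      using \<Psi>(2) \<Psi>0(2) fs by (simp add: fun_eq_iff)
    \<comment> \<open>\<Psi> lives in degree 1 and the traces in degree 0, so length 3 isolates the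
      coefficient of \<open>S\<close>.\<close>
    have "hb \<Psi> xs = c d * area_class xs" if l: "length xs = 3" for xs
      using \<delta>_top[OF \<Psi>(1), of xs] d[of xs] S(2)[OF l] l by (simp add: tr_def)
    then have cd: "c d = 0" by (rule area_class_not_exact)
    have "hb \<Psi> xs = 0" if l: "length xs = 3" for xs
      using \<delta>_top[OF \<Psi>(1), of xs] d[of xs] cd l by (simp add: tr_def)
    \<comment> \<open>Now \<Psi> is a Hochschild 1-cocycle, hence a total coboundary up to
      \<open>tt 0\<close>, which contains only zero; so \<open>\<delta> \<Psi>\<close> vanishes and
      the traces can be tested at the representatives.\<close>
    then have "\<exists>X\<in>tt 1. (\<lambda>xs. \<Psi> xs - \<delta> X xs) \<in> tt 0"
      using lower_degree[of 1 \<Psi>] \<Psi>(1) \<delta>_top[OF \<Psi>(1)] by (simp add: numeral_2_eq_2 numeral_3_eq_3)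
    then obtain X where X: "(\<lambda>xs. \<Psi> xs - \<delta> X xs) \<in> tt 0" by blast
    have "\<Psi> = \<delta> X"
    proof
      fix xs :: "'g list"
      have "xs = [] \<or> 0 < length xs \<or> odd (0 - length xs)" by auto
      from ttD[OF X this] show "\<Psi> xs = \<delta> X xs" by simp
    qed
    then have z: "\<delta> \<Psi> xs = 0" for xs by (simp add: \<delta>_\<delta>)
    have "c i = 0" if i: "i < d" for i
    proof -
      have "(\<Sum>j<d. c j * tr j [rep i]) = 0" using d[of "[rep i]"] z cd by simp
      then show ?thesis using tr_rep[OF i, of c] \<upsilon>_nz[OF rep_fin[OF i]] by simp
    qed
    then show ?thesis using cd by (auto simp: less_Suc_eq)
  qed
  show ?thesis
    unfolding quot_dim_def by (rule exI[of _ f]) (use 1 2 3 in blast)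
qed

end

section \<open>Transport along a bijection of bases\<close>

locale basis_transport =
  fixes \<iota> :: "'g \<Rightarrow> 'b" and Bs :: "'b set"
    and mult :: "'b \<Rightarrow> 'b \<Rightarrow> 'b \<Rightarrow> complex" and gm :: "'g \<Rightarrow> 'g \<Rightarrow> 'g \<Rightarrow> complex" and u :: 'g
  assumes inj: "inj \<iota>" and range: "range \<iota> = Bs"
    and mult_\<iota>: "mult (\<iota> x) (\<iota> y) (\<iota> z) = gm x y z"
    and mult_outside: "b \<notin> Bs \<Longrightarrow> mult (\<iota> x) (\<iota> y) b = 0"
begin

definition pull :: "('b list \<Rightarrow> complex) \<Rightarrow> 'g list \<Rightarrow> complex" where
  "pull \<Phi> xs = \<Phi> (map \<iota> xs)"

definition push :: "('g list \<Rightarrow> complex) \<Rightarrow> 'b list \<Rightarrow> complex" where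
  "push \<phi> xs = (if set xs \<subseteq> Bs then \<phi> (map (inv \<iota>) xs) else 0)"

lemma inv_\<iota> [simp]: "inv \<iota> (\<iota> x) = x"
  using inj by (rule inv_f_f)

lemma map_inv_\<iota> [simp]: "map (inv \<iota>) (map \<iota> xs) = xs"
  by (induction xs) simp_all

lemma set_map_\<iota> [simp]: "\<iota> ` A \<subseteq> Bs"
  using range by blast

lemma list_in_Bs: "set xs \<subseteq> Bs \<Longrightarrow> \<exists>ys. xs = map \<iota> ys"
  using range by (induction xs) (auto, metis imageE list.simps(9))

lemma pull_push [simp]: "pull (push \<phi>) = \<phi>"
  by (simp add: pull_def push_def fun_eq_iff del: map_map)

lemma push_pull:
  assumes "\<And>xs. \<Phi> xs \<noteq> 0 \<Longrightarrow> set xs \<subseteq> Bs"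
  shows "push (pull \<Phi>) = \<Phi>"
proof
  fix xs
  show "push (pull \<Phi>) xs = \<Phi> xs"
  proof (cases "set xs \<subseteq> Bs")
    case True
    then obtain ys where "xs = map \<iota> ys" using list_in_Bs by blast
    then show ?thesis by (simp add: push_def pull_def del: map_map)
  next
    case False
    then show ?thesis using assms[of xs] by (auto simp: push_def)
  qed
qed

lemma ext_at_\<iota>:
  "ext_at \<Phi> (map \<iota> pre) (mult (\<iota> x) (\<iota> y)) (map \<iota> post) = ext_at (pull \<Phi>) pre (gm x y) post"
proof -
  have "{z. mult (\<iota> x) (\<iota> y) z \<noteq> 0} = \<iota> ` {z. gm x y z \<noteq> 0}"
  proof
    show "{z. mult (\<iota> x) (\<iota> y) z \<noteq> 0} \<subseteq> \<iota> ` {z. gm x y z \<noteq> 0}"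
    proof
      fix b assume b: "b \<in> {z. mult (\<iota> x) (\<iota> y) z \<noteq> 0}"
      then have "b \<in> Bs" using mult_outside by blast
      then obtain z where z: "b = \<iota> z" using range by blast
      then show "b \<in> \<iota> ` {z. gm x y z \<noteq> 0}" using b by (auto simp: mult_\<iota>)
    qed
  qed (auto simp: mult_\<iota>)
  moreover have "inj_on \<iota> A" for A using inj by (rule inj_on_subset) simp
  ultimately show ?thesis
    by (simp add: ext_at_def sum.reindex mult_\<iota> pull_def)
qed

lemma bB_\<iota>: "bB Bs mult (\<iota> u) \<Phi> (map \<iota> xs) = bB UNIV gm u (pull \<Phi>) xs"
proof (cases "xs = []")
  case False
  have "hoch_b mult \<Phi> (map \<iota> xs) = hoch_b gm (pull \<Phi>) xs"
  proof (cases "length xs < 2")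
    case False
    have "ext_at \<Phi> (take i (map \<iota> xs)) (mult (map \<iota> xs ! i) (map \<iota> xs ! (i + 1))) (drop (i + 2) (map \<iota> xs))
        = ext_at (pull \<Phi>) (take i xs) (gm (xs ! i) (xs ! (i + 1))) (drop (i + 2) xs)"
      if "i < length xs - 1" for i
      using that ext_at_\<iota>[of \<Phi> "take i xs"] by (simp add: take_map drop_map)
    moreover have "ext_at \<Phi> [] (mult (last (map \<iota> xs)) (hd (map \<iota> xs))) (tl (butlast (map \<iota> xs)))
        = ext_at (pull \<Phi>) [] (gm (last xs) (hd xs)) (tl (butlast xs))"
      using ext_at_\<iota>[of \<Phi> "[]"] \<open>xs \<noteq> []\<close> by (simp add: last_map hd_map map_butlast[symmetric] map_tl[symmetric])
    ultimately show ?thesis using False by (simp add: hoch_b_def)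
  qed (simp add: hoch_b_def)
  moreover have "connes_B (\<iota> u) \<Phi> (map \<iota> xs) = connes_B u (pull \<Phi>) xs"
    by (simp add: connes_B_def connes_B0_def pull_def take_map drop_map)
  ultimately show ?thesis using False by (simp add: bB_def)
qed (simp add: bB_def)

lemma pull_bB: "pull (bB Bs mult (\<iota> u) \<Phi>) = bB UNIV gm u (pull \<Phi>)"
  by (simp add: pull_def[of "bB _ _ _ _"] bB_\<iota> fun_eq_iff)

lemma bB_push: "bB Bs mult (\<iota> u) (push \<phi>) = push (bB UNIV gm u \<phi>)"
proof -
  have "push (pull (bB Bs mult (\<iota> u) (push \<phi>))) = bB Bs mult (\<iota> u) (push \<phi>)"
    by (rule push_pull) (auto simp: bB_def split: if_splits)
  then show ?thesis by (simp add: pull_bB)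
qed

lemma pull_tot: "\<Phi> \<in> tot Bs m \<Longrightarrow> pull \<Phi> \<in> tot UNIV m"
  unfolding tot_def pull_def by force

lemma push_tot: "\<phi> \<in> tot UNIV m \<Longrightarrow> push \<phi> \<in> tot Bs m"
  unfolding tot_def push_def by (auto split: if_splits)

lemma push_zero: "push (\<lambda>_. 0) = (\<lambda>_. 0)"
  by (simp add: push_def fun_eq_iff)

lemma pull_zero: "pull (\<lambda>_. 0) = (\<lambda>_. 0)"
  by (simp add: pull_def fun_eq_iff)

lemma quot_dim_transport:
  assumes "quot_dim (HP_cocycles UNIV gm u p) (HP_coboundaries UNIV gm u p) d"
  shows "quot_dim (HP_cocycles Bs mult (\<iota> u) p) (HP_coboundaries Bs mult (\<iota> u) p) d"
proof -
  from assms[unfolded quot_dim_def] obtain f where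
    "(\<forall>i<d. f i \<in> HP_cocycles UNIV gm u p) \<and>
     (\<forall>\<Phi>\<in>HP_cocycles UNIV gm u p.
       \<exists>c. (\<lambda>x. \<Phi> x - (\<Sum>i<d. c i * f i x)) \<in> HP_coboundaries UNIV gm u p) \<and>
     (\<forall>c. (\<lambda>x. \<Sum>i<d. c i * f i x) \<in> HP_coboundaries UNIV gm u p \<longrightarrow> (\<forall>i<d. c i = 0))"
    by (rule exE)
  then have f: "\<And>i. i < d \<Longrightarrow> f i \<in> HP_cocycles UNIV gm u p"
    "\<And>\<Phi>. \<Phi> \<in> HP_cocycles UNIV gm u p \<Longrightarrow>
       \<exists>c. (\<lambda>x. \<Phi> x - (\<Sum>i<d. c i * f i x)) \<in> HP_coboundaries UNIV gm u p"
    "\<And>c. (\<lambda>x. \<Sum>i<d. c i * f i x) \<in> HP_coboundaries UNIV gm u p \<Longrightarrow> \<forall>i<d. c i = 0"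
    by simp_all
  have Z1: "push \<phi> \<in> HP_cocycles Bs mult (\<iota> u) p" if "\<phi> \<in> HP_cocycles UNIV gm u p" for \<phi>
    using that push_tot unfolding HP_cocycles_def cyc_Z_def by (auto simp: bB_push push_zero)
  have Z2: "pull \<Phi> \<in> HP_cocycles UNIV gm u p \<and> push (pull \<Phi>) = \<Phi>"
    if "\<Phi> \<in> HP_cocycles Bs mult (\<iota> u) p" for \<Phi>
  proof -
    obtain n where n: "\<Phi> \<in> tot Bs (2 * n + p + 1)" "bB Bs mult (\<iota> u) \<Phi> = (\<lambda>_. 0)"
      using \<open>\<Phi> \<in> HP_cocycles Bs mult (\<iota> u) p\<close> by (auto simp: HP_cocycles_def cyc_Z_def)
    have "bB UNIV gm u (pull \<Phi>) = (\<lambda>_. 0)"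
      using pull_bB[of \<Phi>] by (simp add: n(2) pull_zero)
    moreover have "push (pull \<Phi>) = \<Phi>" by (rule push_pull) (use n(1) in \<open>simp add: tot_def\<close>)
    ultimately show ?thesis using pull_tot[OF n(1)] by (auto simp: HP_cocycles_def cyc_Z_def)
  qed
  have B1: "push \<phi> \<in> HP_coboundaries Bs mult (\<iota> u) p" if "\<phi> \<in> HP_coboundaries UNIV gm u p" for \<phi>
  proof -
    obtain n \<Psi> where "\<Psi> \<in> tot UNIV (2 * n + p)" "\<phi> = bB UNIV gm u \<Psi>"
      using \<open>\<phi> \<in> HP_coboundaries UNIV gm u p\<close> unfolding HP_coboundaries_def cyc_B_def by blast
    then have "push \<Psi> \<in> tot Bs (2 * n + p)" "push \<phi> = bB Bs mult (\<iota> u) (push \<Psi>)"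
      using push_tot by (simp_all add: bB_push)
    then show ?thesis unfolding HP_coboundaries_def cyc_B_def by blast
  qed
  have B2: "pull \<Phi> \<in> HP_coboundaries UNIV gm u p" if "\<Phi> \<in> HP_coboundaries Bs mult (\<iota> u) p" for \<Phi>
  proof -
    obtain n \<Psi> where "\<Psi> \<in> tot Bs (2 * n + p)" "\<Phi> = bB Bs mult (\<iota> u) \<Psi>"
      using \<open>\<Phi> \<in> HP_coboundaries Bs mult (\<iota> u) p\<close> unfolding HP_coboundaries_def cyc_B_def by blast
    then have "pull \<Psi> \<in> tot UNIV (2 * n + p)" "pull \<Phi> = bB UNIV gm u (pull \<Psi>)"
      using pull_tot by (simp_all add: pull_bB)
    then show ?thesis unfolding HP_coboundaries_def cyc_B_def by blast
  qed
  show ?thesis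
    unfolding quot_dim_def
  proof (intro exI[of _ "\<lambda>i. push (f i)"] conjI allI ballI impI)
    show "push (f i) \<in> HP_cocycles Bs mult (\<iota> u) p" if "i < d" for i using Z1 f(1) that by blast
    show "\<exists>c. (\<lambda>x. \<Phi> x - (\<Sum>i<d. c i * push (f i) x)) \<in> HP_coboundaries Bs mult (\<iota> u) p"
      if "\<Phi> \<in> HP_cocycles Bs mult (\<iota> u) p" for \<Phi>
    proof -
      note Z = Z2[OF that]
      obtain c where "(\<lambda>x. pull \<Phi> x - (\<Sum>i<d. c i * f i x)) \<in> HP_coboundaries UNIV gm u p"
        using f(2) Z by blast
      from B1[OF this] have "push (\<lambda>x. pull \<Phi> x - (\<Sum>i<d. c i * f i x)) \<in> HP_coboundaries Bs mult (\<iota> u) p" .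
      also have "push (\<lambda>x. pull \<Phi> x - (\<Sum>i<d. c i * f i x))
          = (\<lambda>x. push (pull \<Phi>) x - (\<Sum>i<d. c i * push (f i) x))"
        by (simp add: push_def fun_eq_iff)
      finally show ?thesis using Z by auto
    qed
    show "c i = 0"
      if "(\<lambda>x. \<Sum>i<d. c i * push (f i) x) \<in> HP_coboundaries Bs mult (\<iota> u) p" "i < d" for c i
    proof -
      have "pull (\<lambda>x. \<Sum>i<d. c i * push (f i) x) = (\<lambda>x. \<Sum>i<d. c i * pull (push (f i)) x)"
        by (rule ext) (simp only: pull_def)
      then show ?thesis using B2[OF that(1)] f(3)[of c] that(2) by simp
    qed
  qed
qed

end

section \<open>Monomials of the noncommutative torus\<close>

text \<open>The symplectic form of the lattice, the exponent in the Weyl commutation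
  relations.\<close>

definition sform :: "int \<times> int \<Rightarrow> int \<times> int \<Rightarrow> int" where
  "sform p q = snd p * fst q - fst p * snd q"

definition quad :: "int \<times> int \<Rightarrow> int" where
  "quad p = fst p * snd p"

text \<open>The unit is half an exponent of lambda, as the Weyl normalization requires: lambda^n is
  \<open>phase \<theta> (2 * n)\<close>.\<close>

definition phase :: "real \<Rightarrow> int \<Rightarrow> complex" where
  "phase \<theta> n = cis (pi * \<theta> * of_int n)"

lemma phase_add: "phase \<theta> (a + b) = phase \<theta> a * phase \<theta> b"
  by (simp add: phase_def cis_mult distrib_left)

lemma phase_0 [simp]: "phase \<theta> 0 = 1"
  by (simp add: phase_def)

lemma phase_nz [simp]: "phase \<theta> a \<noteq> 0"
  by (simp add: phase_def)

lemma phase_diff: "phase \<theta> (a - b) = phase \<theta> a / phase \<theta> b"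
  using phase_add[of \<theta> "a - b" b] by (simp add: field_simps)

lemma lam_pow_phase: "lam_pow \<theta> (of_int n) = phase \<theta> (2 * n)"
  by (simp add: lam_pow_def phase_def algebra_simps)

text \<open>The Weyl normalization, for which the product has an antisymmetric phase.\<close>

definition weyl :: "real \<Rightarrow> int \<times> int \<Rightarrow> torus" where
  "weyl \<theta> p = tscale (phase \<theta> (quad p)) (tmono p)"

lemma tsupp_scaled_tmono: "a \<noteq> 0 \<Longrightarrow> tsupp (tscale a (tmono p)) = {p}"
  by (auto simp: tsupp_def tscale_def tmono_def)

lemma tmult_scaled_tmono:
  assumes "a \<noteq> 0" "b \<noteq> 0"
  shows "tmult \<theta> (tscale a (tmono p)) (tscale b (tmono q))
    = tscale (a * b * phase \<theta> (2 * (snd p * fst q))) (tmono (p + q))"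
  using lam_pow_phase[of \<theta> "snd p * fst q"]
  unfolding tmult_def tsupp_scaled_tmono[OF assms(1)] tsupp_scaled_tmono[OF assms(2)]
  by (auto simp: tscale_def tmono_def fun_eq_iff prod_eq_iff)

lemma tscale_tscale: "tscale a (tscale b f) = tscale (a * b) f"
  by (simp add: tscale_def mult.assoc)

lemma tscale_one [simp]: "tscale 1 f = f"
  by (simp add: tscale_def)

lemma tmult_weyl:
  assumes "a \<noteq> 0" "b \<noteq> 0"
  shows "tmult \<theta> (tscale a (weyl \<theta> p)) (tscale b (weyl \<theta> q))
    = tscale (a * b * phase \<theta> (sform p q)) (weyl \<theta> (p + q))"
proof -
  have "phase \<theta> (quad p) * phase \<theta> (quad q) * phase \<theta> (2 * (snd p * fst q))
      = phase \<theta> (sform p q) * phase \<theta> (quad (p + q))"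
    unfolding phase_add[symmetric] by (simp add: quad_def sform_def algebra_simps)
  then show ?thesis
    by (simp add: weyl_def tscale_tscale tmult_scaled_tmono assms mult_ac)
qed

lemma weyl_0: "weyl \<theta> 0 = tone"
  by (simp add: weyl_def quad_def tone_def zero_prod_def)

lemma tinv_weyl: "tinv \<theta> (weyl \<theta> p) = weyl \<theta> (- p)"
  unfolding tinv_def
proof (rule the_equality)
  have "sform p (- p) = 0" "sform (- p) p = 0" by (simp_all add: sform_def)
  then show "tmult \<theta> (weyl \<theta> p) (weyl \<theta> (- p)) = tone \<and> tmult \<theta> (weyl \<theta> (- p)) (weyl \<theta> p) = tone"
    using tmult_weyl[of 1 1 \<theta> p "- p"] tmult_weyl[of 1 1 \<theta> "- p" p] by (simp add: weyl_0)
next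
  fix y
  assume y: "tmult \<theta> (weyl \<theta> p) y = tone \<and> tmult \<theta> y (weyl \<theta> p) = tone"
  let ?a = "phase \<theta> (quad p)"
  have S: "tsupp (weyl \<theta> p) = {p}" by (simp add: weyl_def tsupp_scaled_tmono)
  have m: "tmult \<theta> (weyl \<theta> p) y r = (\<Sum>v\<in>tsupp y. if v = r - p then
      weyl \<theta> p p * y v * lam_pow \<theta> (real_of_int (snd p * fst v)) else 0)" for r
  proof -
    obtain a b where r: "r = (a, b)" by (cases r)
    have "(fst p + fst v = a \<and> snd p + snd v = b) = (v = (a, b) - p)" for v
      by (auto simp: prod_eq_iff)
    then show ?thesis unfolding tmult_def S r by simp
  qed
  \<comment> \<open>The uniqueness ranges over all functions \<open>y\<close>. A sum over an
    infinite set is 0 by convention, so infinite support would make the product vanish at the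
    origin.\<close>
  have fin: "finite (tsupp y)"
  proof (rule ccontr)
    assume "infinite (tsupp y)"
    then have "tmult \<theta> (weyl \<theta> p) y 0 = 0" by (simp add: m)
    then show False using y by (simp add: tone_def tmono_def zero_prod_def)
  qed
  show "y = weyl \<theta> (- p)"
  proof
    fix v
    have "tmult \<theta> (weyl \<theta> p) y (p + v) = ?a * y v * phase \<theta> (2 * (snd p * fst v))"
      using fin lam_pow_phase[of \<theta> "snd p * fst v"]
      by (auto simp: m tsupp_def) (simp_all add: weyl_def tscale_def tmono_def)
    then have e: "?a * y v * phase \<theta> (2 * (snd p * fst v)) = tone (p + v)" using y by simp
    show "y v = weyl \<theta> (- p) v"
    proof (cases "v = - p")
      case True
      have "?a * phase \<theta> (2 * (snd p * fst v)) * phase \<theta> (quad p) = 1"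
        unfolding phase_add[symmetric] by (simp add: True quad_def)
      moreover have "weyl \<theta> (- p) v = ?a" by (simp add: True weyl_def tscale_def tmono_def quad_def)
      moreover have "?a * y v * phase \<theta> (2 * (snd p * fst v)) = 1"
        using e by (simp add: True tone_def tmono_def zero_prod_def)
      ultimately have "(?a * phase \<theta> (2 * (snd p * fst v))) * y v
          = (?a * phase \<theta> (2 * (snd p * fst v))) * weyl \<theta> (- p) v"
        by (simp add: mult_ac)
      then show ?thesis by simp
    next
      case False
      then have "p + v \<noteq> (0, 0)" by (metis add.commute add_eq_0_iff zero_prod_def)
      then have "y v = 0" using e by (simp add: tone_def tmono_def)
      then show ?thesis using False by (simp add: weyl_def tscale_def tmono_def)
    qed
  qed
qed

definition vscale :: "int \<Rightarrow> int \<times> int \<Rightarrow> int \<times> int" where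
  "vscale n p = (n * fst p, n * snd p)"

lemma tmult_weyl_funpow: "(tmult \<theta> (weyl \<theta> p) ^^ n) tone = weyl \<theta> (vscale (int n) p)"
proof (induction n)
  case 0
  then show ?case by (simp add: vscale_def weyl_0[unfolded zero_prod_def])
next
  case (Suc n)
  have "sform p (vscale (int n) p) = 0" by (simp add: sform_def vscale_def algebra_simps)
  moreover have "p + vscale (int n) p = vscale (int (Suc n)) p"
    by (simp add: vscale_def prod_eq_iff algebra_simps)
  ultimately show ?case using Suc tmult_weyl[of 1 1 \<theta> p "vscale (int n) p"] by simp
qed

lemma tpow_weyl: "tpow \<theta> (weyl \<theta> p) n = weyl \<theta> (vscale n p)"
proof (cases "0 \<le> n")
  case False
  then have "vscale (int (nat (- n))) (- p) = vscale n p" by (simp add: vscale_def)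
  then show ?thesis using False by (simp add: tpow_def tinv_weyl tmult_weyl_funpow)
qed (simp add: tpow_def tmult_weyl_funpow)

section \<open>The action of integer matrices on monomials\<close>

definition mact :: "mat2 \<Rightarrow> int \<times> int \<Rightarrow> int \<times> int" where
  "mact h p = (case h of (a, b, c, e) \<Rightarrow> (a * fst p + b * snd p, c * fst p + e * snd p))"

definition mdet :: "mat2 \<Rightarrow> int" where
  "mdet h = (case h of (a, b, c, e) \<Rightarrow> a * e - b * c)"

definition mtr :: "mat2 \<Rightarrow> int" where
  "mtr h = (case h of (a, b, c, e) \<Rightarrow> a + e)"

text \<open>\<open>act_U1\<close> and \<open>act_U2\<close> are the Weyl monomials of the columns of
  h, and the phase of their powers is governed by the determinant. So h permutes Weyl monomials
  without any phase; \<open>- quad p\<close> only rewrites \<open>tmono p\<close> in Weyl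
  form.\<close>

lemma act_tmono:
  assumes "mdet h = 1"
  shows "act \<theta> h (tmono p) = tscale (phase \<theta> (- quad p)) (weyl \<theta> (mact h p))"
proof -
  obtain a b c e where h: "h = (a, b, c, e)" by (cases h) auto
  have s: "tsupp (tmono p) = {p}" using tsupp_scaled_tmono[of 1 p] by simp
  have 1: "act_U1 \<theta> h = weyl \<theta> (a, c)" "act_U2 \<theta> h = weyl \<theta> (b, e)"
    by (simp_all add: act_U1_def act_U2_def h weyl_def phase_def quad_def mult_ac)
  have "sform (vscale (fst p) (a, c)) (vscale (snd p) (b, e)) = - (quad p * mdet h)"
    by (simp add: sform_def vscale_def quad_def mdet_def h algebra_simps)
  moreover have "vscale (fst p) (a, c) + vscale (snd p) (b, e) = mact h p"
    by (simp add: vscale_def mact_def h algebra_simps)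
  ultimately have "tmult \<theta> (tpow \<theta> (act_U1 \<theta> h) (fst p)) (tpow \<theta> (act_U2 \<theta> h) (snd p))
      = tscale (phase \<theta> (- quad p)) (weyl \<theta> (mact h p))"
    using tmult_weyl[of 1 1 \<theta> "vscale (fst p) (a, c)" "vscale (snd p) (b, e)"] assms
    by (simp add: 1 tpow_weyl)
  then show ?thesis by (simp add: act_def s) (simp add: tmono_def)
qed

lemma cp_mult_eq:
  assumes "mdet (mat2_pow g (snd x)) = 1"
  shows "cp_mult \<theta> g N x y = (let r = fst x + mact (mat2_pow g (snd x)) (fst y) in
    (\<lambda>z. if z = (r, (snd x + snd y) mod N)
      then phase \<theta> (quad r - quad (fst x) - quad (fst y) + sform (fst x) (mact (mat2_pow g (snd x)) (fst y)))
      else 0))"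
proof -
  let ?q = "mact (mat2_pow g (snd x)) (fst y)"
  let ?r = "fst x + ?q"
  have t: "tmono p = tscale (phase \<theta> (- quad p)) (weyl \<theta> p)" for p
    using phase_add[of \<theta> "- quad p" "quad p"] by (simp add: weyl_def tscale_tscale)
  have "tmult \<theta> (tmono (fst x)) (act \<theta> (mat2_pow g (snd x)) (tmono (fst y)))
      = tscale (phase \<theta> (- quad (fst x)) * phase \<theta> (- quad (fst y)) * phase \<theta> (sform (fst x) ?q)) (weyl \<theta> ?r)"
    by (subst t[of "fst x"]) (simp add: act_tmono[OF assms] tmult_weyl)
  also have "\<dots> = tscale (phase \<theta> (quad ?r - quad (fst x) - quad (fst y) + sform (fst x) ?q)) (tmono ?r)"
    unfolding weyl_def tscale_tscale phase_add[symmetric] by (simp add: algebra_simps)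
  finally have eq: "tmult \<theta> (tmono (fst x)) (act \<theta> (mat2_pow g (snd x)) (tmono (fst y))) = \<dots>" .
  show ?thesis
    unfolding cp_mult_def eq Let_def by (auto simp: fun_eq_iff tscale_def tmono_def)
qed

section \<open>Crossed products of the torus by finite rotation groups\<close>

lemma mact_mult: "mact (mat2_mult h k) p = mact h (mact k p)"
  by (cases h; cases k) (simp add: mact_def mat2_mult_def algebra_simps)

lemma mdet_mult: "mdet (mat2_mult h k) = mdet h * mdet k"
  by (cases h; cases k) (simp add: mdet_def mat2_mult_def algebra_simps)

lemma mact_add: "mact h (p + q) = mact h p + mact h q"
  by (simp add: mact_def plus_prod_def algebra_simps split: prod.split)

lemma mact_diff: "mact h (p - q) = mact h p - mact h q"
  by (simp add: mact_def minus_prod_def algebra_simps split: prod.split)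

lemma mact_0 [simp]: "mact h 0 = 0"
  by (cases h) (simp add: mact_def zero_prod_def)

lemma mact_minus: "mact h (- p) = - mact h p"
  by (simp add: mact_def uminus_prod_def split: prod.split)

lemma sform_mact: "sform (mact h p) (mact h q) = mdet h * sform p q"
  by (cases h) (simp add: mact_def sform_def mdet_def algebra_simps)

text \<open>For determinant 1, det (1 - h) = 2 - tr h, so 1 - h is injective.\<close>

lemma mact_fixed:
  assumes "mdet h = 1" "mtr h \<noteq> 2" "mact h p = p"
  shows "p = 0"
proof -
  obtain a b c e where h: "h = (a, b, c, e)" by (cases h) auto
  obtain x y where p: "p = (x, y)" by (cases p)
  have d: "a * e - b * c = 1" and 1: "a * x + b * y = x" and 2: "c * x + e * y = y"
    using assms by (simp_all add: h p mdet_def mact_def)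
  have "(2 - (a + e)) * x = 0" using d 1 2 by algebra
  moreover have "(2 - (a + e)) * y = 0" using d 1 2 by algebra
  ultimately show ?thesis using assms(2) by (simp add: p h mtr_def zero_prod_def)
qed

text \<open>For \<open>m\<close> in the sector of the rotation \<open>h\<close>, this makes \<open>sform r (h r) / (2 - tr h)\<close> the phase
  exponent of a twisted trace: it is \<open>sform v (h v)\<close> at the rational fixed point \<open>v\<close> of \<open>m\<close>.\<close>

lemma sform_fixed_point:
  assumes "mdet h = 1"
  shows "(2 - mtr h) * (sform p s - sform p (mact h p) - sform s (mact h p))
      + sform (p + s - mact h p) (mact h (p + s - mact h p)) = sform s (mact h s)"
proof -
  obtain a b c e where h: "h = (a, b, c, e)" by (cases h) auto
  obtain x y where p: "p = (x, y)" by (cases p)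
  obtain u v where s: "s = (u, v)" by (cases s)
  have "a * e - b * c = 1" using assms by (simp add: h mdet_def)
  then show ?thesis unfolding h p s mtr_def mact_def sform_def by simp algebra
qed

text \<open>\<open>trace_pow\<close> excludes the eigenvalue 1 for the non-trivial powers;
  \<open>definite\<close> makes the translations by p and by \<open>mact g p\<close> fail to commute
  in the torus.\<close>

locale rotation =
  fixes \<theta> :: real and g :: mat2 and N :: nat
  assumes irrational: "\<theta> \<notin> \<rat>" and det_g: "mdet g = 1" and N: "1 < N"
    and order_g: "mat2_pow g N = mat2_id" and trace_g: "mtr g \<in> {-1, 0, 1}"
    and trace_pow: "0 < k \<Longrightarrow> k < N \<Longrightarrow> mtr (mat2_pow g k) \<noteq> 2"
    and definite: "p \<noteq> 0 \<Longrightarrow> sform (mact g p) p \<noteq> 0"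
begin

abbreviation P :: "nat \<Rightarrow> int \<times> int \<Rightarrow> int \<times> int" where
  "P j \<equiv> mact (mat2_pow g j)"

lemma mat2_pow_Suc: "mat2_pow g (Suc j) = mat2_mult g (mat2_pow g j)"
  by (simp add: mat2_pow_def)

lemma P_0 [simp]: "P 0 p = p"
  by (simp add: mat2_pow_def mat2_id_def mact_def)

lemma P_Suc: "P (Suc j) p = mact g (P j p)"
  by (simp add: mat2_pow_Suc mact_mult)

lemma P_1: "P (Suc 0) p = mact g p"
  by (simp add: P_Suc)

lemma P_add: "P (i + j) p = P i (P j p)"
  by (induction i) (simp_all add: P_Suc)

lemma P_commute: "P i (P j p) = P j (P i p)"
  by (metis P_add add.commute)

lemma P_N [simp]: "P N p = p"
  by (simp add: order_g mat2_id_def mact_def)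

lemma P_mod [simp]: "P (j mod N) p = P j p"
proof -
  have "P (N * q) p = p" for q
    by (induction q) (simp_all add: P_add)
  then have "P (j mod N + N * (j div N)) p = P (j mod N) p" by (simp only: P_add)
  then show ?thesis by simp
qed

lemma det_pow: "mdet (mat2_pow g j) = 1"
proof (induction j)
  case 0
  then show ?case by (simp add: mat2_pow_def mat2_id_def mdet_def)
qed (simp add: mat2_pow_Suc mdet_mult det_g)

lemma sform_P [simp]: "sform (P j p) (P j q) = sform p q"
  by (simp add: sform_mact det_pow)

lemma P_fixed: "0 < k \<Longrightarrow> k < N \<Longrightarrow> P k p = p \<Longrightarrow> p = 0"
  using mact_fixed[OF det_pow trace_pow] by blast

end

text \<open>\<open>clsr r k\<close> numbers the class of the element with translation part r and
  rotation part g^k. Conjugation replaces r by p + P j r - P k p, which \<open>clsr_rotate\<close>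
  and \<open>clsr_shift\<close> split into single rotations and shifts by the image of 1 -
  g^k.\<close>

locale rotation_classes = rotation +
  fixes clsr :: "int \<times> int \<Rightarrow> nat \<Rightarrow> nat" and repr :: "nat \<Rightarrow> (int \<times> int) \<times> nat" and d :: nat
  assumes cls_0: "clsr 0 0 < d" "repr (clsr 0 0) = (0, 0)"
    and clsr_rotate: "0 < k \<Longrightarrow> k < N \<Longrightarrow> clsr (mact g r) k = clsr r k"
    and clsr_shift: "0 < k \<Longrightarrow> k < N \<Longrightarrow> clsr (p + r - P k p) k = clsr r k"
    and clsr_less: "0 < k \<Longrightarrow> k < N \<Longrightarrow> clsr r k < d"
    and repr_range: "i < d \<Longrightarrow> repr i = (0, 0) \<or> 0 < snd (repr i) \<and> snd (repr i) < N"
    and clsr_repr: "i < d \<Longrightarrow> clsr (fst (repr i)) (snd (repr i)) = i"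
    and repr_conj: "0 < k \<Longrightarrow> k < N \<Longrightarrow> \<exists>p j. j < N \<and> repr (clsr r k) = (p + P j r - P k p, k)"
begin

lemma clsr_conj:
  assumes "0 < k" "k < N"
  shows "clsr (p + P j r - P k p) k = clsr r k"
proof -
  have "clsr (P j r) k = clsr r k"
    by (induction j) (simp_all add: P_Suc clsr_rotate assms)
  then show ?thesis by (simp add: clsr_shift assms)
qed

end

text \<open>The group \<open>\<int>\<^sup>2 \<rtimes> \<int>\<^sub>N\<close> on an arbitrary type in bijection with the basis of the crossed product,
  so that the group operations are total.\<close>

locale semidirect = rotation_classes \<theta> g N clsr repr d
  for \<theta> g N clsr repr d +
  fixes \<iota> :: "'g \<Rightarrow> (int \<times> int) \<times> nat"
  assumes \<iota>: "bij_betw \<iota> UNIV (cp_basis N)"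
begin

definition pos :: "'g \<Rightarrow> int \<times> int" where "pos x = fst (\<iota> x)"
definition idx :: "'g \<Rightarrow> nat" where "idx x = snd (\<iota> x)"
definition mk :: "int \<times> int \<Rightarrow> nat \<Rightarrow> 'g" where "mk p j = the_inv \<iota> (p, j mod N)"

lemma idx_less [simp]: "idx x < N"
  using bij_betwE[OF \<iota>] by (auto simp: idx_def cp_basis_def)

lemma idx_mod [simp]: "idx x mod N = idx x"
  by simp

lemma \<iota>_mk: "\<iota> (mk p j) = (p, j mod N)"
proof -
  have "(p, j mod N) \<in> range \<iota>" using \<iota> N by (auto simp: bij_betw_def cp_basis_def)
  then show ?thesis unfolding mk_def using \<iota> f_the_inv_into_f[of \<iota> UNIV] by (auto simp: bij_betw_def)
qed

lemma pos_mk [simp]: "pos (mk p j) = p"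
  by (simp add: pos_def \<iota>_mk)

lemma idx_mk [simp]: "idx (mk p j) = j mod N"
  by (simp add: idx_def \<iota>_mk)

lemma ext: "pos x = pos y \<Longrightarrow> idx x = idx y \<Longrightarrow> x = y"
  using \<iota> by (auto simp: pos_def idx_def bij_betw_def inj_def prod_eq_iff)

lemma eq_iff: "x = y \<longleftrightarrow> pos x = pos y \<and> idx x = idx y"
  using ext by blast

definition mul :: "'g \<Rightarrow> 'g \<Rightarrow> 'g" (infixl \<open>\<odot>\<close> 70) where
  "x \<odot> y = mk (pos x + P (idx x) (pos y)) (idx x + idx y)"

definition one :: 'g where "one = mk 0 0"

definition iv :: "'g \<Rightarrow> 'g" where
  "iv x = mk (- P (N - idx x) (pos x)) (N - idx x)"

lemma pos_mul [simp]: "pos (x \<odot> y) = pos x + P (idx x) (pos y)"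
  and idx_mul [simp]: "idx (x \<odot> y) = (idx x + idx y) mod N"
  and pos_one [simp]: "pos one = 0" and idx_one [simp]: "idx one = 0"
  and pos_iv: "pos (iv x) = - P (N - idx x) (pos x)" and idx_iv: "idx (iv x) = (N - idx x) mod N"
  by (simp_all add: mul_def one_def iv_def)

text \<open>The Weyl phase times the coboundary of \<open>quad\<close>, since the basis consists of
  plain and not of Weyl monomials.\<close>

definition \<alpha> :: "'g \<Rightarrow> 'g \<Rightarrow> complex" where
  "\<alpha> x y = phase \<theta> (quad (pos (x \<odot> y)) - quad (pos x) - quad (pos y) + sform (pos x) (P (idx x) (pos y)))"

lemma sform_add: "sform (p + q) r = sform p r + sform q r" "sform p (q + r) = sform p q + sform p r"
  by (simp_all add: sform_def algebra_simps)

lemma sform_diff: "sform (p - q) r = sform p r - sform q r" "sform p (q - r) = sform p q - sform p r"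
  by (simp_all add: sform_def algebra_simps)

lemma sform_0 [simp]: "sform 0 r = 0" "sform r 0 = 0" "sform r r = 0"
  by (simp_all add: sform_def)

lemma quad_0 [simp]: "quad 0 = 0"
  by (simp add: quad_def)

sublocale twisted_group mul one iv \<alpha>
proof
  show assoc: "x \<odot> y \<odot> z = x \<odot> (y \<odot> z)" for x y z
    by (rule ext) (simp_all add: mact_add P_add add.assoc mod_simps)
  show "one \<odot> x = x" for x by (rule ext) simp_all
  have "P (N - idx x) (P (idx x) p) = p" for x p
    using P_add[of "N - idx x" "idx x" p] by (simp add: less_imp_le)
  moreover have "N - idx x + idx x = N" for x using idx_less[of x] by linarith
  ultimately show "iv x \<odot> x = one" for x
    by (intro ext) (simp_all add: pos_iv idx_iv mod_simps)
  show "\<alpha> x y \<noteq> 0" for x y by (simp add: \<alpha>_def)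
  show "\<alpha> x y * \<alpha> (x \<odot> y) z = \<alpha> y z * \<alpha> x (y \<odot> z)" for x y z
    unfolding \<alpha>_def phase_add[symmetric] assoc
    by (rule arg_cong[where f = "phase \<theta>"]) (simp add: sform_add mact_add P_add add.assoc)
  show "\<alpha> one x = 1" "\<alpha> x one = 1" for x by (simp_all add: \<alpha>_def)
qed

lemma pos_conj: "pos (z \<odot> m \<odot> iv z) = pos z + P (idx z) (pos m) - P (idx m) (pos z)"
proof -
  have "P (idx z + idx m) (P (N - idx z) p) = P (idx m) p" for p
  proof -
    have "P (idx z + idx m) (P (N - idx z) p) = P (idx m + (idx z + (N - idx z))) p"
      by (simp only: P_add P_commute[of "idx z" "idx m"])
    also have "idx z + (N - idx z) = N" using idx_less[of z] by linarith
    finally show ?thesis by (simp add: P_add)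
  qed
  then show ?thesis by (simp add: pos_iv mact_minus)
qed

lemma idx_conj: "idx (z \<odot> m \<odot> iv z) = idx m"
proof -
  have "idx (z \<odot> m \<odot> iv z) = (idx z + idx m + (N - idx z)) mod N"
    by (simp add: idx_iv mod_simps)
  also have "idx z + idx m + (N - idx z) = idx m + N" using idx_less[of z] by linarith
  finally show ?thesis by simp
qed

lemma conj_phase_eq:
  "conj_phase z m = phase \<theta> (quad (pos (z \<odot> m \<odot> iv z)) - quad (pos m)
     + sform (pos z) (P (idx z) (pos m)) - sform (pos z) (P (idx m) (pos z))
     - sform (P (idx z) (pos m)) (P (idx m) (pos z)))"
proof -
  let ?m = "z \<odot> m \<odot> iv z"
  have "?m \<odot> z = z \<odot> m" by simp
  moreover have "sform (pos ?m) (P (idx ?m) (pos z))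
      = sform (pos z) (P (idx m) (pos z)) + sform (P (idx z) (pos m)) (P (idx m) (pos z))"
    unfolding idx_conj pos_conj by (simp add: sform_add sform_diff)
  ultimately show ?thesis
    unfolding conj_phase_def \<alpha>_def phase_diff[symmetric]
    by (simp only: \<open>?m \<odot> z = z \<odot> m\<close>) (simp add: algebra_simps del: pos_mul idx_mul)
qed

lemma centralizer_infinite: "idx m = 0 \<Longrightarrow> infinite {z. z \<odot> m = m \<odot> z}"
proof
  assume m: "idx m = 0" and f: "finite {z. z \<odot> m = m \<odot> z}"
  have "range (\<lambda>n. mk (n, 0) 0) \<subseteq> {z. z \<odot> m = m \<odot> z}"
    using m by (auto simp: eq_iff add.commute)
  then have "finite (range (\<lambda>n. mk (n, 0) 0))" using f finite_subset by blast
  moreover have "inj (\<lambda>n. mk (n, 0) 0)"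
    by (rule injI) (metis fst_conv pos_mk)
  ultimately show False using finite_imageD infinite_UNIV_int by blast
qed

text \<open>Centralizing elements with equal rotation part differ in position by a vector fixed by
  the rotation of \<open>m\<close>, hence not at all; this leaves at most N of them.\<close>

lemma centralizer_finite: "idx m \<noteq> 0 \<Longrightarrow> finite {z. z \<odot> m = m \<odot> z}"
proof -
  assume m: "idx m \<noteq> 0"
  have "inj_on idx {z. z \<odot> m = m \<odot> z}"
  proof (rule inj_onI, rule ext)
    fix x y
    assume x: "x \<in> {z. z \<odot> m = m \<odot> z}" and y: "y \<in> {z. z \<odot> m = m \<odot> z}" and i: "idx x = idx y"
    have "pos x + P (idx x) (pos m) = pos m + P (idx m) (pos x)"
      using x by (auto simp: eq_iff)
    then have "P (idx m) (pos x) = pos x + P (idx x) (pos m) - pos m" by simp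
    moreover have "pos y + P (idx x) (pos m) = pos m + P (idx m) (pos y)"
      using y i by (auto simp: eq_iff)
    then have "P (idx m) (pos y) = pos y + P (idx x) (pos m) - pos m" by simp
    ultimately have "P (idx m) (pos x - pos y) = pos x - pos y"
      by (simp add: mact_diff)
    then have "pos x - pos y = 0" by (intro P_fixed[of "idx m"]) (use m in simp_all)
    then show "pos x = pos y" by simp
  qed
  moreover have "finite (idx ` {z. z \<odot> m = m \<odot> z})"
    by (rule finite_subset[of _ "{..<N}"]) auto
  ultimately show ?thesis using finite_imageD by blast
qed

text \<open>Irrationality enters here: lambda is not a root of unity.\<close>

lemma phase_neq_1: "n \<noteq> 0 \<Longrightarrow> phase \<theta> (2 * n) \<noteq> 1"
proof
  assume n: "n \<noteq> 0" and "phase \<theta> (2 * n) = 1"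
  then have "cos (pi * \<theta> * of_int (2 * n)) = 1" by (simp add: phase_def complex_eq_iff)
  then obtain k :: int where "pi * \<theta> * of_int (2 * n) = of_int k * 2 * pi"
    using cos_one_2pi_int by blast
  then have "\<theta> * of_int n = of_int k" by simp
  then have "\<theta> = of_int k / of_int n" using n by (simp add: field_simps)
  then show False using irrational by simp
qed

text \<open>On translations \<chi> is g-invariant, so Cayley-Hamilton, g^2 p + p = tr(g) g p, gives
  (2 - tr g) \<chi> = 0. On rotations N times the value at the generator is 0.\<close>

lemma additive_zero:
  assumes \<chi>: "\<And>x y. \<chi> (x \<odot> y) = \<chi> x + (\<chi> y :: complex)"
  shows "\<chi> x = 0"
proof -
  let ?s = "mk 0 1"
  define L where "L p = \<chi> (mk p 0)" for p
  have L: "L (p + q) = L p + L q" for p q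
    using \<chi>[of "mk p 0" "mk q 0"] by (simp add: L_def mul_def)
  have one: "\<chi> one = 0" using \<chi>[of one one] by simp
  then have L0: "L 0 = 0" by (simp add: L_def one_def)
  have Lg: "L (mact g p) = L p" for p
  proof -
    have "?s \<odot> mk p 0 = mk (mact g p) 0 \<odot> ?s" using N by (intro ext) (simp_all add: P_1)
    then show ?thesis using \<chi>[of ?s "mk p 0"] \<chi>[of "mk (mact g p) 0" ?s] by (simp add: L_def)
  qed
  have Lz: "L p = 0" for p
  proof -
    obtain a b c e where h: "g = (a, b, c, e)" by (cases g) auto
    have d: "a * e - b * c = 1" using det_g by (simp add: h mdet_def)
    have ch: "mact g (mact g p) + p = (mtr g * fst (mact g p), mtr g * snd (mact g p))"
    proof -
      obtain x y where p: "p = (x, y)" by (cases p)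
      have "a * (a * x + b * y) + b * (c * x + e * y) + x = (a + e) * (a * x + b * y)" using d by algebra
      moreover have "c * (a * x + b * y) + e * (c * x + e * y) + y = (a + e) * (c * x + e * y)" using d by algebra
      ultimately show ?thesis by (simp add: h p mact_def mtr_def)
    qed
    have s: "L (mact g (mact g p) + p) = 2 * L p" by (simp add: L Lg)
    from trace_g consider "mtr g = -1" | "mtr g = 0" | "mtr g = 1" by auto
    then show ?thesis
    proof cases
      case 1
      then have "mact g (mact g p) + p + mact g p = 0" using ch by (simp add: prod_eq_iff)
      then have "3 * L p = 0" using L0 L[of "mact g (mact g p) + p" "mact g p"] s by (simp add: Lg)
      then show ?thesis by simp
    next
      case 2
      then have "mact g (mact g p) + p = 0" using ch by (simp add: zero_prod_def)
      then show ?thesis using s L0 by simp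
    next
      case 3
      then have "mact g (mact g p) + p = mact g p" using ch by simp
      then show ?thesis using s by (simp add: Lg)
    qed
  qed
  have k: "\<chi> (mk 0 j) = of_nat j * \<chi> ?s" for j
  proof (induction j)
    case (Suc j)
    have "mk 0 j \<odot> ?s = mk 0 (Suc j)" using N by (intro ext) (simp_all add: mod_simps)
    then show ?case using \<chi>[of "mk 0 j" ?s] Suc by (simp add: algebra_simps)
  qed (use one in \<open>simp add: one_def\<close>)
  have "mk 0 N = one" by (rule ext) simp_all
  then have "\<chi> ?s = 0" using k[of N] one N by simp
  then have "\<chi> (mk 0 (idx x)) = 0" using k[of "idx x"] by simp
  moreover have "\<chi> (mk (pos x) 0) = 0" using Lz[of "pos x"] unfolding L_def .
  moreover have "mk (pos x) 0 \<odot> mk 0 (idx x) = x" by (rule ext) simp_all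
  ultimately show ?thesis using \<chi>[of "mk (pos x) 0" "mk 0 (idx x)"] by simp
qed

text \<open>The rotated vector is a choice compatible with conjugation, because g commutes with its
  powers; a fixed translation would not be.\<close>

definition cc :: "'g \<Rightarrow> 'g" where "cc m = mk (mact g (pos m)) 0"
text \<open>Up to sign twice the area of the triangle of positions: invariant by determinant 1,
  closed because the signed areas of the faces of a tetrahedron cancel.\<close>

definition area :: "'g \<Rightarrow> 'g \<Rightarrow> 'g \<Rightarrow> complex" where
  "area x y z = of_int (sform (pos y - pos x) (pos z - pos x))"

lemma mact_g_P: "mact g (P j p) = P j (mact g p)"
  using P_commute[of 1 j p] by (simp add: P_1)

lemma pos_mul_diff: "pos (z \<odot> y) - pos (z \<odot> x) = P (idx z) (pos y - pos x)"
  by (simp add: mact_diff)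

sublocale crystal mul one iv \<alpha> "\<lambda>i. mk (i, 0) 0" "fst \<circ> pos" "\<lambda>i. mk (0, i) 0" "snd \<circ> pos"
  cc "mk 0 ` {..<N}" "\<lambda>z r. mk 0 (idx r + idx z)" area
proof
  fix z m :: 'g
  assume "m \<noteq> one" "infinite {z. z \<odot> m = m \<odot> z}"
  then have i: "idx m = 0" using centralizer_finite by blast
  then have p: "pos m \<noteq> 0" using \<open>m \<noteq> one\<close> by (auto simp: eq_iff)
  show "cc m \<odot> m = m \<odot> cc m" by (rule ext) (simp_all add: cc_def i add.commute)
  then have c: "cc m \<odot> m \<odot> iv (cc m) = m" by simp
  have "conj_phase (cc m) m = phase \<theta> (2 * sform (mact g (pos m)) (pos m))"
    unfolding conj_phase_eq c by (simp add: cc_def i sform_def algebra_simps)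
  then show "conj_phase (cc m) m \<noteq> 1" using phase_neq_1 definite[OF p] by simp
  show "cc (z \<odot> m \<odot> iv z) = z \<odot> cc m \<odot> iv z"
    by (rule ext) (simp_all only: pos_conj idx_conj, simp_all add: cc_def i pos_conj idx_conj mact_g_P del: pos_mul idx_mul)
next
  show "bij_betw (\<lambda>r. mk 0 (idx r + idx z)) (mk 0 ` {..<N}) (mk 0 ` {..<N})" for z
  proof (rule bij_betw_byWitness[where f' = "\<lambda>r. mk 0 (idx r + (N - idx z))"])
    have "(k + idx z + (N - idx z)) mod N = k" "(k + (N - idx z) + idx z) mod N = k" if "k < N" for k
    proof -
      have "k + idx z + (N - idx z) = k + N" "k + (N - idx z) + idx z = k + N"
        using idx_less[of z] by linarith+
      then show "(k + idx z + (N - idx z)) mod N = k" "(k + (N - idx z) + idx z) mod N = k"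
        using that by simp_all
    qed
    then show "\<forall>r\<in>mk 0 ` {..<N}. mk 0 (idx (mk 0 (idx r + idx z)) + (N - idx z)) = r"
      "\<forall>r\<in>mk 0 ` {..<N}. mk 0 (idx (mk 0 (idx r + (N - idx z))) + idx z) = r"
      by (auto simp: eq_iff mod_simps)
    have "mk 0 k = mk 0 (k mod N)" for k by (simp add: eq_iff)
    then show "(\<lambda>r. mk 0 (idx r + idx z)) ` mk 0 ` {..<N} \<subseteq> mk 0 ` {..<N}"
      "(\<lambda>r. mk 0 (idx r + (N - idx z))) ` mk 0 ` {..<N} \<subseteq> mk 0 ` {..<N}"
      using N by (auto intro!: image_eqI[where x = "_ mod N"])
  qed
  show "\<exists>i j. r \<odot> z = mk (i, 0) 0 \<odot> mk (0, j) 0 \<odot> mk 0 (idx r + idx z)" if "r \<in> mk 0 ` {..<N}" for r z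
  proof -
    have "pos r = 0" using that by auto
    then have "r \<odot> z = mk (fst (P (idx r) (pos z)), 0) 0 \<odot> mk (0, snd (P (idx r) (pos z))) 0 \<odot> mk 0 (idx r + idx z)"
      by (intro ext) simp_all
    then show ?thesis by blast
  qed
  show "finite (mk 0 ` {..<N})" "mk 0 ` {..<N} \<noteq> {}" using N by auto
  show "\<chi> x = 0" if "\<And>x y. \<chi> (x \<odot> y) = \<chi> x + (\<chi> y :: complex)" for \<chi> x
    using that by (rule additive_zero)
  show "area (z \<odot> x) (z \<odot> y) (z \<odot> w) = area x y w" for x y z w
    unfolding area_def pos_mul_diff by simp
  show "area y w v - area x w v + area x y v - area x y w = 0" for x y w v
    by (simp add: area_def sform_diff algebra_simps flip: of_int_diff of_int_add) (simp add: sform_def algebra_simps)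
  show "area one (mk (1, 0) 0) (mk (1, 0) 0 \<odot> mk (0, 1) 0) - area one (mk (0, 1) 0) (mk (1, 0) 0 \<odot> mk (0, 1) 0) \<noteq> 0"
    by (simp add: area_def sform_def)
qed (auto simp: eq_iff)

lemma fin_iff: "fin m \<longleftrightarrow> idx m \<noteq> 0"
  using centralizer_finite centralizer_infinite unfolding fin_def by blast

text \<open>The quotient is the fixed point exponent of \<open>sform_fixed_point\<close>, and
  \<open>quad\<close> passes from Weyl to plain monomials. At \<open>one\<close> the quotient is 0 /
  0 = 0 and the value is 1.\<close>

definition \<upsilon> :: "'g \<Rightarrow> complex" where
  "\<upsilon> m = cis (pi * \<theta> * (real_of_int (sform (pos m) (P (idx m) (pos m)))
     / real_of_int (2 - mtr (mat2_pow g (idx m))) - real_of_int (quad (pos m))))"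

lemma \<upsilon>_conj_raw:
  assumes "idx m \<noteq> 0"
  shows "conj_phase z m * \<upsilon> (z \<odot> m \<odot> iv z) = \<upsilon> m"
proof -
  let ?h = "mat2_pow g (idx m)"
  let ?p = "pos z" and ?s = "P (idx z) (pos m)" and ?D = "real_of_int (2 - mtr ?h)"
  let ?r = "?p + ?s - mact ?h ?p"
  have "2 - mtr ?h \<noteq> 0" using trace_pow[of "idx m"] assms by simp
  then have D: "?D \<noteq> 0" by (simp only: of_int_eq_0_iff) simp
  have "sform ?s (mact ?h ?s) = sform (pos m) (mact ?h (pos m))"
    using sform_P[of "idx z" "pos m" "mact ?h (pos m)"] P_commute[of "idx m" "idx z" "pos m"] by simp
  with sform_fixed_point[OF det_pow[of "idx m"], of ?p ?s]
  have "real_of_int ((2 - mtr ?h) * (sform ?p ?s - sform ?p (mact ?h ?p) - sform ?s (mact ?h ?p))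
      + sform ?r (mact ?h ?r)) = real_of_int (sform (pos m) (mact ?h (pos m)))" by simp
  then have "?D * real_of_int (sform ?p ?s - sform ?p (mact ?h ?p) - sform ?s (mact ?h ?p))
      + real_of_int (sform ?r (mact ?h ?r)) = real_of_int (sform (pos m) (mact ?h (pos m)))"
    by (simp only: of_int_add of_int_mult)
  moreover have "X + Y / D = Z / D" if "D * X + Y = Z" "D \<noteq> 0" for X Y Z D :: real
    using that by (auto simp: field_simps)
  ultimately have key: "real_of_int (sform ?p ?s - sform ?p (mact ?h ?p) - sform ?s (mact ?h ?p))
      + real_of_int (sform ?r (mact ?h ?r)) / ?D = real_of_int (sform (pos m) (mact ?h (pos m))) / ?D"
    using D by blast
  show ?thesis
    unfolding \<upsilon>_def conj_phase_eq phase_def cis_mult idx_conj pos_conj distrib_left[symmetric]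
    unfolding key[symmetric] by (simp add: algebra_simps)
qed

sublocale crystal_traces mul one iv \<alpha> "\<lambda>i. mk (i, 0) 0" "fst \<circ> pos" "\<lambda>i. mk (0, i) 0" "snd \<circ> pos"
  cc "mk 0 ` {..<N}" "\<lambda>z r. mk 0 (idx r + idx z)" area
  \<upsilon> "\<lambda>m. clsr (pos m) (idx m)" "\<lambda>i. mk (fst (repr i)) (snd (repr i))" d
proof
  fix m :: 'g
  show "\<upsilon> m \<noteq> 0" by (simp add: \<upsilon>_def)
  assume m: "m = one \<or> fin m"
  show "conj_phase z m * \<upsilon> (z \<odot> m \<odot> iv z) = \<upsilon> m" for z
    using m \<upsilon>_conj_raw[of m z] by (auto simp: fin_iff)
  show "clsr (pos (z \<odot> m \<odot> iv z)) (idx (z \<odot> m \<odot> iv z)) = clsr (pos m) (idx m)" for z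
    using m clsr_conj[of "idx m" "pos z" "idx z" "pos m"]
    by (auto simp: fin_iff pos_conj idx_conj simp del: pos_mul idx_mul)
  show "clsr (pos m) (idx m) < d"
    using m clsr_less[of "idx m" "pos m"] cls_0 by (auto simp: fin_iff)
  show "\<exists>z. z \<odot> m \<odot> iv z = mk (fst (repr (clsr (pos m) (idx m)))) (snd (repr (clsr (pos m) (idx m))))"
  proof (cases "m = one")
    case True
    then show ?thesis using cls_0 by (intro exI[of _ one]) (simp add: eq_iff zero_prod_def)
  next
    case False
    then have i: "idx m \<noteq> 0" using m by (simp add: fin_iff)
    then obtain p j where j: "j < N" and r: "repr (clsr (pos m) (idx m)) = (p + P j (pos m) - P (idx m) p, idx m)"
      using repr_conj[of "idx m" "pos m"] by auto
    show ?thesis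
      by (intro exI[of _ "mk p j"] ext) (simp_all only: pos_conj idx_conj, simp_all add: r j)
  qed
next
  fix i assume i: "i < d"
  have "snd (repr i) < N" using repr_range[OF i] N by auto
  then show "clsr (pos (mk (fst (repr i)) (snd (repr i)))) (idx (mk (fst (repr i)) (snd (repr i)))) = i"
    using clsr_repr[OF i] by simp
  show "mk (fst (repr i)) (snd (repr i)) = one \<or> fin (mk (fst (repr i)) (snd (repr i)))"
    using repr_range[OF i] by (auto simp: fin_iff eq_iff zero_prod_def)
qed

lemma basis_transport: "basis_transport \<iota> (cp_basis N) (cp_mult \<theta> g N) gmult"
proof
  show "inj \<iota>" "range \<iota> = cp_basis N" using \<iota> by (simp_all add: bij_betw_def)
  have m: "cp_mult \<theta> g N (\<iota> x) (\<iota> y) = (\<lambda>z. if z = \<iota> (x \<odot> y) then \<alpha> x y else 0)" for x y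
  proof -
    have "\<iota> (x \<odot> y) = (pos x + P (idx x) (pos y), (idx x + idx y) mod N)"
      by (simp add: mul_def \<iota>_mk)
    then show ?thesis
      unfolding \<alpha>_def pos_mul by (simp add: cp_mult_eq[OF det_pow] Let_def pos_def idx_def cong: if_cong)
  qed
  show "cp_mult \<theta> g N (\<iota> x) (\<iota> y) (\<iota> z) = gmult x y z" for x y z
    using \<open>inj \<iota>\<close> by (simp add: m gmult_def inj_eq)
  show "cp_mult \<theta> g N (\<iota> x) (\<iota> y) b = 0" if "b \<notin> cp_basis N" for b x y
    using that \<open>range \<iota> = cp_basis N\<close> by (auto simp: m)
qed

lemma \<iota>_one: "\<iota> one = cp_unit"
  unfolding one_def \<iota>_mk cp_unit_def zero_prod_def by simp

lemma HP_dims: "HP_dim \<theta> g N 0 (Suc d)" "HP_dim \<theta> g N 1 0"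
  unfolding HP_dim_def \<iota>_one[symmetric]
  using basis_transport.quot_dim_transport[OF basis_transport] HP_even HP_odd by blast+

end

lemma (in rotation_classes) HP_dims: "HP_dim \<theta> g N 0 (Suc d) \<and> HP_dim \<theta> g N 1 0"
proof -
  have "infinite (cp_basis N)"
  proof
    assume "finite (cp_basis N)"
    moreover have "range (\<lambda>n. ((n, 0), 0)) \<subseteq> cp_basis N" using N by (auto simp: cp_basis_def)
    ultimately have "finite (range (\<lambda>n :: int. ((n, 0 :: int), 0 :: nat)))" using finite_subset by blast
    moreover have "inj (\<lambda>n :: int. ((n, 0 :: int), 0 :: nat))" by (rule injI) simp
    ultimately show False using finite_imageD infinite_UNIV_int by blast
  qed
  \<comment> \<open>The basis is countably infinite, so the type of natural numbers can carry the
    group.\<close>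
  then interpret semidirect \<theta> g N clsr repr d "from_nat_into (cp_basis N)"
    by unfold_locales (rule bij_betw_from_nat_into, simp)
  show ?thesis using HP_dims by simp
qed

section \<open>Conjugacy classes for the three rotation groups\<close>

text \<open>The cokernel of 1 - g^k has order 3, is detected by y - x modulo 3, and is fixed by
  rotation. The offset 3 k - 2 gives the numbers 1 to 3 to k = 1 and 4 to 6 to k = 2.\<close>

definition cls_Z3 :: "int \<times> int \<Rightarrow> nat \<Rightarrow> nat" where
  "cls_Z3 p k = (if k = 0 then 0 else 3 * k - 2 + nat ((snd p - fst p) mod 3))"

definition rep_Z3 :: "nat \<Rightarrow> (int \<times> int) \<times> nat" where
  "rep_Z3 i = [((0, 0), 0), ((0, 0), 1), ((0, 1), 1), ((0, 2), 1), ((0, 0), 2), ((0, 1), 2), ((0, 2), 2)] ! i"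

text \<open>For k = 1, 3 the cokernel has order 2. For k = 2 it is the lattice modulo 2, where
  rotation swaps (1,0) and (0,1), leaving three orbits.\<close>

definition cls_Z4 :: "int \<times> int \<Rightarrow> nat \<Rightarrow> nat" where
  "cls_Z4 p k = (if k = 0 then 0
     else if k = 2 then (if even (fst p) \<and> even (snd p) then 5 else if even (fst p + snd p) then 6 else 7)
     else k + (if even (fst p + snd p) then 0 else 1))"

definition rep_Z4 :: "nat \<Rightarrow> (int \<times> int) \<times> nat" where
  "rep_Z4 i = [((0, 0), 0), ((0, 0), 1), ((0, 1), 1), ((0, 0), 3), ((0, 1), 3),
     ((0, 0), 2), ((1, 1), 2), ((0, 1), 2)] ! i"

text \<open>For k = 1, 5 the cokernel is trivial. For k = 2, 4 it has order 3 and g acts by -1,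
  leaving two orbits; for k = 3 it is the lattice modulo 2, whose non-zero vectors g permutes
  cyclically.\<close>

definition cls_Z6 :: "int \<times> int \<Rightarrow> nat \<Rightarrow> nat" where
  "cls_Z6 p k = (if k = 0 then 0 else if k = 1 then 1 else if k = 5 then 2
     else if k = 3 then (if even (fst p) \<and> even (snd p) then 7 else 8)
     else k + (if 3 dvd (snd p - fst p) then 1 else 2))"

definition rep_Z6 :: "nat \<Rightarrow> (int \<times> int) \<times> nat" where
  "rep_Z6 i = [((0, 0), 0), ((0, 0), 1), ((0, 0), 5), ((0, 0), 2), ((0, 1), 2),
     ((0, 0), 4), ((0, 1), 4), ((0, 0), 3), ((0, 1), 3)] ! i"

lemmas mat2_pow_simps = mat2_pow_def mat2_mult_def mat2_id_def numeral_eq_Suc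

text \<open>Up to sign, the forms \<open>sform (mact g p) p\<close> for the generator of order 4 and
  for those of orders 3 and 6.\<close>

lemma sum_squares_pos:
  fixes x y :: int
  assumes "x \<noteq> 0 \<or> y \<noteq> 0"
  shows "0 < x * x + y * y" "0 < x * x + x * y + y * y"
proof -
  show *: "0 < x * x + y * y" using assms by (metis not_sum_squares_lt_zero sum_squares_eq_zero_iff linorder_neqE)
  have "0 \<le> (x + y) * (x + y)" by simp
  then have "0 \<le> x * x + 2 * (x * y) + y * y" by (simp add: algebra_simps)
  then show "0 < x * x + x * y + y * y" using * by linarith
qed

lemma pow_Z3: "mat2_pow gen_Z3 0 = (1, 0, 0, 1)" "mat2_pow gen_Z3 (Suc 0) = (0, 1, -1, -1)"
  "mat2_pow gen_Z3 2 = (-1, -1, 1, 0)" "mat2_pow gen_Z3 3 = (1, 0, 0, 1)"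
  by (simp_all add: mat2_pow_simps gen_Z3_def)

lemma pow_Z4: "mat2_pow gen_Z4 0 = (1, 0, 0, 1)" "mat2_pow gen_Z4 (Suc 0) = (0, 1, -1, 0)"
  "mat2_pow gen_Z4 2 = (-1, 0, 0, -1)" "mat2_pow gen_Z4 3 = (0, -1, 1, 0)"
  "mat2_pow gen_Z4 4 = (1, 0, 0, 1)"
  by (simp_all add: mat2_pow_simps gen_Z4_def)

lemma pow_Z6: "mat2_pow gen_Z6 0 = (1, 0, 0, 1)" "mat2_pow gen_Z6 (Suc 0) = (0, -1, 1, 1)"
  "mat2_pow gen_Z6 2 = (-1, -1, 1, 0)" "mat2_pow gen_Z6 3 = (-1, 0, 0, -1)"
  "mat2_pow gen_Z6 4 = (0, 1, -1, -1)" "mat2_pow gen_Z6 5 = (1, 1, -1, 0)"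
  "mat2_pow gen_Z6 6 = (1, 0, 0, 1)"
  by (simp_all add: mat2_pow_simps gen_Z6_def)

lemma below_3: "0 < k \<Longrightarrow> k < (3 :: nat) \<Longrightarrow> k = 1 \<or> k = 2"
  and below_4: "0 < k \<Longrightarrow> k < (4 :: nat) \<Longrightarrow> k = 1 \<or> k = 2 \<or> k = 3"
  and below_6: "0 < k \<Longrightarrow> k < (6 :: nat) \<Longrightarrow> k = 1 \<or> k = 2 \<or> k = 3 \<or> k = 4 \<or> k = 5"
  by linarith+

lemma rotation_Z3: "\<theta> \<notin> \<rat> \<Longrightarrow> rotation \<theta> gen_Z3 3"
proof
  show "mtr (mat2_pow gen_Z3 k) \<noteq> 2" if "0 < k" "k < 3" for k
    using below_3[OF that] pow_Z3 by (auto simp: mtr_def)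
  show "sform (mact gen_Z3 p) p \<noteq> 0" if "p \<noteq> 0" for p
    using sum_squares_pos(2)[of "fst p" "snd p"] that
    by (auto simp: sform_def mact_def gen_Z3_def prod_eq_iff algebra_simps)
qed (auto simp: mdet_def mtr_def gen_Z3_def pow_Z3[unfolded gen_Z3_def] mat2_id_def)

lemma rotation_Z4: "\<theta> \<notin> \<rat> \<Longrightarrow> rotation \<theta> gen_Z4 4"
proof
  show "mtr (mat2_pow gen_Z4 k) \<noteq> 2" if "0 < k" "k < 4" for k
    using below_4[OF that] pow_Z4 by (auto simp: mtr_def)
  show "sform (mact gen_Z4 p) p \<noteq> 0" if "p \<noteq> 0" for p
    using sum_squares_pos(1)[of "fst p" "snd p"] that
    by (auto simp: sform_def mact_def gen_Z4_def prod_eq_iff algebra_simps)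
qed (auto simp: mdet_def mtr_def gen_Z4_def pow_Z4[unfolded gen_Z4_def] mat2_id_def)

lemma rotation_Z6: "\<theta> \<notin> \<rat> \<Longrightarrow> rotation \<theta> gen_Z6 6"
proof
  show "mtr (mat2_pow gen_Z6 k) \<noteq> 2" if "0 < k" "k < 6" for k
    using below_6[OF that] pow_Z6 by (auto simp: mtr_def)
  show "sform (mact gen_Z6 p) p \<noteq> 0" if "p \<noteq> 0" for p
    using sum_squares_pos(2)[of "fst p" "snd p"] that
    by (auto simp: sform_def mact_def gen_Z6_def prod_eq_iff algebra_simps)
qed (auto simp: mdet_def mtr_def gen_Z6_def pow_Z6[unfolded gen_Z6_def] mat2_id_def)

lemma classes_Z3:
  assumes "\<theta> \<notin> \<rat>"
  shows "rotation_classes \<theta> gen_Z3 3 cls_Z3 rep_Z3 7"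
proof -
  interpret rotation \<theta> gen_Z3 3 using assms by (rule rotation_Z3)
  show ?thesis
  proof
    show "cls_Z3 0 0 < 7" "rep_Z3 (cls_Z3 0 0) = (0, 0)"
      by (simp_all add: cls_Z3_def rep_Z3_def zero_prod_def)
  next
    fix k :: nat and p r :: "int \<times> int"
    assume k: "0 < k" "k < 3"
    obtain x y where r: "r = (x, y)" by (cases r)
    obtain a b where p: "p = (a, b)" by (cases p)
    show "cls_Z3 (mact gen_Z3 r) k = cls_Z3 r k"
    proof -
      have "(- x - y - y) mod 3 = (y - x) mod 3" by presburger
      then show ?thesis by (simp add: cls_Z3_def mact_def gen_Z3_def r)
    qed
    show "cls_Z3 (p + r - P k p) k = cls_Z3 r k"
      using below_3[OF k]
    proof
      assume "k = 1"
      moreover have "(b + y - (- a - b) - (a + x - b)) mod 3 = (y - x) mod 3" by presburger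
      ultimately show ?thesis by (simp add: cls_Z3_def mact_def pow_Z3 p r)
    next
      assume "k = 2"
      moreover have "(b + y - a - (a + x - (- a - b))) mod 3 = (y - x) mod 3" by presburger
      ultimately show ?thesis by (simp add: cls_Z3_def mact_def pow_Z3 p r)
    qed
    have m: "nat ((y - x) mod 3) = 0 \<and> (y - x) mod 3 = 0 \<or> nat ((y - x) mod 3) = 1 \<and> (y - x) mod 3 = 1
        \<or> nat ((y - x) mod 3) = 2 \<and> (y - x) mod 3 = 2"
      using pos_mod_bound[of 3 "y - x"] pos_mod_sign[of 3 "y - x"] by linarith
    then show "cls_Z3 r k < 7" using k by (auto simp: cls_Z3_def r)
    show "\<exists>p j. j < 3 \<and> rep_Z3 (cls_Z3 r k) = (p + P j r - P k p, k)"
      using below_3[OF k]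
    proof
      assume k: "k = 1"
      have "rep_Z3 (cls_Z3 r k) = ((0, (y - x) mod 3), 1)"
        using m by (auto simp: rep_Z3_def cls_Z3_def r k)
      moreover have "\<exists>a b. a + x - b = 0 \<and> b + y - (- a - b) = (y - x) mod 3" by presburger
      then obtain a b where "a + x - b = 0" "b + y - (- a - b) = (y - x) mod 3" by blast
      ultimately show ?thesis
        by (intro exI[of _ "(a, b)"] exI[of _ 0]) (simp add: mact_def pow_Z3 r k)
    next
      assume k: "k = 2"
      have "rep_Z3 (cls_Z3 r k) = ((0, (y - x) mod 3), 2)"
        using m by (auto simp: rep_Z3_def cls_Z3_def r k)
      moreover have "\<exists>a b. a + x - (- a - b) = 0 \<and> b + y - a = (y - x) mod 3" by presburger
      then obtain a b where "a + x - (- a - b) = 0" "b + y - a = (y - x) mod 3" by blast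
      ultimately show ?thesis
        by (intro exI[of _ "(a, b)"] exI[of _ 0]) (simp add: mact_def pow_Z3 r k)
    qed
  next
    fix i :: nat assume "i < 7"
    then have i: "i = 0 \<or> i = 1 \<or> i = 2 \<or> i = 3 \<or> i = 4 \<or> i = 5 \<or> i = 6" by linarith
    then show "rep_Z3 i = (0, 0) \<or> 0 < snd (rep_Z3 i) \<and> snd (rep_Z3 i) < 3"
      by (auto simp: rep_Z3_def zero_prod_def)
    show "cls_Z3 (fst (rep_Z3 i)) (snd (rep_Z3 i)) = i"
      using i by (auto simp: rep_Z3_def cls_Z3_def)
  qed
qed

lemma classes_Z4:
  assumes "\<theta> \<notin> \<rat>"
  shows "rotation_classes \<theta> gen_Z4 4 cls_Z4 rep_Z4 8"
proof -
  interpret rotation \<theta> gen_Z4 4 using assms by (rule rotation_Z4)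
  show ?thesis
  proof
    show "cls_Z4 0 0 < 8" "rep_Z4 (cls_Z4 0 0) = (0, 0)"
      by (simp_all add: cls_Z4_def rep_Z4_def zero_prod_def)
  next
    fix k :: nat and p r :: "int \<times> int"
    assume k: "0 < k" "k < 4"
    obtain x y where r: "r = (x, y)" by (cases r)
    obtain a b where p: "p = (a, b)" by (cases p)
    show "cls_Z4 (mact gen_Z4 r) k = cls_Z4 r k"
      by (auto simp: cls_Z4_def mact_def gen_Z4_def r)
    show "cls_Z4 (p + r - P k p) k = cls_Z4 r k"
      using below_4[OF k] by (auto simp: cls_Z4_def mact_def pow_Z4 p r)
    show "cls_Z4 r k < 8" using below_4[OF k] by (auto simp: cls_Z4_def)
    consider "k = 1" | "k = 2" | "k = 3" using below_4[OF k] by blast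
    then show "\<exists>p j. j < 4 \<and> rep_Z4 (cls_Z4 r k) = (p + P j r - P k p, k)"
    proof cases
      case 1
      have "rep_Z4 (cls_Z4 r k) = ((0, (x + y) mod 2), 1)"
        by (cases "even (x + y)") (auto simp: rep_Z4_def cls_Z4_def r 1 even_iff_mod_2_eq_zero odd_iff_mod_2_eq_one)
      moreover have "\<exists>a b. a + x - b = 0 \<and> b + y + a = (x + y) mod 2" by presburger
      then obtain a b where "a + x - b = 0" "b + y + a = (x + y) mod 2" by blast
      ultimately show ?thesis
        by (intro exI[of _ "(a, b)"] exI[of _ 0]) (simp add: mact_def pow_Z4 r 1)
    next
      case 2
      consider "even x" "even y" | "even x" "odd y" | "odd x" "even y" | "odd x" "odd y" by blast
      then show ?thesis
      proof cases
        case 1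
        then obtain a b where "x = 2 * a" "y = 2 * b" by (auto elim!: evenE)
        then show ?thesis using \<open>k = 2\<close>
          by (intro exI[of _ "(- a, - b)"] exI[of _ 0]) (auto simp: cls_Z4_def rep_Z4_def mact_def pow_Z4 r zero_prod_def)
      next
        case 2
        then obtain a b where "x = 2 * a" "y = 2 * b + 1" by (auto elim!: evenE oddE)
        then show ?thesis using \<open>k = 2\<close>
          by (intro exI[of _ "(- a, - b)"] exI[of _ 0]) (auto simp: cls_Z4_def rep_Z4_def mact_def pow_Z4 r zero_prod_def)
      next
        \<comment> \<open>The residue (1,0) needs one rotation, j = 1, to reach the representative
          (0,1).\<close>
        case 3
        then obtain a b where "x = 2 * a + 1" "y = 2 * b" by (auto elim!: evenE oddE)
        then show ?thesis using \<open>k = 2\<close>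
          by (intro exI[of _ "(- b, a + 1)"] exI[of _ 1]) (auto simp: cls_Z4_def rep_Z4_def mact_def pow_Z4 r zero_prod_def)
      next
        case 4
        then obtain a b where "x = 2 * a + 1" "y = 2 * b + 1" by (auto elim!: oddE)
        then show ?thesis using \<open>k = 2\<close>
          by (intro exI[of _ "(- a, - b)"] exI[of _ 0]) (auto simp: cls_Z4_def rep_Z4_def mact_def pow_Z4 r zero_prod_def)
      qed
    next
      case 3
      have "rep_Z4 (cls_Z4 r k) = ((0, (x + y) mod 2), 3)"
        by (cases "even (x + y)") (auto simp: rep_Z4_def cls_Z4_def r 3 even_iff_mod_2_eq_zero odd_iff_mod_2_eq_one)
      moreover have "\<exists>a b. a + x + b = 0 \<and> b + y - a = (x + y) mod 2" by presburger
      then obtain a b where "a + x + b = 0" "b + y - a = (x + y) mod 2" by blast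
      ultimately show ?thesis
        by (intro exI[of _ "(a, b)"] exI[of _ 0]) (simp add: mact_def pow_Z4 r 3)
    qed
  next
    fix i :: nat assume "i < 8"
    then have i: "i = 0 \<or> i = 1 \<or> i = 2 \<or> i = 3 \<or> i = 4 \<or> i = 5 \<or> i = 6 \<or> i = 7" by linarith
    then show "rep_Z4 i = (0, 0) \<or> 0 < snd (rep_Z4 i) \<and> snd (rep_Z4 i) < 4"
      by (auto simp: rep_Z4_def zero_prod_def)
    show "cls_Z4 (fst (rep_Z4 i)) (snd (rep_Z4 i)) = i"
      using i by (auto simp: rep_Z4_def cls_Z4_def)
  qed
qed

lemma classes_Z6:
  assumes "\<theta> \<notin> \<rat>"
  shows "rotation_classes \<theta> gen_Z6 6 cls_Z6 rep_Z6 9"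
proof -
  interpret rotation \<theta> gen_Z6 6 using assms by (rule rotation_Z6)
  show ?thesis
  proof
    show "cls_Z6 0 0 < 9" "rep_Z6 (cls_Z6 0 0) = (0, 0)"
      by (simp_all add: cls_Z6_def rep_Z6_def zero_prod_def)
  next
    fix k :: nat and p r :: "int \<times> int"
    assume k: "0 < k" "k < 6"
    obtain x y where r: "r = (x, y)" by (cases r)
    obtain a b where p: "p = (a, b)" by (cases p)
    have "(3 dvd (x + y - (- y))) = (3 dvd (y - x))" by presburger
    then show "cls_Z6 (mact gen_Z6 r) k = cls_Z6 r k"
      by (auto simp: cls_Z6_def mact_def gen_Z6_def r)
    have "(3 dvd (b + y - a - (a + x - (- a - b)))) = (3 dvd (y - x))"
      "(3 dvd (b + y - (- a - b) - (a + x - b))) = (3 dvd (y - x))" by presburger+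
    then show "cls_Z6 (p + r - P k p) k = cls_Z6 r k"
      using below_6[OF k] by (auto simp: cls_Z6_def mact_def pow_Z6 p r)
    show "cls_Z6 r k < 9" using below_6[OF k] by (auto simp: cls_Z6_def)
    have third: "\<exists>a. 3 * a = z - 1" if "z mod 3 = 1" for z :: int using that by presburger
    \<comment> \<open>\<open>x + y - (- y)\<close> is the difference of coordinates of
      \<open>mact g r\<close>: one rotation turns the residue 2 into 1.\<close>
    have residues: "(y - x) mod 3 = 0 \<or> (y - x) mod 3 = 1 \<or> (x + y - (- y)) mod 3 = 1" by presburger
    consider "k = 1" | "k = 2" | "k = 3" | "k = 4" | "k = 5" using below_6[OF k] by blast
    then show "\<exists>p j. j < 6 \<and> rep_Z6 (cls_Z6 r k) = (p + P j r - P k p, k)"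
    proof cases
      case 1
      then show ?thesis
        by (intro exI[of _ "(y, - x - y)"] exI[of _ 0]) (simp add: cls_Z6_def rep_Z6_def mact_def pow_Z6 r zero_prod_def)
    next
      case 2
      consider "(y - x) mod 3 = 0" | "(y - x) mod 3 = 1" | "(x + y - (- y)) mod 3 = 1"
        using residues by blast
      then show ?thesis
      proof cases
        case 1
        \<comment> \<open>The witness (a, b) solves p - g^2 p = - r: the second coordinate gives b =
          a - y, the first then 3 a = y - x.\<close>
        then obtain a where "y - x = 3 * a" by auto
        then show ?thesis
          using \<open>k = 2\<close>
          by (intro exI[of _ "(a, a - y)"] exI[of _ 0]) (auto simp: cls_Z6_def rep_Z6_def mact_def pow_Z6 r zero_prod_def)
      next
        case 2
        then have "\<not> 3 dvd (y - x)" by presburger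
        moreover obtain a where "3 * a = y - x - 1" using third[OF 2] by blast
        ultimately show ?thesis using \<open>k = 2\<close>
          by (intro exI[of _ "(a, a + 1 - y)"] exI[of _ 0]) (auto simp: cls_Z6_def rep_Z6_def mact_def pow_Z6 r zero_prod_def)
      next
        case 3
        then have "\<not> 3 dvd (y - x)" by presburger
        moreover obtain a where "3 * a = x + y - (- y) - 1" using third[OF 3] by blast
        ultimately show ?thesis using \<open>k = 2\<close>
          by (intro exI[of _ "(a, a + 1 - (x + y))"] exI[of _ 1]) (auto simp: cls_Z6_def rep_Z6_def mact_def pow_Z6 r zero_prod_def)
      qed
    next
      case 3
      consider "even x" "even y" | "even x" "odd y" | "odd x" "even y" | "odd x" "odd y" by blast
      then show ?thesis
      proof cases
        case 1
        then obtain a b where "x = 2 * a" "y = 2 * b" by (auto elim!: evenE)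
        then show ?thesis using \<open>k = 3\<close>
          by (intro exI[of _ "(- a, - b)"] exI[of _ 0]) (auto simp: cls_Z6_def rep_Z6_def mact_def pow_Z6 r zero_prod_def)
      next
        case 2
        then obtain a b where "x = 2 * a" "y = 2 * b + 1" by (auto elim!: evenE oddE)
        then show ?thesis using \<open>k = 3\<close>
          by (intro exI[of _ "(- a, - b)"] exI[of _ 0]) (auto simp: cls_Z6_def rep_Z6_def mact_def pow_Z6 r zero_prod_def)
      next
        case 3
        then obtain a b where "x = 2 * a + 1" "y = 2 * b" by (auto elim!: evenE oddE)
        then show ?thesis using \<open>k = 3\<close>
          by (intro exI[of _ "(b, - a - b)"] exI[of _ 1]) (auto simp: cls_Z6_def rep_Z6_def mact_def pow_Z6 r zero_prod_def)
      next
        \<comment> \<open>Modulo 2 the generator takes (1,1) to (1,0) and then to (0,1), hence j =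
          2.\<close>
        case 4
        then obtain a b where "x = 2 * a + 1" "y = 2 * b + 1" by (auto elim!: oddE)
        then show ?thesis using \<open>k = 3\<close>
          by (intro exI[of _ "(a + b + 1, - a)"] exI[of _ 2]) (auto simp: cls_Z6_def rep_Z6_def mact_def pow_Z6 r zero_prod_def)
      qed
    next
      case 4
      consider "(y - x) mod 3 = 0" | "(y - x) mod 3 = 1" | "(x + y - (- y)) mod 3 = 1"
        using residues by blast
      then show ?thesis
      proof cases
        case 1
        then obtain a where "y - x = 3 * a" by auto
        then show ?thesis using \<open>k = 4\<close>
          by (intro exI[of _ "(- a - x, - a)"] exI[of _ 0]) (auto simp: cls_Z6_def rep_Z6_def mact_def pow_Z6 r zero_prod_def)
      next
        case 2
        then have "\<not> 3 dvd (y - x)" by presburger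
        moreover obtain a where "3 * a = y - x - 1" using third[OF 2] by blast
        ultimately show ?thesis using \<open>k = 4\<close>
          by (intro exI[of _ "(- a - x, - a)"] exI[of _ 0]) (auto simp: cls_Z6_def rep_Z6_def mact_def pow_Z6 r zero_prod_def)
      next
        case 3
        then have "\<not> 3 dvd (y - x)" by presburger
        moreover obtain a where "3 * a = x + y - (- y) - 1" using third[OF 3] by blast
        ultimately show ?thesis using \<open>k = 4\<close>
          by (intro exI[of _ "(- a + y, - a)"] exI[of _ 1]) (auto simp: cls_Z6_def rep_Z6_def mact_def pow_Z6 r zero_prod_def)
      qed
    next
      case 5
      then show ?thesis
        by (intro exI[of _ "(- x - y, x)"] exI[of _ 0]) (simp add: cls_Z6_def rep_Z6_def mact_def pow_Z6 r zero_prod_def)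
    qed
  next
    fix i :: nat assume "i < 9"
    then have i: "i = 0 \<or> i = 1 \<or> i = 2 \<or> i = 3 \<or> i = 4 \<or> i = 5 \<or> i = 6 \<or> i = 7 \<or> i = 8" by linarith
    then show "rep_Z6 i = (0, 0) \<or> 0 < snd (rep_Z6 i) \<and> snd (rep_Z6 i) < 6"
      by (auto simp: rep_Z6_def zero_prod_def)
    show "cls_Z6 (fst (rep_Z6 i)) (snd (rep_Z6 i)) = i"
      using i by (auto simp: rep_Z6_def cls_Z6_def)
  qed
qed

theorem theorem2p2:
  fixes \<theta> :: real
  assumes "\<theta> \<notin> \<rat>"
  shows "HP_even_dim \<theta> gen_Z3 3 8 \<and> HP_even_dim \<theta> gen_Z4 4 9 \<and> HP_even_dim \<theta> gen_Z6 6 10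
       \<and> HP_odd_dim \<theta> gen_Z3 3 0 \<and> HP_odd_dim \<theta> gen_Z4 4 0 \<and> HP_odd_dim \<theta> gen_Z6 6 0"
  using rotation_classes.HP_dims[OF classes_Z3[OF assms]]
    rotation_classes.HP_dims[OF classes_Z4[OF assms]]
    rotation_classes.HP_dims[OF classes_Z6[OF assms]]
  by simp

end
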